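(* Let $G$ be a finitely generated free group, and let $H \leq G$ be a subgroup of finite index. Let $G$ act on a standard probability space $(X,\mu)$ by measure preserving bijections, and let $H$ act on $(X,\mu)$ by restricting the action of $G$. Assume that the f-invariant entropy is defined for either the $G$ action or the $H$ action. Then the f-invariant entropy is defined for both actions and $$f_H(X,\mu) = |G:H| \cdot f_G(X,\mu).$$
   Context: For a countable measurable partition $\alpha$ of $X$, $g\in G$ and finite $F\subseteq G$, put $g\cdot\alpha=\{g\cdot A : A\in\alpha\}$ and $F\cdot\alpha=\bigvee_{f\in F} f\cdot\alpha$ (join of partitions). The Shannon entropy is $\mathrm{H}(\alpha)=\sum_{A\in\alpha}-\mu(A)\log\mu(A)$. A countable measurable partition $\alpha$ is generating for an action of a group $G$ if the smallest $G$-invariant $\sigma$-algebra containing $\alpha$ contains all measurable sets up to null sets. f-invariant entropy: let $G$ be a finitely generated free group with free generating set $S$, $r=|S|$, acting measure preservingly on a standard probability space $(X,\mu)$. For $\alpha$ with $\mathrm{H}(\alpha)<\infty$ set $F_G(X,\mu,S,\alpha)=(1-2r)\mathrm{H}(\alpha)+\sum_{s\in S}\mathrm{H}(s\cdot\alpha\vee\alpha)$. Let $B_S(n)$ be the ball of radius $n$ about $1_G$ for the $S$-word length. If there is a generating partition $\alpha$ with $\mathrm{H}(\alpha)<\infty$, define $f_G(X,\mu)=\lim_{n\to\infty}F_G(X,\mu,S,B_S(n)\cdot\alpha)$; otherwise $f_G(X,\mu)$ is undefined. By theorems of Bowen the sequence is non-increasing, so the limit exists in $[-\infty,\infty)$,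 and it does not depend on the choice of $S$ or of the finite Shannon entropy generating partition $\alpha$. *)

theory Defs
  imports "HOL-Probability.Probability" "HOL-Algebra.Algebra"
begin

section \<open>Free groups\<close>

text \<open>A letter \<open>(True, s)\<close> stands for \<open>s\<close>, a letter \<open>(False, s)\<close> for the inverse of \<open>s\<close>.\<close>

definition letter_value :: "('g, 'b) monoid_scheme \<Rightarrow> bool \<times> 'g \<Rightarrow> 'g" where
  "letter_value G l = (if fst l then snd l else inv\<^bsub>G\<^esub> (snd l))"

definition word_value :: "('g, 'b) monoid_scheme \<Rightarrow> (bool \<times> 'g) list \<Rightarrow> 'g" where
  "word_value G w = foldr (\<lambda>l g. letter_value G l \<otimes>\<^bsub>G\<^esub> g) w \<one>\<^bsub>G\<^esub>"

definition words_over :: "'g set \<Rightarrow> (bool \<times> 'g) list set" where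
  "words_over S = {w. snd ` set w \<subseteq> S}"

definition reduced_word :: "(bool \<times> 'g) list \<Rightarrow> bool" where
  "reduced_word w \<longleftrightarrow> successively (\<lambda>l m. \<not> (snd l = snd m \<and> fst l \<noteq> fst m)) w"

definition free_generating_set :: "('g, 'b) monoid_scheme \<Rightarrow> 'g set \<Rightarrow> bool" where
  "free_generating_set G S \<longleftrightarrow>
     S \<subseteq> carrier G \<and> generate G S = carrier G \<and>
     (\<forall>w\<in>words_over S. reduced_word w \<and> w \<noteq> [] \<longrightarrow> word_value G w \<noteq> \<one>\<^bsub>G\<^esub>)"

definition fg_free_group :: "('g, 'b) monoid_scheme \<Rightarrow> bool" where
  "fg_free_group G \<longleftrightarrow> group G \<and> (\<exists>S. finite S \<and> free_generating_set G S)"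

definition word_ball :: "('g, 'b) monoid_scheme \<Rightarrow> 'g set \<Rightarrow> nat \<Rightarrow> 'g set" where
  "word_ball G S n = {word_value G w | w. w \<in> words_over S \<and> length w \<le> n}"


section \<open>Probability-measure-preserving actions\<close>

text \<open>The underlying measurable space is standard Borel: its measurable sets are the Borel sets
  of some Polish topology on it.\<close>

definition standard_probability_space :: "'x measure \<Rightarrow> bool" where
  "standard_probability_space M \<longleftrightarrow> prob_space M \<and>
     (\<exists>T. topspace T = space M \<and> completely_metrizable_space T \<and> second_countable T \<and>
          sets M = sigma_sets (space M) {U. openin T U})"

text \<open>In \<^locale>\<open>group_action\<close> each \<open>\<phi> g\<close> is a bijection of \<open>space M\<close>, and
  \<open>\<phi> (g \<otimes> h) = \<phi> g \<circ> \<phi> h\<close> on \<open>space M\<close>.\<close>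

definition pmp_action ::
  "('g, 'b) monoid_scheme \<Rightarrow> ('g \<Rightarrow> 'x \<Rightarrow> 'x) \<Rightarrow> 'x measure \<Rightarrow> bool" where
  "pmp_action G \<phi> M \<longleftrightarrow> group_action G (space M) \<phi> \<and>
     (\<forall>g\<in>carrier G. \<phi> g \<in> measurable M M \<and> distr M M (\<phi> g) = M)"


section \<open>Partitions and Shannon entropy\<close>

definition countable_partition :: "'x measure \<Rightarrow> 'x set set \<Rightarrow> bool" where
  "countable_partition M \<alpha> \<longleftrightarrow> partition_on (space M) \<alpha> \<and> countable \<alpha> \<and> \<alpha> \<subseteq> sets M"

definition translate :: "('g \<Rightarrow> 'x \<Rightarrow> 'x) \<Rightarrow> 'g \<Rightarrow> 'x set set \<Rightarrow> 'x set set" where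
  "translate \<phi> g \<alpha> = (\<lambda>A. \<phi> g ` A) ` \<alpha>"

text \<open>Intended for nonempty \<open>F\<close>: \<^const>\<open>common_refinement\<close> knows nothing of the ambient space.\<close>

definition translate_join :: "('g \<Rightarrow> 'x \<Rightarrow> 'x) \<Rightarrow> 'g set \<Rightarrow> 'x set set \<Rightarrow> 'x set set" where
  "translate_join \<phi> F \<alpha> = common_refinement ((\<lambda>f. translate \<phi> f \<alpha>) ` F)"

text \<open>An unordered sum of nonnegative terms, possibly infinite; \<open>0 log 0 = 0\<close> since
  \<open>ln 0 = 0\<close>.\<close>

definition shannon_entropy :: "'x measure \<Rightarrow> 'x set set \<Rightarrow> ereal" where
  "shannon_entropy M \<alpha> =
     enn2ereal (\<Sum>\<^sub>\<infinity>A\<in>\<alpha>. ennreal (- measure M A * ln (measure M A)))"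

definition invariant_sigma_algebra ::
  "('g, 'b) monoid_scheme \<Rightarrow> ('g \<Rightarrow> 'x \<Rightarrow> 'x) \<Rightarrow> 'x measure \<Rightarrow> 'x set set \<Rightarrow> 'x set set" where
  "invariant_sigma_algebra G \<phi> M \<alpha> =
     \<Inter> {\<Sigma>. sigma_algebra (space M) \<Sigma> \<and> \<alpha> \<subseteq> \<Sigma> \<and>
          (\<forall>g\<in>carrier G. \<forall>A\<in>\<Sigma>. \<phi> g ` A \<in> \<Sigma>)}"

definition generating_partition ::
  "('g, 'b) monoid_scheme \<Rightarrow> ('g \<Rightarrow> 'x \<Rightarrow> 'x) \<Rightarrow> 'x measure \<Rightarrow> 'x set set \<Rightarrow> bool" where
  "generating_partition G \<phi> M \<alpha> \<longleftrightarrow> countable_partition M \<alpha> \<and>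
     (\<forall>A\<in>sets M. \<exists>B\<in>invariant_sigma_algebra G \<phi> M \<alpha>. (A - B) \<union> (B - A) \<in> null_sets M)"


section \<open>The f-invariant entropy\<close>

text \<open>Only meaningful if \<open>\<alpha>\<close> has finite Shannon entropy; then every summand is finite.\<close>

definition F_functional ::
  "('g \<Rightarrow> 'x \<Rightarrow> 'x) \<Rightarrow> 'x measure \<Rightarrow> 'g set \<Rightarrow> 'x set set \<Rightarrow> ereal" where
  "F_functional \<phi> M S \<alpha> =
     ereal (1 - 2 * real (card S)) * shannon_entropy M \<alpha> +
     (\<Sum>s\<in>S. shannon_entropy M (common_refinement {translate \<phi> s \<alpha>, \<alpha>}))"

definition f_entropy_defined ::
  "('g, 'b) monoid_scheme \<Rightarrow> ('g \<Rightarrow> 'x \<Rightarrow> 'x) \<Rightarrow> 'x measure \<Rightarrow> bool" where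
  "f_entropy_defined G \<phi> M \<longleftrightarrow> fg_free_group G \<and>
     (\<exists>\<alpha>. generating_partition G \<phi> M \<alpha> \<and> shannon_entropy M \<alpha> < \<infinity>)"

text \<open>By theorems of Bowen, if the f-invariant entropy is defined then the sequence below
  converges in the extended reals for all admissible \<open>S\<close> and \<open>\<alpha>\<close>, to a limit that depends on
  neither of them; the description picks out this common limit.\<close>

definition f_entropy ::
  "('g, 'b) monoid_scheme \<Rightarrow> ('g \<Rightarrow> 'x \<Rightarrow> 'x) \<Rightarrow> 'x measure \<Rightarrow> ereal" where
  "f_entropy G \<phi> M =
     (THE v. \<exists>S \<alpha>. finite S \<and> free_generating_set G S \<and>
        generating_partition G \<phi> M \<alpha> \<and> shannon_entropy M \<alpha> < \<infinity> \<and>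
        (\<lambda>n. F_functional \<phi> M S (translate_join \<phi> (word_ball G S n) \<alpha>)) \<longlonglongrightarrow> v)"

end

theory Submission
  imports Defs
begin

text \<open>
  Write \<open>F\<^sub>S(\<beta>) = H(\<beta>) - \<Sum>\<^sub>s I(\<beta>; s\<beta>)\<close> with mutual informations \<open>I\<close>. For a subgroup \<open>K\<close> of finite index and a
  family \<open>\<gamma>\<close> of partitions indexed by the cosets of \<open>K\<close>, the analogous functional \<open>\<Phi>(\<gamma>)\<close> on the Schreier graph is the
  sum of the entropies over the vertices minus the mutual informations over the edges.
  Bowen's splittings do not increase \<open>\<Phi>\<close>; splitting first \<open>\<gamma>\<close> until it nearly determines a generating
  partition \<open>\<alpha>\<close>, then along \<open>\<alpha>\<close>, and finally forgetting \<open>\<gamma>\<close>, one gets that \<open>|G:K| F\<^sub>S(B\<^sub>S(n)\<cdot>\<alpha>)\<close> is eventually at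
  most \<open>\<Phi>(\<gamma>) + \<epsilon>\<close>.

  Given a free basis \<open>R\<close> of \<open>K\<close>, Stallings foldings transform the rose with petals \<open>R\<close> into the Schreier graph
  of \<open>K\<close>. Carrying partitions along (taking joins when vertices are identified) does not increase the value of
  the graph, because \<open>R\<close> has the right rank and so no edge is lost. Hence \<open>\<Phi>(\<gamma>) \<le> F\<^sub>R(\<beta>)\<close> for some
  \<open>\<gamma>\<close> refining \<open>\<beta>\<close> at the base point. With \<open>K = G\<close> this gives Bowen's theorem that the limit depends neither on
  \<open>S\<close> nor on \<open>\<alpha>\<close>; in general it gives \<open>|G:K| f\<^sub>G \<le> f\<^sub>K\<close>.
  Conversely, collapsing a spanning tree of the Schreier graph shows that the join \<open>\<beta>\<close> of translates of \<open>\<alpha>\<close> by coset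
  representatives satisfies \<open>F\<^sub>R(\<beta>) \<le> |G:K| F\<^sub>S(\<alpha>)\<close> for the Schreier basis \<open>R\<close>.
\<close>

section \<open>Words in free groups\<close>

text \<open>\<open>f_entropy\<close> is a definite description, so convergence and independence of
  all choices have to be proved before any value can be computed. One comparison inequality serves
  both for this, with index 1, and for the index formula. Partitions are replaced by collections of
  sets, each standing for the partition into its membership classes. Joins become unions, which are
  associative and idempotent as sets, and only submodularity, monotonicity and invariance of entropy
  are used until the measure theory begins. An infinite partition is in general not determined by
  finitely many translates of another one. So one family captures another only up to small
  conditional entropy, and adding or forgetting such a part must change the functional by little;
  this is the origin of the error \<epsilon>. In foldings the danger is that more than one edge
  disappears together with a vertex: each lost edge removes a nonnegative mutual information that
  was subtracted. Counting Euler characteristics rules this out: the rose on a basis and the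
  Schreier graph have the same one.\<close>

definition letter_inv :: "bool \<times> 'g \<Rightarrow> bool \<times> 'g" where
  "letter_inv l = (\<not> fst l, snd l)"

lemma letter_inv_letter_inv [simp]: "letter_inv (letter_inv l) = l"
  by (simp add: letter_inv_def)

lemma letter_inv_neq [simp]: "letter_inv l \<noteq> l" "l \<noteq> letter_inv l"
  by (auto simp: letter_inv_def prod_eq_iff)

lemma snd_letter_inv [simp]: "snd (letter_inv l) = snd l"
  by (simp add: letter_inv_def)

lemma letter_inv_iff: "snd l = snd m \<and> fst l \<noteq> fst m \<longleftrightarrow> m = letter_inv l"
  by (auto simp: letter_inv_def prod_eq_iff)

lemma reduced_word_Nil [simp]: "reduced_word []"
  by (simp add: reduced_word_def)

lemma reduced_word_Cons_Cons [simp]: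
  "reduced_word (l # m # w) \<longleftrightarrow> m \<noteq> letter_inv l \<and> reduced_word (m # w)"
  using letter_inv_iff[of l m] by (auto simp: reduced_word_def)

lemma reduced_word_single [simp]: "reduced_word [l]"
  by (simp add: reduced_word_def)

lemma reduced_word_tl: "reduced_word (l # w) \<Longrightarrow> reduced_word w"
  by (cases w) auto

definition word_inv :: "(bool \<times> 'g) list \<Rightarrow> (bool \<times> 'g) list" where
  "word_inv w = rev (map letter_inv w)"

lemma not_reduced_wordD:
  "\<not> reduced_word w \<Longrightarrow> \<exists>x l y. w = x @ [l, letter_inv l] @ y"
proof (induction w rule: induct_list012)
  case (3 l m w)
  show ?case
  proof (cases "m = letter_inv l")
    case True
    then show ?thesis by (intro exI[of _ "[]"] exI[of _ l] exI[of _ w]) simp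
  next
    case False
    with 3 obtain x k y where "m # w = x @ [k, letter_inv k] @ y" by auto
    then show ?thesis by (intro exI[of _ "l # x"] exI[of _ k] exI[of _ y]) simp
  qed
qed auto

text \<open>Left multiplication of reduced words by a letter. Opposite letters act by inverse
  bijections of the reduced words; this is van der Waerden's device for obtaining unique normal
  forms.\<close>

definition push :: "bool \<times> 'g \<Rightarrow> (bool \<times> 'g) list \<Rightarrow> (bool \<times> 'g) list" where
  "push l w = (if w \<noteq> [] \<and> hd w = letter_inv l then tl w else l # w)"

lemma push_Nil [simp]: "push l [] = [l]"
  by (simp add: push_def)

lemma push_Cons: "push l (m # w) = (if m = letter_inv l then w else l # m # w)"
  by (simp add: push_def)

lemma reduced_word_push: "reduced_word w \<Longrightarrow> reduced_word (push l w)"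
  by (cases w) (auto simp: push_Cons dest: reduced_word_tl)

text \<open>Reducedness matters when \<open>w\<close> begins with \<open>l\<close>: the inner
  \<open>push\<close> deletes that letter, and the outer one must not cancel against the
  next.\<close>

lemma push_letter_inv: "reduced_word w \<Longrightarrow> push l (push (letter_inv l) w) = w"
proof (cases w)
  case (Cons m v)
  assume "reduced_word w"
  with Cons show ?thesis by (cases v) (auto simp: push_Cons)
qed (auto simp: push_Cons)

lemma push_reduced: "reduced_word (l # w) \<Longrightarrow> push l w = l # w"
  by (cases w) (auto simp: push_Cons)

lemma foldr_push_reduced: "reduced_word w \<Longrightarrow> foldr push w [] = w"
proof (induction w)
  case (Cons l w)
  then have "foldr push w [] = w" using reduced_word_tl by blast
  with Cons.prems show ?case by (simp add: push_reduced)
qed simp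

lemma words_over_Nil [simp]: "[] \<in> words_over S"
  by (simp add: words_over_def)

lemma words_over_Cons [simp]: "l # w \<in> words_over S \<longleftrightarrow> snd l \<in> S \<and> w \<in> words_over S"
  by (auto simp: words_over_def)

lemma words_over_append [simp]:
  "v @ w \<in> words_over S \<longleftrightarrow> v \<in> words_over S \<and> w \<in> words_over S"
  by (auto simp: words_over_def)

lemma words_over_word_inv [simp]: "word_inv w \<in> words_over S \<longleftrightarrow> w \<in> words_over S"
  by (auto simp: words_over_def word_inv_def image_image)

lemma words_over_push: "snd l \<in> S \<Longrightarrow> w \<in> words_over S \<Longrightarrow> push l w \<in> words_over S"
  by (cases w) (auto simp: push_Cons)

lemma word_value_Nil [simp]: "word_value G [] = \<one>\<^bsub>G\<^esub>"
  by (simp add: word_value_def)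

lemma word_value_Cons [simp]: "word_value G (l # w) = letter_value G l \<otimes>\<^bsub>G\<^esub> word_value G w"
  by (simp add: word_value_def)

context group
begin

lemma letter_value_closed [simp]:
  "S \<subseteq> carrier G \<Longrightarrow> snd l \<in> S \<Longrightarrow> letter_value G l \<in> carrier G"
  by (auto simp: letter_value_def)

lemma word_value_closed [simp]:
  "S \<subseteq> carrier G \<Longrightarrow> w \<in> words_over S \<Longrightarrow> word_value G w \<in> carrier G"
  by (induction w) auto

lemma letter_value_letter_inv:
  "snd l \<in> carrier G \<Longrightarrow> letter_value G (letter_inv l) = inv (letter_value G l)"
  by (auto simp: letter_value_def letter_inv_def)

lemma word_value_append:
  "S \<subseteq> carrier G \<Longrightarrow> v \<in> words_over S \<Longrightarrow> w \<in> words_over S \<Longrightarrow>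
    word_value G (v @ w) = word_value G v \<otimes> word_value G w"
  by (induction v) (auto simp: m_assoc)

lemma word_value_word_inv:
  assumes "S \<subseteq> carrier G" "w \<in> words_over S"
  shows "word_value G (word_inv w) = inv (word_value G w)"
  using assms(2)
proof (induction w)
  case (Cons l w)
  then have *: "snd l \<in> carrier G" "letter_value G l \<in> carrier G" using assms(1) by auto
  have "word_inv (l # w) = word_inv w @ [letter_inv l]" by (simp add: word_inv_def)
  moreover have "word_inv w \<in> words_over S" "[letter_inv l] \<in> words_over S"
    using Cons.prems by auto
  ultimately show ?case
    using Cons * assms(1) word_value_append[OF assms(1), of "word_inv w" "[letter_inv l]"]
    by (simp add: letter_value_letter_inv inv_mult_group)
qed (simp add: word_inv_def)

lemma generate_word_value:
  assumes "S \<subseteq> carrier G"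
  shows "generate G S = word_value G ` words_over S"
proof
  show "generate G S \<subseteq> word_value G ` words_over S"
  proof
    fix g assume "g \<in> generate G S"
    then show "g \<in> word_value G ` words_over S"
    proof (induction rule: generate.induct)
      case one
      then show ?case by (intro image_eqI[of _ _ "[]"]) auto
    next
      case (incl s)
      then show ?case using assms
        by (intro image_eqI[of _ _ "[(True, s)]"]) (auto simp: letter_value_def)
    next
      case (inv s)
      then show ?case using assms
        by (intro image_eqI[of _ _ "[(False, s)]"]) (auto simp: letter_value_def)
    next
      case (eng a b)
      then obtain v w where "v \<in> words_over S" "w \<in> words_over S" "a = word_value G v" "b = word_value G w"
        by auto
      then show ?case using assms
        by (intro image_eqI[of _ _ "v @ w"]) (auto simp: word_value_append)
    qed
  qed
next
  have "w \<in> words_over S \<Longrightarrow> word_value G w \<in> generate G S" for w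
  proof (induction w)
    case (Cons l w)
    then have "letter_value G l \<in> generate G S"
      by (cases l) (auto simp: letter_value_def intro: generate.incl generate.inv)
    with Cons show ?case by (auto intro: generate.eng)
  qed (auto intro: generate.one)
  then show "word_value G ` words_over S \<subseteq> generate G S" by auto
qed

end

lemma (in group) one_notin_free_generating_set:
  assumes "free_generating_set G S"
  shows "\<one> \<notin> S"
proof
  assume "\<one> \<in> S"
  then have "[(True, \<one>)] \<in> words_over S" by simp
  then have "word_value G [(True, \<one>)] \<noteq> \<one>"
    using assms unfolding free_generating_set_def by (meson list.discI reduced_word_single)
  then show False by (simp add: letter_value_def)
qed

locale free_basis = group G for G (structure) +
  fixes S :: "'a set"
  assumes free: "free_generating_set G S" and fin [simp]: "finite S"
begin

lemma S_carrier [simp]: "S \<subseteq> carrier G"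
  using free by (simp add: free_generating_set_def)

lemma S_carrierD [simp]: "s \<in> S \<Longrightarrow> s \<in> carrier G"
  using S_carrier by blast

lemma letter_closed [simp]: "snd l \<in> S \<Longrightarrow> letter_value G l \<in> carrier G"
  using letter_value_closed[OF S_carrier] .

lemma word_closed [simp]: "w \<in> words_over S \<Longrightarrow> word_value G w \<in> carrier G"
  using word_value_closed[OF S_carrier] .

lemma words_onto: "word_value G ` words_over S = carrier G"
  using free generate_word_value[OF S_carrier] by (simp add: free_generating_set_def)

text \<open>Freeness as an induction principle: a nonempty word of value one is not reduced, so it
  contains a cancelling pair, whose removal shortens the word and keeps its value.\<close>

lemma trivial_word_induct [consumes 2, case_names Nil cancel]:
  assumes "w \<in> words_over S" "word_value G w = \<one>"
    and "P []"
    and "\<And>x l y. x \<in> words_over S \<Longrightarrow> snd l \<in> S \<Longrightarrow> y \<in> words_over S \<Longrightarrow> P (x @ y) \<Longrightarrow>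
      P (x @ [l, letter_inv l] @ y)"
  shows "P w"
  using assms(1,2)
proof (induction "length w" arbitrary: w rule: less_induct)
  case less
  show ?case
  proof (cases "w = []")
    case False
    with less.prems have "\<not> reduced_word w" using free by (auto simp: free_generating_set_def)
    then obtain x l y where w: "w = x @ [l, letter_inv l] @ y" using not_reduced_wordD by blast
    with less.prems have *: "x \<in> words_over S" "snd l \<in> S" "y \<in> words_over S" by auto
    have "word_value G w = word_value G (x @ y)"
      using * unfolding w
      by (simp add: word_value_append[OF S_carrier] letter_value_letter_inv m_assoc[symmetric])
    then have "P (x @ y)" using less w * by auto
    with * assms(4) w show ?thesis by auto
  qed (use assms in auto)
qed

text \<open>The universal property of free groups, for letters acting by bijections of \<open>Y\<close>.\<close>

lemma foldr_action_cong:
  assumes closed: "\<And>l y. snd l \<in> S \<Longrightarrow> y \<in> Y \<Longrightarrow> f l y \<in> Y"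
    and cancel: "\<And>l y. snd l \<in> S \<Longrightarrow> y \<in> Y \<Longrightarrow> f l (f (letter_inv l) y) = y"
    and v: "v \<in> words_over S" and w: "w \<in> words_over S" and eq: "word_value G v = word_value G w"
    and y: "y \<in> Y"
  shows "foldr f v y = foldr f w y"
proof -
  have foldr_closed: "u \<in> words_over S \<Longrightarrow> y \<in> Y \<Longrightarrow> foldr f u y \<in> Y" for u y
    by (induction u) (auto intro: closed)
  have inv: "u \<in> words_over S \<Longrightarrow> y \<in> Y \<Longrightarrow> foldr f (word_inv u) (foldr f u y) = y" for u y
  proof (induction u arbitrary: y)
    case (Cons l u)
    then have "f (letter_inv l) (f l (foldr f u y)) = foldr f u y"
      using cancel[of "letter_inv l" "foldr f u y"] foldr_closed by simp
    with Cons show ?case by (auto simp: word_inv_def)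
  qed (simp add: word_inv_def)
  have triv: "u \<in> words_over S \<Longrightarrow> word_value G u = \<one> \<Longrightarrow> \<forall>y\<in>Y. foldr f u y = y" for u
    by (induction rule: trivial_word_induct) (auto simp: cancel foldr_closed)
  have "word_value G (v @ word_inv w) = \<one>"
    using v w eq by (simp add: word_value_append[OF S_carrier] word_value_word_inv[OF S_carrier])
  with triv[of "v @ word_inv w"] v w have "foldr f v (foldr f (word_inv w) y') = y'" if "y' \<in> Y" for y'
    using that by auto
  from this[of "foldr f w y"] show ?thesis using inv[OF w y] foldr_closed[OF w y] by simp
qed

text \<open>An arbitrary word for \<open>g\<close> is chosen and then reduced; the choice is shown
  to be immaterial in \<open>nf_word_value\<close>.\<close>

definition nf :: "'a \<Rightarrow> (bool \<times> 'a) list" where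
  "nf g = foldr push (SOME w. w \<in> words_over S \<and> word_value G w = g) []"

text \<open>The letters act on reduced words through \<open>push\<close>, so by
  \<open>foldr_action_cong\<close> the effect of a word on the empty one depends only on its
  value.\<close>

lemma nf_word_value:
  assumes "w \<in> words_over S"
  shows "nf (word_value G w) = foldr push w []"
proof -
  let ?v = "SOME v. v \<in> words_over S \<and> word_value G v = word_value G w"
  have "?v \<in> words_over S \<and> word_value G ?v = word_value G w"
    by (rule someI[of _ w]) (use assms in auto)
  then show ?thesis unfolding nf_def
    by (intro foldr_action_cong[where Y = "{w. reduced_word w}"])
      (auto simp: reduced_word_push push_letter_inv assms)
qed

lemma word_value_push:
  assumes "snd l \<in> S" "w \<in> words_over S"
  shows "word_value G (push l w) = letter_value G l \<otimes> word_value G w"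
  using assms by (cases w) (auto simp: push_Cons letter_value_letter_inv m_assoc[symmetric])

lemma word_value_foldr_push:
  "w \<in> words_over S \<Longrightarrow> foldr push w [] \<in> words_over S \<and> word_value G (foldr push w []) = word_value G w"
  by (induction w) (auto simp: words_over_push word_value_push)

lemma nf_props:
  assumes "g \<in> carrier G"
  shows "nf g \<in> words_over S" "word_value G (nf g) = g" "reduced_word (nf g)"
proof -
  obtain w where "w \<in> words_over S" "g = word_value G w" using assms words_onto by auto
  moreover have "reduced_word (foldr push v [])" for v :: "(bool \<times> 'a) list"
    by (induction v) (auto simp: reduced_word_push)
  ultimately show "nf g \<in> words_over S" "word_value G (nf g) = g" "reduced_word (nf g)"
    using nf_word_value word_value_foldr_push by auto
qed

lemma nf_mult_letter:
  assumes "snd l \<in> S" "g \<in> carrier G"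
  shows "nf (letter_value G l \<otimes> g) = push l (nf g)"
proof -
  obtain w where "w \<in> words_over S" "g = word_value G w" using assms words_onto by auto
  then show ?thesis using assms nf_word_value[of "l # w"] nf_word_value[of w] by simp
qed

lemma nf_reduced: "w \<in> words_over S \<Longrightarrow> reduced_word w \<Longrightarrow> nf (word_value G w) = w"
  by (simp add: nf_word_value foldr_push_reduced)

lemma nf_one: "nf \<one> = []"
  using nf_reduced[of "[]"] by simp

text \<open>Each letter of \<open>z\<close> can cancel at most one letter of the normal form of
  \<open>g\<close>, so all but \<open>length z\<close> letters survive as a suffix.\<close>

lemma nf_mult_suffix:
  assumes "z \<in> words_over S" "g \<in> carrier G"
  shows "\<exists>p m. m \<le> length z \<and> nf (word_value G z \<otimes> g) = p @ drop m (nf g)"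
  using assms(1)
proof (induction z)
  case Nil
  then show ?case using assms by (intro exI[of _ "[]"] exI[of _ 0]) auto
next
  case (Cons l z)
  then obtain p m where pm: "m \<le> length z" "nf (word_value G z \<otimes> g) = p @ drop m (nf g)"
    by auto
  have "nf (word_value G (l # z) \<otimes> g) = push l (p @ drop m (nf g))"
    using nf_mult_letter[of l "word_value G z \<otimes> g"] Cons.prems assms pm by (simp add: m_assoc)
  moreover have "\<exists>q k. k \<le> Suc (length z) \<and> push l (p @ drop m (nf g)) = q @ drop k (nf g)"
  proof (cases p)
    case Nil
    show ?thesis
    proof (cases "drop m (nf g)")
      case Nil
      with \<open>p = []\<close> pm show ?thesis by (intro exI[of _ "[l]"] exI[of _ m]) auto
    next
      case (Cons k v)
      then have "v = drop (Suc m) (nf g)" by (metis drop_Suc list.sel(3) tl_drop)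
      show ?thesis
      proof (cases "k = letter_inv l")
        case True
        then show ?thesis using Cons \<open>p = []\<close> \<open>v = _\<close> pm
          by (intro exI[of _ "[]"] exI[of _ "Suc m"]) (simp add: push_Cons)
      next
        case False
        then show ?thesis using Cons \<open>p = []\<close> pm
          by (intro exI[of _ "[l]"] exI[of _ m]) (simp add: push_Cons)
      qed
    qed
  next
    case (Cons k q)
    then show ?thesis using pm
      by (cases "k = letter_inv l")
        (auto simp: push_Cons intro!: exI[of _ m])
  qed
  ultimately show ?case by auto
qed

end

section \<open>Splittings\<close>

text \<open>In the intended instance \<open>U\<close> consists of the measurable sets,
  \<open>adm\<close> means finite entropy and \<open>h\<close> is the entropy of the partition
  induced by a collection, so that the join is the union. \<open>h_submod\<close> states that
  conditional mutual information is nonnegative.\<close>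

locale entropy_system = group G for G (structure) +
  fixes T :: "'a \<Rightarrow> 'e \<Rightarrow> 'e" and U :: "'e set" and adm :: "'e set \<Rightarrow> bool" and h :: "'e set \<Rightarrow> real"
  assumes T_mult: "g \<in> carrier G \<Longrightarrow> k \<in> carrier G \<Longrightarrow> a \<in> U \<Longrightarrow> T g (T k a) = T (g \<otimes> k) a"
    and T_one: "a \<in> U \<Longrightarrow> T \<one> a = a"
    and adm_U: "adm C \<Longrightarrow> C \<subseteq> U"
    and adm_empty [simp]: "adm {}"
    and adm_Un [simp]: "adm C \<Longrightarrow> adm D \<Longrightarrow> adm (C \<union> D)"
    and adm_T [simp]: "adm C \<Longrightarrow> g \<in> carrier G \<Longrightarrow> adm (T g ` C)"
    and h_T [simp]: "adm C \<Longrightarrow> g \<in> carrier G \<Longrightarrow> h (T g ` C) = h C"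
    and h_mono_Un: "adm C \<Longrightarrow> adm D \<Longrightarrow> h C \<le> h (C \<union> D)"
    and h_submod: "adm A \<Longrightarrow> adm B \<Longrightarrow> adm C \<Longrightarrow> h (A \<union> B \<union> C) + h C \<le> h (A \<union> C) + h (B \<union> C)"
    and h_empty [simp]: "h {} = 0"
begin

lemma adm_UN [simp]: "finite I \<Longrightarrow> (\<And>i. i \<in> I \<Longrightarrow> adm (C i)) \<Longrightarrow> adm (\<Union>i\<in>I. C i)"
  by (induction I rule: finite_induct) auto

lemma T_image_mult:
  "adm C \<Longrightarrow> g \<in> carrier G \<Longrightarrow> k \<in> carrier G \<Longrightarrow> T g ` (T k ` C) = T (g \<otimes> k) ` C"
  using adm_U[of C] by (auto simp: image_image T_mult intro!: image_cong)

lemma T_image_one [simp]: "adm C \<Longrightarrow> T \<one> ` C = C"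
  using adm_U[of C] by (force simp: T_one)

lemma h_mono: "adm C \<Longrightarrow> adm D \<Longrightarrow> C \<subseteq> D \<Longrightarrow> h C \<le> h D"
  using h_mono_Un[of C D] by (simp add: Un_absorb1)

text \<open>The conditional entropy of \<open>C\<close> given \<open>D\<close>.\<close>

definition hc :: "'e set \<Rightarrow> 'e set \<Rightarrow> real" where
  "hc C D = h (C \<union> D) - h D"

lemma hc_antimono:
  assumes "adm C" "adm D" "adm E" "D \<subseteq> E"
  shows "hc C E \<le> hc C D"
  using h_submod[of C E D] assms by (simp add: hc_def Un_absorb2 Un_assoc)

lemma hc_mono: "adm B \<Longrightarrow> adm C \<Longrightarrow> adm D \<Longrightarrow> B \<subseteq> C \<Longrightarrow> hc B D \<le> hc C D"
  unfolding hc_def by (auto intro!: h_mono)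

lemma hc_Un_le: "adm B \<Longrightarrow> adm C \<Longrightarrow> adm D \<Longrightarrow> hc (B \<union> C) D \<le> hc B D + hc C D"
  using h_submod[of B C D] by (simp add: hc_def)

lemma hc_chain: "adm B \<Longrightarrow> adm C \<Longrightarrow> adm D \<Longrightarrow> hc (B \<union> C) D = hc B (C \<union> D) + hc C D"
  by (simp add: hc_def Un_assoc)

lemma hc_trans: "adm B \<Longrightarrow> adm C \<Longrightarrow> adm D \<Longrightarrow> hc B D \<le> hc B C + hc C D"
  using hc_chain[of B C D] hc_antimono[of B C "C \<union> D"] hc_mono[of B "B \<union> C" D] by simp

lemma hc_T: "adm C \<Longrightarrow> adm D \<Longrightarrow> g \<in> carrier G \<Longrightarrow> hc (T g ` C) (T g ` D) = hc C D"
  by (simp add: hc_def flip: image_Un)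

lemma hc_le_h: "adm C \<Longrightarrow> adm D \<Longrightarrow> hc C D \<le> h C"
  using hc_antimono[of C "{}" D] by (simp add: hc_def)

text \<open>\<open>J A x B\<close> is the mutual information of \<open>A\<close> and \<open>x\<cdot>B\<close>. With it, the functional \<open>F\<close>
  is \<open>h C - (\<Sum>s\<in>S. J C s C)\<close>.\<close>

definition J :: "'e set \<Rightarrow> 'a \<Rightarrow> 'e set \<Rightarrow> real" where
  "J A x B = h A + h B - h (A \<union> T x ` B)"

text \<open>By \<open>hc_antimono\<close>, a part added to one side raises the joint entropy by no
  more than it raises the entropy of that side. The two sides are enlarged in turn.\<close>

lemma J_mono:
  assumes "adm A" "adm A'" "adm B" "adm B'" "x \<in> carrier G" "A \<subseteq> A'" "B \<subseteq> B'"
  shows "J A x B \<le> J A' x B'"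
proof -
  have 1: "hc A' (A \<union> T x ` B) \<le> hc A' A"
    using assms by (intro hc_antimono) auto
  have "h (A' \<union> T x ` B) - h A' \<le> h (A \<union> T x ` B) - h A"
    using 1 assms unfolding hc_def by (simp add: Un_absorb2 Un_absorb1 Un_assoc[symmetric])
  moreover have "hc (T x ` B') (A' \<union> T x ` B) \<le> hc (T x ` B') (T x ` B)"
    using assms by (intro hc_antimono) auto
  then have "h (A' \<union> T x ` B') - h (A' \<union> T x ` B) \<le> h B' - h B"
    using assms unfolding hc_def
    by (simp add: Un_absorb2 Un_absorb1 image_mono Un_left_commute[of _ A'])
  ultimately show ?thesis by (simp add: J_def)
qed

text \<open>The two single entropies grow by exactly \<open>hc Z A\<close> and
  \<open>hc Z' B\<close>, while the joint entropy, which is subtracted, does not fall.\<close>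

lemma J_Un_le:
  assumes "adm A" "adm Z" "adm B" "adm Z'" "x \<in> carrier G"
  shows "J (A \<union> Z) x (B \<union> Z') \<le> J A x B + hc Z A + hc Z' B"
proof -
  have "h (A \<union> T x ` B) \<le> h ((A \<union> Z) \<union> T x ` (B \<union> Z'))"
    using assms by (intro h_mono) auto
  then show ?thesis by (simp add: J_def hc_def Un_commute)
qed

lemma J_flip:
  assumes "adm A" "adm B" "x \<in> carrier G"
  shows "J A (inv x) B = J B x A"
proof -
  have "h (A \<union> T (inv x) ` B) = h (T x ` (A \<union> T (inv x) ` B))"
    using assms by (intro h_T[symmetric]) auto
  also have "\<dots> = h (B \<union> T x ` A)"
    using assms by (simp add: image_Un T_image_mult Un_commute)
  finally show ?thesis by (simp add: J_def)
qed

lemma J_translate: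
  assumes "adm A" "adm B" "x \<in> carrier G" "g \<in> carrier G" "k \<in> carrier G"
  shows "J (T g ` A) (g \<otimes> x \<otimes> inv k) (T k ` B) = J A x B"
proof -
  have "h (T g ` A \<union> T (g \<otimes> x \<otimes> inv k) ` T k ` B) = h (T g ` (A \<union> T x ` B))"
    using assms by (simp add: image_Un T_image_mult m_assoc)
  then show ?thesis using assms by (simp add: J_def)
qed

definition orb :: "'a set \<Rightarrow> 'e set \<Rightarrow> 'e set" where
  "orb F C = (\<Union>g\<in>F. T g ` C)"

lemma orb_mono: "F \<subseteq> F' \<Longrightarrow> orb F C \<subseteq> orb F' C"
  by (auto simp: orb_def)

lemma orb_adm [simp]: "finite F \<Longrightarrow> F \<subseteq> carrier G \<Longrightarrow> adm C \<Longrightarrow> adm (orb F C)"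
  unfolding orb_def by (intro adm_UN adm_T) auto

text \<open>The entropic form of generation: finitely many translates leave arbitrarily little
  uncertainty about any admissible collection. For generating partitions it is derived in
  \<open>generating_partition_generates\<close>.\<close>

definition generates :: "'a set \<Rightarrow> 'e set \<Rightarrow> bool" where
  "generates K \<beta> \<longleftrightarrow> adm \<beta> \<and>
     (\<forall>C \<epsilon>. adm C \<longrightarrow> \<epsilon> > 0 \<longrightarrow> (\<exists>F. finite F \<and> F \<subseteq> K \<and> hc C (orb F \<beta>) < \<epsilon>))"

lemma generates_adm: "generates K \<beta> \<Longrightarrow> adm \<beta>"
  by (simp add: generates_def)

lemma generatesE:
  assumes "generates K \<beta>" "adm C" "\<epsilon> > 0"
  obtains F where "finite F" "F \<subseteq> K" "hc C (orb F \<beta>) < \<epsilon>"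
  using assms unfolding generates_def by blast

text \<open>Every finite join of translates of \<alpha> lies below a finite join of translates of
  \<beta>. This covers both enlarging \<alpha> to the join over a ball and trading the group for a
  subgroup.\<close>

lemma generates_coarser:
  assumes \<alpha>: "generates K' \<alpha>" and \<beta>: "adm \<beta>" and K: "K \<subseteq> carrier G" "K' \<subseteq> carrier G"
    and cover: "\<And>g. g \<in> K' \<Longrightarrow> \<exists>k\<in>K. T g ` \<alpha> \<subseteq> T k ` \<beta>"
  shows "generates K \<beta>"
  unfolding generates_def
proof (intro conjI allI impI)
  fix C and \<epsilon> :: real assume C: "adm C" "\<epsilon> > 0"
  obtain F where F: "finite F" "F \<subseteq> K'" "hc C (orb F \<alpha>) < \<epsilon>" using generatesE[OF \<alpha> C] .
  obtain \<kappa> where \<kappa>: "\<And>g. g \<in> K' \<Longrightarrow> \<kappa> g \<in> K \<and> T g ` \<alpha> \<subseteq> T (\<kappa> g) ` \<beta>" using cover by metis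
  have "\<kappa> ` F \<subseteq> K" using \<kappa> F(2) by blast
  moreover have "orb F \<alpha> \<subseteq> orb (\<kappa> ` F) \<beta>"
    unfolding orb_def
  proof (rule UN_least)
    fix g assume "g \<in> F"
    then have "T g ` \<alpha> \<subseteq> T (\<kappa> g) ` \<beta>" "\<kappa> g \<in> \<kappa> ` F" using \<kappa> F(2) by auto
    then show "T g ` \<alpha> \<subseteq> (\<Union>k\<in>\<kappa> ` F. T k ` \<beta>)" by (rule order_trans[OF _ UN_upper])
  qed
  then have "hc C (orb (\<kappa> ` F) \<beta>) \<le> hc C (orb F \<alpha>)"
    using C F K \<beta> \<open>\<kappa> ` F \<subseteq> K\<close> generates_adm[OF \<alpha>] by (intro hc_antimono orb_adm) auto
  ultimately show "\<exists>F. finite F \<and> F \<subseteq> K \<and> hc C (orb F \<beta>) < \<epsilon>"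
    using F by (intro exI[of _ "\<kappa> ` F"]) auto
qed (fact \<beta>)

end

definition letters :: "'g set \<Rightarrow> (bool \<times> 'g) set" where
  "letters S = UNIV \<times> S"

lemma finite_letters [simp]: "finite S \<Longrightarrow> finite (letters S)"
  by (simp add: letters_def)

lemma mem_letters [simp]: "l \<in> letters S \<longleftrightarrow> snd l \<in> S"
  by (cases l) (simp add: letters_def)

lemma word_ball_0 [simp]: "word_ball G S 0 = {\<one>\<^bsub>G\<^esub>}"
  by (force simp: word_ball_def)

lemma word_ball_Suc:
  "word_ball G S (Suc n) =
    word_ball G S n \<union> (\<Union>l\<in>letters S. (\<lambda>g. letter_value G l \<otimes>\<^bsub>G\<^esub> g) ` word_ball G S n)"
proof (intro subset_antisym subsetI)
  fix g assume "g \<in> word_ball G S (Suc n)"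
  then obtain w where w: "w \<in> words_over S" "length w \<le> Suc n" "g = word_value G w"
    by (auto simp: word_ball_def)
  show "g \<in> word_ball G S n \<union> (\<Union>l\<in>letters S. (\<lambda>g. letter_value G l \<otimes>\<^bsub>G\<^esub> g) ` word_ball G S n)"
  proof (cases w)
    case Nil
    with w have "g \<in> word_ball G S n"
      unfolding word_ball_def by (intro CollectI exI[of _ "[]"]) simp
    then show ?thesis by blast
  next
    case (Cons l v)
    with w show ?thesis
      by (intro UnI2 UN_I[of l] image_eqI[of _ _ "word_value G v"]) (auto simp: word_ball_def)
  qed
next
  fix g assume "g \<in> word_ball G S n \<union> (\<Union>l\<in>letters S. (\<lambda>g. letter_value G l \<otimes>\<^bsub>G\<^esub> g) ` word_ball G S n)"
  then show "g \<in> word_ball G S (Suc n)"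
  proof
    assume "g \<in> word_ball G S n"
    then show ?thesis by (auto simp: word_ball_def intro: le_SucI)
  next
    assume "g \<in> (\<Union>l\<in>letters S. (\<lambda>g. letter_value G l \<otimes>\<^bsub>G\<^esub> g) ` word_ball G S n)"
    then obtain l w where "snd l \<in> S" "w \<in> words_over S" "length w \<le> n"
      "g = letter_value G l \<otimes>\<^bsub>G\<^esub> word_value G w"
      by (auto simp: word_ball_def)
    then show ?thesis unfolding word_ball_def by (intro CollectI exI[of _ "l # w"]) auto
  qed
qed

lemma word_ball_mono: "m \<le> n \<Longrightarrow> word_ball G S m \<subseteq> word_ball G S n"
  by (force simp: word_ball_def)

lemma finite_word_ball [simp]: "finite S \<Longrightarrow> finite (word_ball G S n)"
  by (induction n) (auto simp: word_ball_Suc)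

text \<open>A family \<open>\<gamma>\<close> on the finite set \<open>V\<close> of left cosets of \<open>K\<close> encodes a \<open>K\<close>-equivariant family of
  collections on the Cayley tree of \<open>G\<close>: the vertex \<open>g\<close> carries \<open>g\<cdot>\<gamma>(g\<^sup>-\<^sup>1K)\<close>. For \<open>K = carrier G\<close> there is
  one coset, and \<open>Phi\<close> below is \<open>F\<close>.\<close>

locale coset_system = entropy_system G T U adm h
    for G (structure) and T :: "'a \<Rightarrow> 'e \<Rightarrow> 'e" and U adm h +
  fixes S :: "'a set" and K :: "'a set"
  assumes S_sub: "S \<subseteq> carrier G" and S_fin [simp]: "finite S"
    and S_gen: "word_value G ` words_over S = carrier G"
    and K_sub: "subgroup K G"
    and fin_V: "finite (lcosets K)"
begin

abbreviation V :: "'a set set" where "V \<equiv> lcosets K"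

lemma V_finite [simp]: "finite V" by (fact fin_V)

lemma K_carrier [simp]: "K \<subseteq> carrier G"
  using K_sub by (rule subgroup.subset)

lemma V_iff: "v \<in> V \<longleftrightarrow> (\<exists>g\<in>carrier G. v = g <# K)"
  by (auto simp: LCOSETS_def)

lemma V_carrier: "v \<in> V \<Longrightarrow> v \<subseteq> carrier G"
  using l_coset_subset_G[OF K_carrier] by (auto simp: V_iff)

lemma V_act [simp]: "g \<in> carrier G \<Longrightarrow> v \<in> V \<Longrightarrow> g <# v \<in> V"
  by (auto simp: V_iff lcos_m_assoc)

lemma V_act_act [simp]:
  "g \<in> carrier G \<Longrightarrow> k \<in> carrier G \<Longrightarrow> v \<in> V \<Longrightarrow> g <# (k <# v) = (g \<otimes> k) <# v"
  using V_carrier by (auto simp: lcos_m_assoc)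

lemma V_act_one [simp]: "v \<in> V \<Longrightarrow> \<one> <# v = v"
  using V_carrier by (auto simp: lcos_mult_one)

lemma K_V [simp]: "K \<in> V"
  using lcos_mult_one[OF K_carrier] by (auto simp: V_iff intro!: bexI[of _ \<one>])

lemma V_act_bij: "g \<in> carrier G \<Longrightarrow> bij_betw (\<lambda>v. g <# v) V V"
  by (rule bij_betw_byWitness[where f' = "\<lambda>v. inv g <# v"]) auto

lemma S_carrier [simp]: "s \<in> S \<Longrightarrow> s \<in> carrier G"
  using S_sub by auto

lemma letter_carrier [simp]: "snd l \<in> S \<Longrightarrow> letter_value G l \<in> carrier G"
  using letter_value_closed[OF S_sub] .

lemma word_ball_carrier: "word_ball G S n \<subseteq> carrier G"
  using word_value_closed[OF S_sub] by (auto simp: word_ball_def)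

text \<open>In the Schreier graph the edge labelled \<open>s\<close> leads from \<open>v\<close> to
  \<open>s <# v\<close>; its term is the mutual information of the target collection and the
  translated source collection.\<close>

definition Phi :: "('a set \<Rightarrow> 'e set) \<Rightarrow> real" where
  "Phi \<gamma> = (\<Sum>v\<in>V. h (\<gamma> v) - (\<Sum>s\<in>S. J (\<gamma> (s <# v)) s (\<gamma> v)))"

definition family :: "('a set \<Rightarrow> 'e set) \<Rightarrow> bool" where
  "family \<gamma> \<longleftrightarrow> (\<forall>v\<in>V. adm (\<gamma> v))"

lemma family_adm [simp]: "family \<gamma> \<Longrightarrow> v \<in> V \<Longrightarrow> adm (\<gamma> v)"
  by (simp add: family_def)

lemma Phi_eq: "Phi \<gamma> = (\<Sum>v\<in>V. h (\<gamma> v)) - (\<Sum>s\<in>S. \<Sum>v\<in>V. J (\<gamma> (s <# v)) s (\<gamma> v))"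
  unfolding Phi_def sum_subtractf by (subst sum.swap) simp

lemma sum_shift: "g \<in> carrier G \<Longrightarrow> (\<Sum>v\<in>V. f (g <# v)) = (\<Sum>v\<in>V. f v)" for f :: "_ \<Rightarrow> real"
  using sum.reindex_bij_betw[OF V_act_bij] .

text \<open>Bowen's splitting inequality. For \<open>l = s\<close>, the added part \<open>s\<cdot>C\<close> is already contained in
  \<open>s\<cdot>\<gamma>\<close>, so the term \<open>J\<close> of the letter \<open>s\<close> grows by at least the growth of \<open>h\<close>.\<close>

lemma Phi_split:
  assumes \<gamma>: "family \<gamma>" and C: "family C" "\<And>v. v \<in> V \<Longrightarrow> C v \<subseteq> \<gamma> v" and l: "snd l \<in> S"
  defines "\<gamma>' \<equiv> \<lambda>v. \<gamma> v \<union> T (letter_value G l) ` C (inv (letter_value G l) <# v)"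
  shows "Phi \<gamma>' \<le> Phi \<gamma>"
proof -
  obtain e s where ls: "l = (e, s)" by force
  with l have s: "s \<in> S" "s \<in> carrier G" by auto
  have \<gamma>': "family \<gamma>'"
    using \<gamma> C l by (auto simp: family_def \<gamma>'_def)
  have adm: "adm (\<gamma> v)" "adm (C v)" "adm (\<gamma>' v)" if "v \<in> V" for v using \<gamma> \<gamma>' C that by auto
  have sub: "\<gamma> v \<subseteq> \<gamma>' v" for v by (auto simp: \<gamma>'_def)
  have mono: "J (\<gamma> (t <# v)) t (\<gamma> v) \<le> J (\<gamma>' (t <# v)) t (\<gamma>' v)" if "t \<in> S" "v \<in> V" for t v
    using that sub by (intro J_mono) (auto simp: adm)
  have key: "(\<Sum>v\<in>V. h (\<gamma>' v)) - (\<Sum>v\<in>V. h (\<gamma> v)) \<le>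
      (\<Sum>v\<in>V. J (\<gamma>' (s <# v)) s (\<gamma>' v)) - (\<Sum>v\<in>V. J (\<gamma> (s <# v)) s (\<gamma> v))"
  proof (cases e)
    case True
    have "h (\<gamma>' (s <# v)) - h (\<gamma> (s <# v)) \<le> J (\<gamma>' (s <# v)) s (\<gamma>' v) - J (\<gamma> (s <# v)) s (\<gamma> v)"
      if v: "v \<in> V" for v
    proof -
      have eq: "\<gamma>' (s <# v) = \<gamma> (s <# v) \<union> T s ` C v"
        using v s True by (simp add: \<gamma>'_def ls letter_value_def)
      have "\<gamma>' (s <# v) \<union> T s ` \<gamma> v = \<gamma> (s <# v) \<union> T s ` \<gamma> v"
        using C(2)[OF v] by (auto simp: eq)
      then have "J (\<gamma>' (s <# v)) s (\<gamma> v) - J (\<gamma> (s <# v)) s (\<gamma> v) = h (\<gamma>' (s <# v)) - h (\<gamma> (s <# v))"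
        by (simp add: J_def)
      moreover have "J (\<gamma>' (s <# v)) s (\<gamma> v) \<le> J (\<gamma>' (s <# v)) s (\<gamma>' v)"
        using v s sub by (intro J_mono) (auto simp: adm)
      ultimately show ?thesis by simp
    qed
    then have "(\<Sum>v\<in>V. h (\<gamma>' (s <# v)) - h (\<gamma> (s <# v))) \<le>
        (\<Sum>v\<in>V. J (\<gamma>' (s <# v)) s (\<gamma>' v) - J (\<gamma> (s <# v)) s (\<gamma> v))"
      by (intro sum_mono)
    then show ?thesis
      by (simp add: sum_subtractf sum_shift[OF s(2), of "\<lambda>v. h (\<gamma>' v)"] sum_shift[OF s(2), of "\<lambda>v. h (\<gamma> v)"])
  next
    case False
    have "h (\<gamma>' v) - h (\<gamma> v) \<le> J (\<gamma>' (s <# v)) s (\<gamma>' v) - J (\<gamma> (s <# v)) s (\<gamma> v)"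
      if v: "v \<in> V" for v
    proof -
      have "\<gamma>' v = \<gamma> v \<union> T (inv s) ` C (s <# v)"
        using v s False by (simp add: \<gamma>'_def ls letter_value_def)
      \<comment> \<open>For an inverse letter the new part, translated back by \<open>s\<close>,
        lies in the collection at the target of the edge, so now it is the source side that grows
        without changing the joint entropy.\<close>
      then have "T s ` \<gamma>' v = T s ` \<gamma> v \<union> C (s <# v)"
        using s v by (simp add: image_Un T_image_mult adm)
      then have "\<gamma> (s <# v) \<union> T s ` \<gamma>' v = \<gamma> (s <# v) \<union> T s ` \<gamma> v"
        using C(2)[of "s <# v"] s v by auto
      then have "J (\<gamma> (s <# v)) s (\<gamma>' v) - J (\<gamma> (s <# v)) s (\<gamma> v) = h (\<gamma>' v) - h (\<gamma> v)"
        by (simp add: J_def)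
      moreover have "J (\<gamma> (s <# v)) s (\<gamma>' v) \<le> J (\<gamma>' (s <# v)) s (\<gamma>' v)"
        using v s sub by (intro J_mono) (auto simp: adm)
      ultimately show ?thesis by simp
    qed
    then have "(\<Sum>v\<in>V. h (\<gamma>' v) - h (\<gamma> v)) \<le>
        (\<Sum>v\<in>V. J (\<gamma>' (s <# v)) s (\<gamma>' v) - J (\<gamma> (s <# v)) s (\<gamma> v))"
      by (intro sum_mono)
    then show ?thesis by (simp add: sum_subtractf)
  qed
  have "(\<Sum>t\<in>S-{s}. \<Sum>v\<in>V. J (\<gamma> (t <# v)) t (\<gamma> v)) \<le> (\<Sum>t\<in>S-{s}. \<Sum>v\<in>V. J (\<gamma>' (t <# v)) t (\<gamma>' v))"
    by (intro sum_mono mono) auto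
  with key show ?thesis
    unfolding Phi_eq using s by (simp add: sum.remove[of S s])
qed

text \<open>All added parts are translates of the same \<open>C\<close>, which stays below the
  growing family; hence the letters can be treated one after the other.\<close>

lemma Phi_split_many:
  assumes \<gamma>: "family \<gamma>" and C: "family C" "\<And>v. v \<in> V \<Longrightarrow> C v \<subseteq> \<gamma> v" and L: "finite L" "L \<subseteq> letters S"
  shows "Phi (\<lambda>v. \<gamma> v \<union> (\<Union>l\<in>L. T (letter_value G l) ` C (inv (letter_value G l) <# v))) \<le> Phi \<gamma>"
  using L
proof (induction L rule: finite_induct)
  case (insert l L)
  define \<delta> where "\<delta> = (\<lambda>v. \<gamma> v \<union> (\<Union>l\<in>L. T (letter_value G l) ` C (inv (letter_value G l) <# v)))"
  have l: "snd l \<in> S" "L \<subseteq> letters S" using insert by auto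
  have "family \<delta>"
    using \<gamma> C insert by (auto simp: family_def \<delta>_def intro!: adm_UN adm_Un)
  then have "Phi (\<lambda>v. \<delta> v \<union> T (letter_value G l) ` C (inv (letter_value G l) <# v)) \<le> Phi \<delta>"
    using C l by (intro Phi_split) (auto simp: \<delta>_def)
  moreover have "Phi \<delta> \<le> Phi \<gamma>" using insert unfolding \<delta>_def by auto
  moreover have "\<delta> v \<union> T (letter_value G l) ` C (inv (letter_value G l) <# v) =
      \<gamma> v \<union> (\<Union>l\<in>insert l L. T (letter_value G l) ` C (inv (letter_value G l) <# v))" for v
    by (auto simp: \<delta>_def)
  ultimately show ?case by simp
qed simp

text \<open>On the Cayley tree this joins to each vertex collection all those at distance at most
  \<open>n\<close>. For a constant family it is the join over the ball of radius
  \<open>n\<close>.\<close>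

definition expand :: "nat \<Rightarrow> ('a set \<Rightarrow> 'e set) \<Rightarrow> 'a set \<Rightarrow> 'e set" where
  "expand n C v = (\<Union>g\<in>word_ball G S n. T g ` C (inv g <# v))"

lemma family_expand [simp]: "family C \<Longrightarrow> family (expand n C)"
  unfolding family_def expand_def using word_ball_carrier
  by (intro ballI adm_UN adm_T) (auto simp: subset_iff)

lemma expand_0: "family C \<Longrightarrow> v \<in> V \<Longrightarrow> expand 0 C v = C v"
  by (simp add: expand_def)

lemma expand_Suc:
  assumes "family C" "v \<in> V"
  shows "expand (Suc n) C v =
    expand n C v \<union> (\<Union>l\<in>letters S. T (letter_value G l) ` expand n C (inv (letter_value G l) <# v))"
proof -
  have "T (letter_value G l \<otimes> g) ` C (inv (letter_value G l \<otimes> g) <# v) =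
      T (letter_value G l) ` T g ` C (inv g <# (inv (letter_value G l) <# v))"
    if "l \<in> letters S" "g \<in> word_ball G S n" for l g
  proof -
    have "g \<in> carrier G" using word_ball_carrier that by auto
    then show ?thesis using that assms by (simp add: T_image_mult inv_mult_group)
  qed
  then have "(\<Union>g\<in>(\<lambda>g. letter_value G l \<otimes> g) ` word_ball G S n. T g ` C (inv g <# v)) =
      T (letter_value G l) ` expand n C (inv (letter_value G l) <# v)" if "l \<in> letters S" for l
    using that unfolding expand_def image_UN by (auto simp: image_UN)
  then show ?thesis unfolding expand_def[of "Suc n"] word_ball_Suc UN_Un UN_UN_flatten
    by (simp add: expand_def[of n C v])
qed

lemma expand_mono: "m \<le> n \<Longrightarrow> expand m C v \<subseteq> expand n C v"
  using word_ball_mono[of m n G S] by (auto simp: expand_def)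

text \<open>Enlarging the radius by one is a simultaneous split along \<open>expand n C\<close>; the
  family \<zeta> is only carried along.\<close>

lemma Phi_expand_Un:
  assumes \<zeta>: "family \<zeta>" and C: "family C"
  shows "Phi (\<lambda>v. \<zeta> v \<union> expand (Suc n) C v) \<le> Phi (\<lambda>v. \<zeta> v \<union> expand n C v)"
proof -
  have "Phi (\<lambda>v. \<zeta> v \<union> expand (Suc n) C v) = Phi (\<lambda>v. (\<zeta> v \<union> expand n C v) \<union>
      (\<Union>l\<in>letters S. T (letter_value G l) ` expand n C (inv (letter_value G l) <# v)))"
    unfolding Phi_def by (intro sum.cong arg_cong2[where f = "(-)"]) (simp_all add: expand_Suc C Un_assoc)
  also have "\<dots> \<le> Phi (\<lambda>v. \<zeta> v \<union> expand n C v)"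
    using assms family_expand[OF C] by (intro Phi_split_many) (auto simp: family_def)
  finally show ?thesis .
qed

lemma Phi_cong: "(\<And>v. v \<in> V \<Longrightarrow> \<gamma> v = \<delta> v) \<Longrightarrow> Phi \<gamma> = Phi \<delta>"
  unfolding Phi_def by (intro sum.cong arg_cong2[where f = "(-)"]) simp_all

lemma Phi_expand_Un_le:
  assumes "family \<zeta>" "family C" "\<And>v. v \<in> V \<Longrightarrow> C v \<subseteq> \<zeta> v"
  shows "Phi (\<lambda>v. \<zeta> v \<union> expand n C v) \<le> Phi \<zeta>"
proof (induction n)
  case 0
  have "Phi (\<lambda>v. \<zeta> v \<union> expand 0 C v) = Phi \<zeta>"
    using assms by (intro Phi_cong) (auto simp: expand_0)
  then show ?case by simp
next
  case (Suc n)
  then show ?case using Phi_expand_Un[OF assms(1,2), of n] by simp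
qed

lemma Phi_expand_antimono:
  assumes "family C"
  shows "Phi (expand (Suc n) C) \<le> Phi (expand n C)"
proof -
  have "Phi (\<lambda>v. {} \<union> expand (Suc n) C v) \<le> Phi (\<lambda>v. {} \<union> expand n C v)"
    using assms by (intro Phi_expand_Un) (simp_all add: family_def)
  then show ?thesis by simp
qed

lemma Phi_expand_le: "family C \<Longrightarrow> Phi (expand n C) \<le> Phi C"
proof (induction n)
  case 0
  have "Phi (expand 0 C) = Phi C" by (intro Phi_cong) (auto simp: expand_0 0)
  then show ?case by simp
next
  case (Suc n)
  then show ?case using Phi_expand_antimono[of C n] by simp
qed

text \<open>The mutual informations can only grow and are subtracted, so the rise is bounded by the
  growth of the vertex entropies.\<close>

lemma Phi_add_le:
  assumes "family \<gamma>" "adm A"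
  shows "Phi (\<lambda>v. \<gamma> v \<union> A) \<le> Phi \<gamma> + (\<Sum>v\<in>V. hc A (\<gamma> v))"
proof -
  have "J (\<gamma> (s <# v)) s (\<gamma> v) \<le> J (\<gamma> (s <# v) \<union> A) s (\<gamma> v \<union> A)" if "s \<in> S" "v \<in> V" for s v
    using that assms by (intro J_mono) auto
  then have "(\<Sum>s\<in>S. \<Sum>v\<in>V. J (\<gamma> (s <# v)) s (\<gamma> v)) \<le>
      (\<Sum>s\<in>S. \<Sum>v\<in>V. J (\<gamma> (s <# v) \<union> A) s (\<gamma> v \<union> A))"
    by (intro sum_mono)
  then show ?thesis unfolding Phi_eq hc_def by (simp add: sum_subtractf Un_commute)
qed

text \<open>On each edge, \<open>J\<close> loses at most the conditional entropies of the dropped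
  parts at its two ends. Every vertex is met by \<open>2 * card S\<close> edge ends, which gives the
  factor.\<close>

lemma Phi_drop_le:
  assumes "family \<gamma>" "family \<zeta>"
  shows "Phi \<gamma> \<le> Phi (\<lambda>v. \<gamma> v \<union> \<zeta> v) + 2 * card S * (\<Sum>v\<in>V. hc (\<zeta> v) (\<gamma> v))"
proof -
  let ?d = "\<Sum>v\<in>V. hc (\<zeta> v) (\<gamma> v)"
  have "(\<Sum>v\<in>V. J (\<gamma> (s <# v) \<union> \<zeta> (s <# v)) s (\<gamma> v \<union> \<zeta> v)) \<le> (\<Sum>v\<in>V. J (\<gamma> (s <# v)) s (\<gamma> v)) + 2 * ?d"
    if s: "s \<in> S" for s
  proof -
    have "(\<Sum>v\<in>V. J (\<gamma> (s <# v) \<union> \<zeta> (s <# v)) s (\<gamma> v \<union> \<zeta> v)) \<le>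
        (\<Sum>v\<in>V. J (\<gamma> (s <# v)) s (\<gamma> v) + hc (\<zeta> (s <# v)) (\<gamma> (s <# v)) + hc (\<zeta> v) (\<gamma> v))"
      using s assms by (intro sum_mono J_Un_le) auto
    also have "\<dots> = (\<Sum>v\<in>V. J (\<gamma> (s <# v)) s (\<gamma> v)) + 2 * ?d"
      using sum_shift[of s "\<lambda>v. hc (\<zeta> v) (\<gamma> v)"] s by (simp add: sum.distrib)
    finally show ?thesis .
  qed
  then have "(\<Sum>s\<in>S. \<Sum>v\<in>V. J (\<gamma> (s <# v) \<union> \<zeta> (s <# v)) s (\<gamma> v \<union> \<zeta> v)) \<le>
      (\<Sum>s\<in>S. (\<Sum>v\<in>V. J (\<gamma> (s <# v)) s (\<gamma> v)) + 2 * ?d)"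
    by (intro sum_mono)
  moreover have "(\<Sum>v\<in>V. h (\<gamma> v)) \<le> (\<Sum>v\<in>V. h (\<gamma> v \<union> \<zeta> v))"
    using assms by (intro sum_mono h_mono) auto
  ultimately show ?thesis unfolding Phi_eq by (simp add: sum.distrib)
qed

definition Fval :: "'e set \<Rightarrow> real" where
  "Fval C = h C - (\<Sum>s\<in>S. J C s C)"

lemma Phi_const: "Phi (\<lambda>_. C) = card V * Fval C"
  by (simp add: Phi_def Fval_def)

lemma Phi_capture:
  assumes \<gamma>: "family \<gamma>" and \<alpha>: "adm \<alpha>"
    and gen: "\<And>C \<epsilon>. adm C \<Longrightarrow> \<epsilon> > 0 \<Longrightarrow> \<exists>k. hc C (orb (word_ball G S k) \<alpha>) < \<epsilon>"
    and cap: "\<And>\<epsilon>. \<epsilon> > 0 \<Longrightarrow> \<exists>n. \<forall>v\<in>V. hc \<alpha> (expand n \<gamma> v) < \<epsilon>"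
    and \<epsilon>: "\<epsilon> > 0"
  shows "\<exists>k. card V * Fval (orb (word_ball G S k) \<alpha>) \<le> Phi \<gamma> + \<epsilon>"
proof -
  define N where "N = real (card V)"
  have "V \<noteq> {}" using K_V by (metis empty_iff)
  then have N: "N > 0" by (simp add: N_def card_gt_0_iff)
  \<comment> \<open>Adding \<alpha> at all \<open>N\<close> vertices will cost at most
    \<open>N * \<eta>\<close>, and forgetting \<zeta> at most
    \<open>2 * card S * N * \<eta>\<close>; together this is \<epsilon>.\<close>
  define \<eta> where "\<eta> = \<epsilon> / (N * (1 + 2 * card S))"
  have \<eta>: "\<eta> > 0" using N \<epsilon> by (simp add: \<eta>_def add_pos_nonneg)
  obtain n where n: "\<forall>v\<in>V. hc \<alpha> (expand n \<gamma> v) < \<eta>" using cap[OF \<eta>] by auto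
  define \<zeta> where "\<zeta> = (\<lambda>v. expand n \<gamma> v \<union> \<alpha>)"
  have \<zeta>: "family \<zeta>" using \<gamma> \<alpha> family_expand[OF \<gamma>, of n] by (auto simp: \<zeta>_def family_def)
  have "Phi \<zeta> \<le> Phi (expand n \<gamma>) + (\<Sum>v\<in>V. hc \<alpha> (expand n \<gamma> v))"
    unfolding \<zeta>_def using \<gamma> \<alpha> by (intro Phi_add_le) auto
  also have "\<dots> \<le> Phi \<gamma> + N * \<eta>"
    using Phi_expand_le[OF \<gamma>, of n] sum_bounded_above[of V "\<lambda>v. hc \<alpha> (expand n \<gamma> v)" \<eta>] n
    by (fastforce simp: N_def)
  finally have 1: "Phi \<zeta> \<le> Phi \<gamma> + N * \<eta>" .
  \<comment> \<open>The radius is chosen for the join of all \<zeta> over the cosets, so that one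
    \<open>k\<close> serves every vertex.\<close>
  obtain k where k: "hc (\<Union>v\<in>V. \<zeta> v) (orb (word_ball G S k) \<alpha>) < \<eta>"
    using gen[OF _ \<eta>, of "\<Union>v\<in>V. \<zeta> v"] \<zeta> by auto
  define D where "D = orb (word_ball G S k) \<alpha>"
  have fam\<alpha>: "family (\<lambda>_. \<alpha>)" using \<alpha> by (simp add: family_def)
  have D: "adm D" unfolding D_def orb_def using \<alpha> word_ball_carrier by (auto intro!: adm_UN adm_T)
  \<comment> \<open>A constant family expands to a constant family. Once \<zeta> is forgotten, the
    value is therefore \<open>card V\<close> times the functional of the group itself.\<close>
  have Dk: "expand k (\<lambda>_. \<alpha>) = (\<lambda>_. D)" by (simp add: expand_def D_def orb_def fun_eq_iff)
  have 2: "Phi (\<lambda>v. \<zeta> v \<union> D) \<le> Phi \<zeta>"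
    using Phi_expand_Un_le[OF \<zeta> fam\<alpha>, of k] by (auto simp: Dk \<zeta>_def)
  have "hc (\<zeta> v) D \<le> \<eta>" if "v \<in> V" for v
  proof -
    have "hc (\<zeta> v) D \<le> hc (\<Union>v\<in>V. \<zeta> v) D"
      using that \<zeta> D by (intro hc_mono) (auto intro!: adm_UN)
    then show ?thesis using k by (simp add: D_def)
  qed
  then have "(\<Sum>v\<in>V. hc (\<zeta> v) D) \<le> N * \<eta>"
    using sum_bounded_above[of V "\<lambda>v. hc (\<zeta> v) D" \<eta>] by (simp add: N_def)
  then have "2 * card S * (\<Sum>v\<in>V. hc (\<zeta> v) D) \<le> 2 * card S * (N * \<eta>)"
    by (intro mult_left_mono) auto
  moreover have "Phi (\<lambda>_. D) \<le> Phi (\<lambda>v. D \<union> \<zeta> v) + 2 * card S * (\<Sum>v\<in>V. hc (\<zeta> v) D)"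
    using D \<zeta> by (intro Phi_drop_le) (auto simp: family_def)
  ultimately have "Phi (\<lambda>_. D) \<le> Phi \<gamma> + N * \<eta> + 2 * card S * (N * \<eta>)"
    using 1 2 by (simp add: Un_commute)
  also have "N * \<eta> + 2 * card S * (N * \<eta>) = \<epsilon>"
  proof -
    have "1 + 2 * real (card S) > 0" by (simp add: add_pos_nonneg)
    then have "N * (1 + 2 * real (card S)) \<noteq> 0" using N by simp
    then have "N * (1 + 2 * real (card S)) * \<eta> = \<epsilon>" by (simp add: \<eta>_def)
    then show ?thesis by (simp add: algebra_simps)
  qed
  then have "Phi \<gamma> + N * \<eta> + 2 * card S * (N * \<eta>) = Phi \<gamma> + \<epsilon>" by linarith
  finally show ?thesis unfolding Phi_const D_def by blast
qed

end

section \<open>Foldings\<close>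

text \<open>Labels of paths from \<open>b\<close>, edges being traversable in both directions. A
  path grows by multiplication on the left, so the last edge gives the leftmost factor.\<close>

inductive_set reach :: "('g, 'b) monoid_scheme \<Rightarrow> ('n \<times> 'g \<times> 'n) set \<Rightarrow> 'n \<Rightarrow> ('g \<times> 'n) set"
  for G E b where
  base: "(\<one>\<^bsub>G\<^esub>, b) \<in> reach G E b"
| forward: "(g, u) \<in> reach G E b \<Longrightarrow> (u, x, v) \<in> E \<Longrightarrow> (x \<otimes>\<^bsub>G\<^esub> g, v) \<in> reach G E b"
| backward: "(g, v) \<in> reach G E b \<Longrightarrow> (u, x, v) \<in> E \<Longrightarrow> (inv\<^bsub>G\<^esub> x \<otimes>\<^bsub>G\<^esub> g, u) \<in> reach G E b"

definition step :: "('n \<times> 'g \<times> 'n) set \<Rightarrow> bool \<times> 'g \<Rightarrow> 'n \<Rightarrow> 'n \<Rightarrow> bool" where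
  "step E l u v \<longleftrightarrow> (if fst l then (u, snd l, v) \<in> E else (v, snd l, u) \<in> E)"

text \<open>The head of the list is the last step, in accordance with \<open>word_value\<close> and
  \<open>reach\<close>.\<close>

primrec path :: "('n \<times> 'g \<times> 'n) set \<Rightarrow> 'n \<Rightarrow> (bool \<times> 'g) list \<Rightarrow> 'n \<Rightarrow> bool" where
  "path E b [] v \<longleftrightarrow> v = b"
| "path E b (l # w) v \<longleftrightarrow> (\<exists>u. path E b w u \<and> step E l u v)"

definition folded :: "('n \<times> 'g \<times> 'n) set \<Rightarrow> bool" where
  "folded E \<longleftrightarrow> (\<forall>u x v v'. (u, x, v) \<in> E \<and> (u, x, v') \<in> E \<longrightarrow> v = v') \<and>
     (\<forall>u u' x v. (u, x, v) \<in> E \<and> (u', x, v) \<in> E \<longrightarrow> u = u')"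

lemma step_letter_inv: "step E (letter_inv l) v u \<longleftrightarrow> step E l u v"
  by (auto simp: step_def letter_inv_def)

lemma step_det: "folded E \<Longrightarrow> step E l u v \<Longrightarrow> step E l u v' \<Longrightarrow> v = v'"
  unfolding folded_def step_def by (cases "fst l") (simp_all, blast+)

lemma path_det: "folded E \<Longrightarrow> path E b w v \<Longrightarrow> path E b w v' \<Longrightarrow> v = v'"
  by (induction w arbitrary: v v') (auto dest: step_det)

lemma path_append: "path E b (x @ y) v \<Longrightarrow> \<exists>u. path E b y u"
  by (induction x arbitrary: v) auto

text \<open>If the new letter cancels the previous one, determinism of a folded graph forces the
  walk back to where it came from. So reducing a label does not change the endpoint.\<close>

lemma path_push:
  assumes "folded E" "path E b w u" "step E l u v"
  shows "path E b (push l w) v"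
proof (cases w)
  case (Cons m w')
  show ?thesis
  proof (cases "m = letter_inv l")
    case True
    then obtain u0 where "path E b w' u0" "step E l u u0"
      using assms Cons by (auto simp: step_letter_inv)
    then show ?thesis using step_det[OF assms(1,3)] Cons True by (auto simp: push_Cons)
  qed (use assms Cons in \<open>auto simp: push_Cons\<close>)
qed (use assms in auto)

locale free_coset_system = coset_system G T U adm h S K + free_basis G S
  for G (structure) and T :: "'a \<Rightarrow> 'e \<Rightarrow> 'e" and U adm h S K
begin

text \<open>A finite graph over \<open>V\<close>, with an edge \<open>(u, x, v)\<close> leading from \<open>u\<close> to \<open>v\<close> and labelled by
  a group element; the last two conditions say that the fundamental group at \<open>b\<close> maps onto \<open>K\<close>
  and that the graph is connected.\<close>

definition graph_over ::
  "nat set \<Rightarrow> (nat \<times> 'a \<times> nat) set \<Rightarrow> (nat \<Rightarrow> 'e set) \<Rightarrow> (nat \<Rightarrow> 'a set) \<Rightarrow> nat \<Rightarrow> bool" where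
  "graph_over W E \<gamma> \<pi> b \<longleftrightarrow> finite W \<and> finite E \<and> b \<in> W \<and>
     (\<forall>u x v. (u, x, v) \<in> E \<longrightarrow>
        u \<in> W \<and> v \<in> W \<and> x \<in> carrier G \<and> x \<noteq> \<one> \<and> \<pi> v = x <# \<pi> u) \<and>
     (\<forall>u\<in>W. \<pi> u \<in> V \<and> adm (\<gamma> u)) \<and> \<pi> b = K \<and>
     (\<forall>k\<in>K. (k, b) \<in> reach G E b) \<and> (\<forall>u\<in>W. \<exists>g. (g, u) \<in> reach G E b)"

lemma graph_over_edge:
  assumes "graph_over W E \<gamma> \<pi> b" "(u, x, v) \<in> E"
  shows "u \<in> W" "v \<in> W" "x \<in> carrier G" "x \<noteq> \<one>" "\<pi> v = x <# \<pi> u" "\<pi> u \<in> V" "\<pi> v \<in> V"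
    "adm (\<gamma> u)" "adm (\<gamma> v)"
  using assms unfolding graph_over_def by blast+

definition edge_J :: "(nat \<Rightarrow> 'e set) \<Rightarrow> nat \<times> 'a \<times> nat \<Rightarrow> real" where
  "edge_J \<gamma> = (\<lambda>(u, x, v). J (\<gamma> v) x (\<gamma> u))"

definition graph_val :: "nat set \<Rightarrow> (nat \<times> 'a \<times> nat) set \<Rightarrow> (nat \<Rightarrow> 'e set) \<Rightarrow> real" where
  "graph_val W E \<gamma> = (\<Sum>u\<in>W. h (\<gamma> u)) - (\<Sum>e\<in>E. edge_J \<gamma> e)"

definition chi :: "nat set \<Rightarrow> (nat \<times> 'a \<times> nat) set \<Rightarrow> int" where
  "chi W E = int (card W) - int (card E)"

text \<open>The Euler characteristic never drops under the moves, and it is bounded by that of the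
  coset graph; so the possible loss of an edge, which could raise the value, is excluded whenever
  the two characteristics agree at the start.\<close>

definition improves where
  "improves W E \<gamma> b W' E' \<gamma>' b' \<longleftrightarrow> chi W E \<le> chi W' E' \<and>
     (chi W E = chi W' E' \<longrightarrow> graph_val W' E' \<gamma>' \<le> graph_val W E \<gamma>) \<and> \<gamma> b \<subseteq> \<gamma>' b'"

lemma improves_refl: "improves W E \<gamma> b W E \<gamma> b"
  by (simp add: improves_def)

lemma improves_trans:
  assumes 1: "improves W E \<gamma> b W' E' \<gamma>' b'" and 2: "improves W' E' \<gamma>' b' W'' E'' \<gamma>'' b''"
  shows "improves W E \<gamma> b W'' E'' \<gamma>'' b''"
proof -
  note 1 = 1[unfolded improves_def] and 2 = 2[unfolded improves_def]
  have "graph_val W'' E'' \<gamma>'' \<le> graph_val W E \<gamma>" if "chi W E = chi W'' E''"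
  proof -
    have "chi W E = chi W' E'" "chi W' E' = chi W'' E''" using that 1 2 by linarith+
    with 1 2 show ?thesis by simp
  qed
  moreover have "chi W E \<le> chi W'' E''" using 1 2 by linarith
  moreover have "\<gamma> b \<subseteq> \<gamma>'' b''" using 1 2 by blast
  ultimately show ?thesis unfolding improves_def by blast
qed

text \<open>The weights make every move of the folding procedure (reversing an edge, subdividing it,
  folding two edges) decrease the cost.\<close>

definition label_cost :: "'a \<Rightarrow> nat" where
  "label_cost x = (if x \<in> S then 0 else if inv x \<in> S then 1 else 3 * length (nf x))"

definition cost :: "nat set \<Rightarrow> (nat \<times> 'a \<times> nat) set \<Rightarrow> nat" where
  "cost W E = card W + (\<Sum>e\<in>E. label_cost (fst (snd e)))"

section \<open>Moves on labelled graphs\<close>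

lemma reach_carrier:
  assumes "\<And>u x v. (u, x, v) \<in> E \<Longrightarrow> x \<in> carrier G" "(g, u) \<in> reach G E b"
  shows "g \<in> carrier G"
  using assms(2)
proof induction
  case (forward g u x v)
  then show ?case using assms(1)[of u x v] by simp
next
  case (backward g v u x)
  then show ?case using assms(1)[of u x v] by simp
qed simp

text \<open>An old edge need only be traversable in the new graph in both directions, possibly along
  several new edges; this form suits reversal, subdivision and identification of vertices.\<close>

lemma reach_map:
  assumes "\<And>u x v. (u, x, v) \<in> E \<Longrightarrow> x \<in> carrier G" "(g, u) \<in> reach G E b"
    and "\<And>g u x v. (u, x, v) \<in> E \<Longrightarrow> g \<in> carrier G \<Longrightarrow> (g, f u) \<in> reach G E' (f b) \<Longrightarrow>
      (x \<otimes> g, f v) \<in> reach G E' (f b)"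
    and "\<And>g u x v. (u, x, v) \<in> E \<Longrightarrow> g \<in> carrier G \<Longrightarrow> (g, f v) \<in> reach G E' (f b) \<Longrightarrow>
      (inv x \<otimes> g, f u) \<in> reach G E' (f b)"
  shows "(g, f u) \<in> reach G E' (f b)"
proof -
  have carr: "k \<in> carrier G" if "(k, w) \<in> reach G E b" for k w
    by (rule reach_carrier[OF _ that]) (rule assms(1))
  show ?thesis
    using assms(2)
  proof induction
    case base
    show ?case by (rule reach.base)
  next
    case (forward g u x v)
    show ?case by (rule assms(3)[OF forward.hyps(2) carr[OF forward.hyps(1)] forward.IH])
  next
    case (backward g v u x)
    show ?case by (rule assms(4)[OF backward.hyps(2) carr[OF backward.hyps(1)] backward.IH])
  qed
qed

lemma improve_flip:
  assumes gr: "graph_over W E \<gamma> \<pi> b" and e: "(u, x, v) \<in> E" and x: "x \<notin> S" "inv x \<in> S"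
  shows "\<exists>E'. graph_over W E' \<gamma> \<pi> b \<and> improves W E \<gamma> b W E' \<gamma> b \<and> cost W E' < cost W E"
proof -
  define E0 where "E0 = E - {(u, x, v)}"
  define E' where "E' = insert (v, inv x, u) E0"
  have E: "E = insert (u, x, v) E0" "(u, x, v) \<notin> E0" "finite E0"
    using e gr by (auto simp: E0_def graph_over_def)
  have uv: "u \<in> W" "v \<in> W" "x \<in> carrier G" "x \<noteq> \<one>" "\<pi> v = x <# \<pi> u" "\<pi> u \<in> V"
    "adm (\<gamma> u)" "adm (\<gamma> v)"
    using graph_over_edge[OF gr e] by blast+
  have uback: "\<pi> u = inv x <# \<pi> v" using uv by simp
  have carr: "\<And>u x v. (u, x, v) \<in> E \<Longrightarrow> x \<in> carrier G" using graph_over_edge[OF gr] by blast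
  have 1: "(x \<otimes> g, v) \<in> reach G E' b" if "(g, u) \<in> reach G E' b" for g
    using reach.backward[OF that, of v "inv x"] uv by (simp add: E'_def)
  have 2: "(inv x \<otimes> g, u) \<in> reach G E' b" if "(g, v) \<in> reach G E' b" for g
    using reach.forward[OF that, of "inv x" u] by (simp add: E'_def)
  have reach: "(g, w) \<in> reach G E' b" if "(g, w) \<in> reach G E b" for g w
  proof -
    have 3: "(z \<otimes> g, q) \<in> reach G E' b" if "(p, z, q) \<in> E" "(g, p) \<in> reach G E' b" for p z q g
      using that 1 by (cases "(p, z, q) = (u, x, v)") (auto simp: E E'_def intro: reach.forward)
    have 4: "(inv z \<otimes> g, p) \<in> reach G E' b" if "(p, z, q) \<in> E" "(g, q) \<in> reach G E' b" for p z q g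
      using that 2 by (cases "(p, z, q) = (u, x, v)") (auto simp: E E'_def intro: reach.backward)
    show ?thesis by (rule reach_map[where f = "\<lambda>w. w", OF carr that 3 4])
  qed
  have "inv x \<noteq> \<one>" using uv by (metis inv_inv inv_one)
  have graph: "graph_over W E' \<gamma> \<pi> b"
    unfolding graph_over_def
  proof (intro conjI allI ballI impI)
    fix p z q assume "(p, z, q) \<in> E'"
    then consider "p = v" "z = inv x" "q = u" | "(p, z, q) \<in> E" by (auto simp: E'_def E0_def)
    then have "p \<in> W \<and> q \<in> W \<and> z \<in> carrier G \<and> z \<noteq> \<one> \<and> \<pi> q = z <# \<pi> p"
    proof cases
      case 1
      with uv uback \<open>inv x \<noteq> \<one>\<close> show ?thesis by simp
    next
      case 2
      from graph_over_edge[OF gr 2] show ?thesis by blast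
    qed
    then show "p \<in> W" "q \<in> W" "z \<in> carrier G" "z \<noteq> \<one>" "\<pi> q = z <# \<pi> p"
      by auto
  next
    fix p assume "p \<in> W"
    then show "\<exists>g. (g, p) \<in> reach G E' b" using gr reach unfolding graph_over_def by blast
  next
    fix k assume "k \<in> K"
    then show "(k, b) \<in> reach G E' b" using gr reach unfolding graph_over_def by blast
  qed (use gr E in \<open>auto simp: graph_over_def E'_def\<close>)
  \<comment> \<open>The reversed edge may already be present. Then an edge is lost and the Euler
    characteristic rises, in which case nothing is claimed about the value.\<close>
  have card: "card E' \<le> card E" using E by (simp add: E'_def card_insert_if)
  have val: "graph_val W E' \<gamma> \<le> graph_val W E \<gamma>" if "card E' = card E"
  proof -
    have "(v, inv x, u) \<notin> E0" using that E by (auto simp: E'_def insert_absorb)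
    then have "(\<Sum>e\<in>E'. edge_J \<gamma> e) = (\<Sum>e\<in>E. edge_J \<gamma> e)"
      using E uv by (simp add: E'_def edge_J_def J_flip)
    then show ?thesis by (simp add: graph_val_def)
  qed
  have "cost W E' < cost W E"
  proof -
    have "label_cost (inv x) = 0" "label_cost x = 1" using x by (auto simp: label_cost_def)
    then show ?thesis using E by (cases "(v, inv x, u) \<in> E0") (auto simp: cost_def E'_def insert_absorb)
  qed
  moreover have "improves W E \<gamma> b W E' \<gamma> b"
    using card val by (auto simp: improves_def chi_def)
  ultimately show ?thesis using graph by blast
qed

text \<open>The first letter of the normal form is split off, \<open>x = a \<otimes> y\<close>. The
  new vertex carries the translate by \<open>y\<close> of the source collection: its entropy equals
  the mutual information on the edge labelled \<open>y\<close>, and the edge labelled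
  \<open>a\<close> inherits that of the old edge. So the value does not change.\<close>

lemma improve_subdivide:
  assumes gr: "graph_over W E \<gamma> \<pi> b" and e: "(u, x, v) \<in> E" and x: "x \<notin> S" "inv x \<notin> S"
  shows "\<exists>W' E' \<gamma>' \<pi>'. graph_over W' E' \<gamma>' \<pi>' b \<and> improves W E \<gamma> b W' E' \<gamma>' b \<and> cost W' E' < cost W E"
proof -
  have uv: "u \<in> W" "v \<in> W" "x \<in> carrier G" "x \<noteq> \<one>" "\<pi> v = x <# \<pi> u" "\<pi> u \<in> V"
    "adm (\<gamma> u)" "adm (\<gamma> v)"
    using graph_over_edge[OF gr e] by blast+
  note nfx = nf_props[OF uv(3)]
  obtain l w where lw: "nf x = l # w" using nfx uv by (cases "nf x") auto
  define y where "y = word_value G w"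
  define a where "a = letter_value G l"
  have l: "snd l \<in> S" and w: "w \<in> words_over S" "reduced_word w"
    using nfx by (auto simp: lw intro: reduced_word_tl)
  have ay: "a \<in> carrier G" "y \<in> carrier G" "x = a \<otimes> y"
    using nfx lw l w by (auto simp: a_def y_def)
  have a: "a \<in> S \<or> inv a \<in> S" using l by (auto simp: a_def letter_value_def)
  have "w \<noteq> []"
  proof
    assume "w = []"
    then have "x = a" using ay by (simp add: y_def)
    then show False using a x by auto
  qed
  have nfy: "nf y = w" using nf_reduced w by (simp add: y_def)
  have "y \<noteq> \<one>" using nfy nf_one \<open>w \<noteq> []\<close> by auto
  have one_S: "\<one> \<notin> S" using one_notin_free_generating_set[OF free] .
  have "a \<noteq> \<one>" using a one_S by auto
  have "finite W" using gr by (simp add: graph_over_def)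
  then obtain m where m: "m \<notin> W" using ex_new_if_finite[OF infinite_UNIV_nat] by blast
  define E0 where "E0 = E - {(u, x, v)}"
  define E' where "E' = insert (u, y, m) (insert (m, a, v) E0)"
  define \<gamma>' where "\<gamma>' = \<gamma>(m := T y ` \<gamma> u)"
  define \<pi>' where "\<pi>' = \<pi>(m := y <# \<pi> u)"
  have E: "E = insert (u, x, v) E0" "(u, x, v) \<notin> E0" "finite E0"
    using e gr by (auto simp: E0_def graph_over_def)
  have new: "m \<noteq> u" "m \<noteq> v" "m \<noteq> b" using m uv gr by (auto simp: graph_over_def)
  have E0W: "p \<in> W \<and> q \<in> W \<and> z \<in> carrier G \<and> z \<noteq> \<one> \<and> \<pi> q = z <# \<pi> p" if "(p, z, q) \<in> E0" for p z q
    using that gr by (auto simp: E0_def graph_over_def)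
  then have notE0: "(u, y, m) \<notin> E0" "(m, a, v) \<notin> E0" using m by auto
  have carr: "\<And>u x v. (u, x, v) \<in> E \<Longrightarrow> x \<in> carrier G" using graph_over_edge[OF gr] by blast
  have 1: "(x \<otimes> g, v) \<in> reach G E' b" if "(g, u) \<in> reach G E' b" "g \<in> carrier G" for g
    using reach.forward[OF reach.forward[OF that(1), of y m], of a v] that ay
    by (simp add: E'_def m_assoc)
  have 2: "(inv x \<otimes> g, u) \<in> reach G E' b" if "(g, v) \<in> reach G E' b" "g \<in> carrier G" for g
    using reach.backward[OF reach.backward[OF that(1), of m a], of u y] that ay
    by (simp add: E'_def m_assoc inv_mult_group)
  have reach: "(g, w) \<in> reach G E' b" if "(g, w) \<in> reach G E b" for g w
  proof -
    have 3: "(z \<otimes> g, q) \<in> reach G E' b"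
      if "(p, z, q) \<in> E" "g \<in> carrier G" "(g, p) \<in> reach G E' b" for p z q g
      using that 1 by (cases "(p, z, q) = (u, x, v)") (auto simp: E E'_def intro: reach.forward)
    have 4: "(inv z \<otimes> g, p) \<in> reach G E' b"
      if "(p, z, q) \<in> E" "g \<in> carrier G" "(g, q) \<in> reach G E' b" for p z q g
      using that 2 by (cases "(p, z, q) = (u, x, v)") (auto simp: E E'_def intro: reach.backward)
    show ?thesis by (rule reach_map[where f = "\<lambda>w. w", OF carr that 3 4])
  qed
  have "\<exists>g. (g, m) \<in> reach G E' b"
  proof -
    obtain g where "(g, u) \<in> reach G E b" using gr uv by (auto simp: graph_over_def)
    then show ?thesis using reach.forward[OF reach, of g u y m] by (auto simp: E'_def)
  qed
  have \<pi>v: "\<pi> v = a <# (y <# \<pi> u)" using uv ay by simp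
  have graph: "graph_over (insert m W) E' \<gamma>' \<pi>' b"
    unfolding graph_over_def
  proof (intro conjI allI ballI impI)
    fix p z q assume "(p, z, q) \<in> E'"
    then consider "(p, z, q) = (u, y, m)" | "(p, z, q) = (m, a, v)" | "(p, z, q) \<in> E0"
      by (auto simp: E'_def)
    then have "p \<in> insert m W \<and> q \<in> insert m W \<and> z \<in> carrier G \<and> z \<noteq> \<one> \<and> \<pi>' q = z <# \<pi>' p"
    proof cases
      case 3
      then show ?thesis using E0W[OF 3] m by (auto simp: \<pi>'_def)
    qed (use uv new ay \<open>y \<noteq> \<one>\<close> \<open>a \<noteq> \<one>\<close> \<pi>v in \<open>auto simp: \<pi>'_def\<close>)
    then show "p \<in> insert m W" "q \<in> insert m W" "z \<in> carrier G" "z \<noteq> \<one>" "\<pi>' q = z <# \<pi>' p"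
      by auto
  next
    fix p assume "p \<in> insert m W"
    then show "\<exists>g. (g, p) \<in> reach G E' b"
      using gr reach \<open>\<exists>g. (g, m) \<in> reach G E' b\<close> unfolding graph_over_def by blast
  qed (use gr uv ay new E reach in \<open>auto simp: graph_over_def E'_def \<gamma>'_def \<pi>'_def\<close>)
  have cardW: "card (insert m W) = Suc (card W)" using m gr by (simp add: graph_over_def)
  have cardE: "card E' = Suc (card E)" using E notE0 new by (simp add: E'_def)
  have "(\<Sum>e\<in>E0. edge_J \<gamma>' e) = (\<Sum>e\<in>E0. edge_J \<gamma> e)"
    using E0W m by (intro sum.cong) (auto simp: edge_J_def \<gamma>'_def)
  moreover have "edge_J \<gamma>' (u, y, m) = h (\<gamma> u)"
    using uv ay new by (simp add: edge_J_def \<gamma>'_def J_def)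
  moreover have "edge_J \<gamma>' (m, a, v) = edge_J \<gamma> (u, x, v)"
    using uv ay new by (simp add: edge_J_def \<gamma>'_def J_def T_image_mult)
  moreover have "(\<Sum>p\<in>insert m W. h (\<gamma>' p)) = h (\<gamma> u) + (\<Sum>p\<in>W. h (\<gamma> p))"
  proof -
    have "(\<Sum>p\<in>W. h (\<gamma>' p)) = (\<Sum>p\<in>W. h (\<gamma> p))" using m by (intro sum.cong) (auto simp: \<gamma>'_def)
    then show ?thesis using m gr uv ay by (simp add: graph_over_def \<gamma>'_def)
  qed
  ultimately have val: "graph_val (insert m W) E' \<gamma>' = graph_val W E \<gamma>"
    using E notE0 new by (simp add: graph_val_def E'_def)
  \<comment> \<open>This is where the factor 3 in \<open>label_cost\<close> comes from: the shorter
    label saves 3, while the new vertex and the single letter cost at most 1 each.\<close>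
  have "label_cost x = 3 * Suc (length w)" using x lw by (simp add: label_cost_def)
  moreover have "label_cost a \<le> 1" using a by (auto simp: label_cost_def)
  moreover have "label_cost y \<le> 3 * length w" using \<open>w \<noteq> []\<close> by (cases w) (auto simp: label_cost_def nfy)
  ultimately have "cost (insert m W) E' < cost W E"
    using E notE0 new cardW by (simp add: cost_def E'_def)
  moreover have "improves W E \<gamma> b (insert m W) E' \<gamma>' b"
    using cardW cardE val new by (auto simp: improves_def chi_def \<gamma>'_def)
  ultimately show ?thesis using graph by blast
qed

text \<open>The common part of both kinds of folds: \<open>u'\<close> is identified with
  \<open>u\<close>, whereby \<open>e\<close> and \<open>e'\<close> coincide. \<open>ineq\<close> is
  the balance of the terms directly affected; the remaining edges can only gain mutual
  information.\<close>

lemma improve_merge: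
  fixes u u' :: nat
  defines "f \<equiv> \<lambda>w. if w = u' then u else w"
  assumes gr: "graph_over W E \<gamma> \<pi> b" and u: "u \<in> W" "u' \<in> W" "u \<noteq> u'" "\<pi> u = \<pi> u'"
    and S: "\<forall>u x v. (u, x, v) \<in> E \<longrightarrow> x \<in> S"
    and e: "e \<in> E" "e' \<in> E" "e \<noteq> e'" "(\<lambda>(p, x, q). (f p, x, f q)) e = (\<lambda>(p, x, q). (f p, x, f q)) e'"
    and ineq: "h (\<gamma> u \<union> \<gamma> u') + edge_J \<gamma> e + edge_J \<gamma> e' \<le>
      h (\<gamma> u) + h (\<gamma> u') + edge_J (\<gamma>(u := \<gamma> u \<union> \<gamma> u')) ((\<lambda>(p, x, q). (f p, x, f q)) e)"
  shows "\<exists>W' E' \<gamma>' b'. graph_over W' E' \<gamma>' \<pi> b' \<and> improves W E \<gamma> b W' E' \<gamma>' b' \<and> cost W' E' < cost W E"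
proof -
  define F where "F = (\<lambda>(p, x :: 'a, q). (f p, x, f q))"
  define E' where "E' = F ` E"
  define W' where "W' = W - {u'}"
  define \<gamma>' where "\<gamma>' = \<gamma>(u := \<gamma> u \<union> \<gamma> u')"
  have fin: "finite W" "finite E" "b \<in> W" using gr by (auto simp: graph_over_def)
  have EW: "p \<in> W \<and> q \<in> W \<and> x \<in> carrier G \<and> x \<noteq> \<one> \<and> \<pi> q = x <# \<pi> p" if "(p, x, q) \<in> E" for p x q
    using that gr by (auto simp: graph_over_def)
  have adm: "adm (\<gamma> w)" "adm (\<gamma>' w)" if "w \<in> W" for w
    using that gr u by (auto simp: graph_over_def \<gamma>'_def)
  have f: "f w \<in> W'" "\<pi> (f w) = \<pi> w" if "w \<in> W" for w using u that by (auto simp: f_def W'_def)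
  have W'W: "W' \<subseteq> W" by (auto simp: W'_def)
  have fid: "f w = w" if "w \<in> W'" for w using that by (auto simp: f_def W'_def)
  have sub: "\<gamma> w \<subseteq> \<gamma>' (f w)" for w by (auto simp: \<gamma>'_def f_def)
  have FE: "(f p, x, f q) \<in> E'" if "(p, x, q) \<in> E" for p x q
    using that by (force simp: E'_def F_def)
  have carr: "\<And>u x v. (u, x, v) \<in> E \<Longrightarrow> x \<in> carrier G" using EW by blast
  have reach: "(g, f w) \<in> reach G E' (f b)" if "(g, w) \<in> reach G E b" for g w
  proof (rule reach_map[where f = f, OF _ that])
    show "x \<in> carrier G" if "(u, x, v) \<in> E" for u x v by (rule carr[OF that])
  qed (blast intro: reach.forward reach.backward FE)+
  have graph: "graph_over W' E' \<gamma>' \<pi> (f b)"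
    unfolding graph_over_def
  proof (intro conjI allI ballI impI)
    fix p x q assume "(p, x, q) \<in> E'"
    then obtain p0 q0 where pq: "(p0, x, q0) \<in> E" "p = f p0" "q = f q0" by (auto simp: E'_def F_def)
    note EW[OF pq(1)]
    then show "p \<in> W'" "q \<in> W'" "x \<in> carrier G" "x \<noteq> \<one>" "\<pi> q = x <# \<pi> p"
      using f by (auto simp: pq)
  next
    fix k assume "k \<in> K"
    then show "(k, f b) \<in> reach G E' (f b)" using gr by (auto simp: graph_over_def intro: reach)
  next
    fix w assume w: "w \<in> W'"
    then have "w \<in> W" using W'W by blast
    then obtain g where "(g, w) \<in> reach G E b" using gr unfolding graph_over_def by blast
    from reach[OF this] show "\<exists>g. (g, w) \<in> reach G E' (f b)" using fid[OF w] by auto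
  next
    show "\<pi> (f b) = K" using f fin gr by (simp add: graph_over_def)
  qed (use gr fin f W'W adm in \<open>auto simp: E'_def graph_over_def\<close>, simp add: W'_def)
  have "F e = F e'" using e(4) unfolding F_def .
  then have "F e' \<in> F ` (E - {e'})" using e(1,3) by (metis Diff_iff image_eqI singletonD)
  moreover have "E = insert e' (E - {e'})" using e(2) by blast
  ultimately have E'2: "E' = F ` (E - {e'})" unfolding E'_def by (metis image_insert insert_absorb)
  have "card E > 0" using e fin by (auto simp: card_gt_0_iff)
  have "card W > 0" using u fin by (auto simp: card_gt_0_iff)
  have cE: "Suc (card (E - {e'})) = card E" using card_Suc_Diff1[OF fin(2) e(2)] .
  have cW: "Suc (card W') = card W" unfolding W'_def using card_Suc_Diff1[OF fin(1) u(2)] .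
  have cE': "card E' \<le> card (E - {e'})" unfolding E'2 using fin by (intro card_image_le) auto
  have val: "graph_val W' E' \<gamma>' \<le> graph_val W E \<gamma>" if eq: "chi W E = chi W' E'"
  proof -
    \<comment> \<open>Equal characteristics mean that exactly one edge disappears with the one
      vertex, so no pair other than \<open>e\<close>, \<open>e'\<close> is identified.\<close>
    have "card (F ` (E - {e'})) = card (E - {e'})" using eq cE cW cE' E'2 by (simp add: chi_def)
    then have inj: "inj_on F (E - {e'})" using fin by (intro eq_card_imp_inj_on) auto
    have mono: "edge_J \<gamma> d \<le> edge_J \<gamma>' (F d)" if "d \<in> E" for d
    proof -
      obtain p x q where d: "d = (p, x, q)" by (cases d)
      have pq: "p \<in> W" "q \<in> W" "x \<in> carrier G" using EW[of p x q] that d by blast+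
      then have "f p \<in> W" "f q \<in> W" using f W'W by blast+
      with pq have "J (\<gamma> q) x (\<gamma> p) \<le> J (\<gamma>' (f q)) x (\<gamma>' (f p))"
        using sub by (intro J_mono) (auto simp: adm)
      then show ?thesis by (simp add: d edge_J_def F_def)
    qed
    have "(\<Sum>d\<in>E'. edge_J \<gamma>' d) = (\<Sum>d\<in>E-{e'}. edge_J \<gamma>' (F d))"
      unfolding E'2 using inj by (simp add: sum.reindex)
    also have "\<dots> = edge_J \<gamma>' (F e) + (\<Sum>d\<in>E-{e'}-{e}. edge_J \<gamma>' (F d))"
      using fin e by (intro sum.remove) auto
    also have "\<dots> \<ge> edge_J \<gamma>' (F e) + (\<Sum>d\<in>E-{e'}-{e}. edge_J \<gamma> d)"
      using mono by (intro add_left_mono sum_mono) auto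
    finally have 1: "(\<Sum>d\<in>E'. edge_J \<gamma>' d) \<ge> edge_J \<gamma>' (F e) + (\<Sum>d\<in>E-{e'}-{e}. edge_J \<gamma> d)" .
    have 2: "(\<Sum>d\<in>E. edge_J \<gamma> d) = edge_J \<gamma> e' + (edge_J \<gamma> e + (\<Sum>d\<in>E-{e'}-{e}. edge_J \<gamma> d))"
      using fin e sum.remove[of E e' "edge_J \<gamma>"] sum.remove[of "E - {e'}" e "edge_J \<gamma>"] by simp
    have "(\<Sum>w\<in>W'. h (\<gamma>' w)) = h (\<gamma> u \<union> \<gamma> u') + (\<Sum>w\<in>W'-{u}. h (\<gamma>' w))"
      using fin u sum.remove[of W' u "\<lambda>w. h (\<gamma>' w)"] by (simp add: W'_def \<gamma>'_def)
    also have "(\<Sum>w\<in>W'-{u}. h (\<gamma>' w)) = (\<Sum>w\<in>W'-{u}. h (\<gamma> w))"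
      by (intro sum.cong) (auto simp: \<gamma>'_def)
    finally have 3: "(\<Sum>w\<in>W'. h (\<gamma>' w)) = h (\<gamma> u \<union> \<gamma> u') + (\<Sum>w\<in>W'-{u}. h (\<gamma> w))" .
    have 4: "(\<Sum>w\<in>W. h (\<gamma> w)) = h (\<gamma> u') + (h (\<gamma> u) + (\<Sum>w\<in>W'-{u}. h (\<gamma> w)))"
      using fin u sum.remove[of W u' "\<lambda>w. h (\<gamma> w)"] sum.remove[of W' u "\<lambda>w. h (\<gamma> w)"]
      by (simp add: W'_def)
    show ?thesis using 1 2 3 4 ineq unfolding graph_val_def \<gamma>'_def F_def by linarith
  qed
  have zero: "label_cost (fst (snd d)) = 0" if "d \<in> E \<or> d \<in> E'" for d
  proof -
    have "fst (snd d) \<in> S"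
      using that S unfolding E'_def F_def by (cases d) fastforce
    then show ?thesis by (simp add: label_cost_def)
  qed
  \<comment> \<open>All labels lie in \<open>S\<close> and have cost 0, so the cost is the number of
    vertices.\<close>
  have "cost W' E' < cost W E" using zero cW by (simp add: cost_def)
  moreover have "improves W E \<gamma> b W' E' \<gamma>' (f b)"
    using cE cW cE' val sub[of b] by (auto simp: improves_def chi_def)
  ultimately show ?thesis using graph by blast
qed

text \<open>After cancellation this is submodularity of \<open>A\<close> and \<open>B\<close> over
  the translate of \<open>C\<close>. The larger \<open>C'\<close> is there for loops: if the common
  neighbour is itself one of the merged vertices, its collection grows too.\<close>

lemma fold_inequality:
  assumes "adm A" "adm B" "adm C" "adm C'" "C \<subseteq> C'" "x \<in> carrier G"
  shows "h (A \<union> B) + J A x C + J B x C \<le> h A + h B + J (A \<union> B) x C'"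
proof -
  have "h (A \<union> B \<union> T x ` C) + h (T x ` C) \<le> h (A \<union> T x ` C) + h (B \<union> T x ` C)"
    using assms by (intro h_submod) auto
  moreover have "J (A \<union> B) x C \<le> J (A \<union> B) x C'"
    using assms by (intro J_mono) auto
  ultimately show ?thesis using assms by (simp add: J_def)
qed

lemma improve_fold_target:
  assumes gr: "graph_over W E \<gamma> \<pi> b" and S: "\<forall>u x v. (u, x, v) \<in> E \<longrightarrow> x \<in> S"
    and e: "(v, x, u) \<in> E" "(v, x, u') \<in> E" "u \<noteq> u'"
  shows "\<exists>W' E' \<gamma>' b'. graph_over W' E' \<gamma>' \<pi> b' \<and> improves W E \<gamma> b W' E' \<gamma>' b' \<and> cost W' E' < cost W E"
proof -
  have \<pi>: "\<pi> u = \<pi> u'"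
    using graph_over_edge(5)[OF gr e(1)] graph_over_edge(5)[OF gr e(2)] by simp
  have u: "u \<in> W" "u' \<in> W" "v \<in> W" "\<pi> u = \<pi> u'" "adm (\<gamma> u)" "adm (\<gamma> u')" "adm (\<gamma> v)" "x \<in> carrier G"
    using graph_over_edge[OF gr e(1)] graph_over_edge[OF gr e(2)] \<pi> by blast+
  show ?thesis
  proof (rule improve_merge[OF gr u(1,2) e(3) u(4) S e(1,2)])
    let ?f = "\<lambda>w. if w = u' then u else w"
    have "h (\<gamma> u \<union> \<gamma> u') + J (\<gamma> u) x (\<gamma> v) + J (\<gamma> u') x (\<gamma> v) \<le>
        h (\<gamma> u) + h (\<gamma> u') + J (\<gamma> u \<union> \<gamma> u') x ((\<gamma>(u := \<gamma> u \<union> \<gamma> u')) (?f v))"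
      using u by (intro fold_inequality) auto
    then show "h (\<gamma> u \<union> \<gamma> u') + edge_J \<gamma> (v, x, u) + edge_J \<gamma> (v, x, u') \<le> h (\<gamma> u) + h (\<gamma> u') +
        edge_J (\<gamma>(u := \<gamma> u \<union> \<gamma> u')) (case (v, x, u) of (p, x, q) \<Rightarrow> (?f p, x, ?f q))"
      using e(3) by (simp add: edge_J_def)
  qed (use e in auto)
qed

lemma improve_fold_source:
  assumes gr: "graph_over W E \<gamma> \<pi> b" and S: "\<forall>u x v. (u, x, v) \<in> E \<longrightarrow> x \<in> S"
    and e: "(u, x, v) \<in> E" "(u', x, v) \<in> E" "u \<noteq> u'"
  shows "\<exists>W' E' \<gamma>' b'. graph_over W' E' \<gamma>' \<pi> b' \<and> improves W E \<gamma> b W' E' \<gamma>' b' \<and> cost W' E' < cost W E"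
proof -
  have u: "u \<in> W" "u' \<in> W" "v \<in> W" "adm (\<gamma> u)" "adm (\<gamma> u')" "adm (\<gamma> v)" "x \<in> carrier G"
    "\<pi> v = x <# \<pi> u" "\<pi> v = x <# \<pi> u'" "\<pi> u \<in> V" "\<pi> u' \<in> V"
    using graph_over_edge[OF gr e(1)] graph_over_edge[OF gr e(2)] by blast+
  have "inv x <# (x <# \<pi> u) = inv x <# (x <# \<pi> u')" using u by simp
  then have \<pi>: "\<pi> u = \<pi> u'" using u by simp
  show ?thesis
  proof (rule improve_merge[OF gr u(1,2) e(3) \<pi> S e(1,2)])
    let ?f = "\<lambda>w. if w = u' then u else w"
    let ?C = "(\<gamma>(u := \<gamma> u \<union> \<gamma> u')) (?f v)"
    have C: "adm ?C" "\<gamma> v \<subseteq> ?C" using u by auto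
    \<comment> \<open>Read backwards, with label \<open>inv x\<close>, the two edges leave the
      common vertex \<open>v\<close>, as in the other kind of fold.\<close>
    have "h (\<gamma> u \<union> \<gamma> u') + J (\<gamma> u) (inv x) (\<gamma> v) + J (\<gamma> u') (inv x) (\<gamma> v) \<le>
        h (\<gamma> u) + h (\<gamma> u') + J (\<gamma> u \<union> \<gamma> u') (inv x) ?C"
      using u C by (intro fold_inequality) auto
    then have "h (\<gamma> u \<union> \<gamma> u') + J (\<gamma> v) x (\<gamma> u) + J (\<gamma> v) x (\<gamma> u') \<le>
        h (\<gamma> u) + h (\<gamma> u') + J ?C x (\<gamma> u \<union> \<gamma> u')"
      using J_flip[of "\<gamma> u" "\<gamma> v" x] J_flip[of "\<gamma> u'" "\<gamma> v" x] J_flip[of "\<gamma> u \<union> \<gamma> u'" ?C x] u C by simp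
    then show "h (\<gamma> u \<union> \<gamma> u') + edge_J \<gamma> (u, x, v) + edge_J \<gamma> (u', x, v) \<le> h (\<gamma> u) + h (\<gamma> u') +
        edge_J (\<gamma>(u := \<gamma> u \<union> \<gamma> u')) (case (u, x, v) of (p, x, q) \<Rightarrow> (?f p, x, ?f q))"
      using e(3) by (simp add: edge_J_def)
  qed (use e in auto)
qed

lemma ex_folded:
  assumes "graph_over W E \<gamma> \<pi> b"
  shows "\<exists>W' E' \<gamma>' \<pi>' b'. graph_over W' E' \<gamma>' \<pi>' b' \<and> improves W E \<gamma> b W' E' \<gamma>' b' \<and>
    folded E' \<and> (\<forall>u x v. (u, x, v) \<in> E' \<longrightarrow> x \<in> S)"
  using assms
proof (induction "cost W E" arbitrary: W E \<gamma> \<pi> b rule: less_induct)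
  case less
  have "(folded E \<and> (\<forall>u x v. (u, x, v) \<in> E \<longrightarrow> x \<in> S)) \<or>
    (\<exists>W' E' \<gamma>' \<pi>' b'. graph_over W' E' \<gamma>' \<pi>' b' \<and> improves W E \<gamma> b W' E' \<gamma>' b' \<and> cost W' E' < cost W E)"
  proof (cases "\<forall>u x v. (u, x, v) \<in> E \<longrightarrow> x \<in> S")
    case False
    then obtain u x v where e: "(u, x, v) \<in> E" "x \<notin> S" by blast
    show ?thesis
    proof (cases "inv x \<in> S")
      case True
      from improve_flip[OF less.prems e True] show ?thesis
          by (intro disjI2) (elim exE, intro exI, assumption)
    next
      case False
      from improve_subdivide[OF less.prems e False] show ?thesis
          by (intro disjI2) (elim exE, intro exI, assumption)
    qed
  next
    case True
    show ?thesis
    proof (cases "folded E")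
      case False
      then consider v x u u' where "(v, x, u) \<in> E" "(v, x, u') \<in> E" "u \<noteq> u'"
        | u x v u' where "(u, x, v) \<in> E" "(u', x, v) \<in> E" "u \<noteq> u'"
        unfolding folded_def by metis
      then show ?thesis
      proof cases
        case 1
        from improve_fold_target[OF less.prems True 1] show ?thesis
          by (intro disjI2) (elim exE, intro exI, assumption)
      next
        case 2
        from improve_fold_source[OF less.prems True 2] show ?thesis
          by (intro disjI2) (elim exE, intro exI, assumption)
      qed
    qed (use True in blast)
  qed
  then show ?case
  proof
    assume "\<exists>W' E' \<gamma>' \<pi>' b'. graph_over W' E' \<gamma>' \<pi>' b' \<and> improves W E \<gamma> b W' E' \<gamma>' b' \<and> cost W' E' < cost W E"
    then obtain W' E' \<gamma>' \<pi>' b' where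
      *: "graph_over W' E' \<gamma>' \<pi>' b'" "improves W E \<gamma> b W' E' \<gamma>' b'" "cost W' E' < cost W E"
      by blast
    from less.hyps[OF *(3,1)] improves_trans[OF *(2)] show ?thesis by meson
  qed (use less.prems improves_refl in blast)
qed

text \<open>By \<open>path_push\<close> the label of any path may be replaced by its normal form.
  Since folded graphs are deterministic, the endpoint is then a function of the group
  element.\<close>

lemma path_nf:
  assumes gr: "graph_over W E \<gamma> \<pi> b" and E: "folded E" "\<forall>u x v. (u, x, v) \<in> E \<longrightarrow> x \<in> S"
    and "(g, u) \<in> reach G E b"
  shows "path E b (nf g) u \<and> \<pi> u = g <# K \<and> g \<in> carrier G \<and> u \<in> W"
  using assms(4)
proof induction
  case base
  then show ?case using gr by (simp add: nf_one graph_over_def lcos_mult_one)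
next
  case (forward g u x v)
  note ed = graph_over_edge[OF gr forward.hyps(2)]
  have x: "x \<in> S" using E(2) forward.hyps(2) by blast
  have "step E (True, x) u v" using forward.hyps(2) by (simp add: step_def)
  then have "path E b (push (True, x) (nf g)) v" using path_push[OF E(1)] forward.IH by blast
  moreover have "nf (x \<otimes> g) = push (True, x) (nf g)"
    using nf_mult_letter[of "(True, x)" g] x forward.IH by (simp add: letter_value_def)
  ultimately show ?case using ed forward.IH by (simp add: lcos_m_assoc)
next
  case (backward g v u x)
  note ed = graph_over_edge[OF gr backward.hyps(2)]
  have x: "x \<in> S" using E(2) backward.hyps(2) by blast
  have "step E (False, x) v u" using backward.hyps(2) by (simp add: step_def)
  then have "path E b (push (False, x) (nf g)) u" using path_push[OF E(1)] backward.IH by blast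
  moreover have "nf (inv x \<otimes> g) = push (False, x) (nf g)"
    using nf_mult_letter[of "(False, x)" g] x backward.IH by (simp add: letter_value_def)
  moreover have "\<pi> u = (inv x \<otimes> g) <# K"
  proof -
    have "\<pi> u = inv x <# \<pi> v" using ed by simp
    also have "\<pi> v = g <# K" using backward.IH by blast
    finally show ?thesis using ed(3) backward.IH by (simp add: lcos_m_assoc)
  qed
  ultimately show ?case using ed(1,3) backward.IH by simp
qed

text \<open>Suppose that no edge labelled \<open>l\<close> leaves \<open>v\<close>. Then no loop at \<open>b\<close> has a label of the form
  \<open>u l\<^sup>n g\<close> when \<open>g\<close> leads to \<open>v\<close> and \<open>n\<close> is large compared to the length of \<open>u\<close>; but since
  \<open>K\<close> has finite index, some such element lies in \<open>K\<close>.\<close>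

lemma folded_complete:
  assumes gr: "graph_over W E \<gamma> \<pi> b" and E: "folded E" "\<forall>u x v. (u, x, v) \<in> E \<longrightarrow> x \<in> S"
    and v: "v \<in> W" and l: "snd l \<in> S"
  shows "\<exists>v'. step E l v v'"
proof (rule ccontr)
  assume none: "\<nexists>v'. step E l v v'"
  obtain g where "(g, v) \<in> reach G E b" using gr v unfolding graph_over_def by blast
  note g = path_nf[OF gr E this]
  define a where "a = letter_value G l"
  have a: "a \<in> carrier G" using l by (simp add: a_def)
  note nfg = nf_props[of g]
  \<comment> \<open>Arriving at \<open>v\<close> by the inverse of \<open>l\<close> would use an
    edge that also allows leaving by \<open>l\<close>. Hence powers of \<open>l\<close> do not
    cancel against the normal form of \<open>g\<close>.\<close>
  have hd: "nf g = [] \<or> hd (nf g) \<noteq> letter_inv l"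
  proof (rule ccontr)
    assume "\<not> ?thesis"
    then have "nf g = letter_inv l # tl (nf g)" by (cases "nf g") auto
    with g obtain u where "step E (letter_inv l) u v" by (metis path.simps(2))
    then show False using none by (simp add: step_letter_inv)
  qed
  have nfn: "nf (a [^] n \<otimes> g) = replicate n l @ nf g" for n :: nat
  proof (induction n)
    case (Suc n)
    have "a [^] Suc n \<otimes> g = a \<otimes> (a [^] n \<otimes> g)"
      using a g nat_pow_Suc2[of a n] by (simp add: m_assoc)
    then have "nf (a [^] Suc n \<otimes> g) = push l (replicate n l @ nf g)"
      using nf_mult_letter[OF l, of "a [^] n \<otimes> g"] a g Suc by (simp add: a_def)
    also have "\<dots> = l # replicate n l @ nf g"
      using hd by (cases n) (auto simp: push_def)
    finally show ?case by simp
  qed (use g in simp)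
  define r where "r c = (SOME x. x \<in> c)" for c :: "'a set"
  \<comment> \<open>The coset of \<open>k\<close> depends on \<open>n\<close>, so \<open>n\<close>
    has to exceed the length of the correcting prefix \<open>inv (r c)\<close> for every coset
    \<open>c\<close>.\<close>
  define n where "n = Suc (Max ((\<lambda>c. length (nf (inv (r c)))) ` V))"
  define k where "k = a [^] n \<otimes> g"
  have k: "k \<in> carrier G" using a g by (simp add: k_def)
  define c where "c = k <# K"
  have c: "c \<in> V" using k by (auto simp: c_def V_iff)
  have "k \<in> c" using lcos_self[OF k K_sub] by (simp add: c_def)
  then have "r c \<in> c" unfolding r_def by (rule someI)
  then obtain q where q: "q \<in> K" "r c = k \<otimes> q" by (auto simp: c_def l_coset_def)
  have qc: "q \<in> carrier G" using q K_carrier by blast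
  have rc: "inv (r c) \<in> carrier G" using q k qc by simp
  have "inv (r c) \<otimes> k = inv q" using q k qc by (simp add: inv_mult_group m_assoc)
  moreover have "inv q \<in> K" using q K_sub by (simp add: subgroup.m_inv_closed)
  ultimately have "(inv (r c) \<otimes> k, b) \<in> reach G E b" using gr unfolding graph_over_def by simp
  then have p: "path E b (nf (inv (r c) \<otimes> k)) b" using path_nf[OF gr E] by blast
  note nfr = nf_props[OF rc]
  obtain p m where pm: "m \<le> length (nf (inv (r c)))" "nf (inv (r c) \<otimes> k) = p @ drop m (nf k)"
    using nf_mult_suffix[OF nfr(1) k] nfr(2) by auto
  have "length (nf (inv (r c))) < n"
    unfolding n_def using c by (intro le_imp_less_Suc Max_ge) auto
  with pm have mn: "m < n" by simp
  \<comment> \<open>At least one \<open>l\<close> survives immediately before the normal form of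
    \<open>g\<close>, so the loop would have to leave \<open>v\<close> by \<open>l\<close>.\<close>
  then have "drop m (nf k) = replicate (n - Suc m) l @ l # nf g"
    by (simp add: k_def nfn Suc_diff_Suc flip: replicate_append_same) (metis Suc_diff_Suc replicate_Suc replicate_append_same append_Cons append_assoc append_Nil)
  then have "path E b ((p @ replicate (n - Suc m) l) @ l # nf g) b" using p pm by simp
  from path_append[OF this] obtain z where "path E b (l # nf g) z" by blast
  then obtain v0 where "path E b (nf g) v0" "step E l v0 z" by auto
  with path_det[OF E(1)] g none show False by blast
qed

text \<open>Labels of paths to two vertices over one coset differ by an element of \<open>K\<close>
  on the right, which is the label of a loop at \<open>b\<close>. Running this loop first gives both
  vertices a path with the same label, so they agree. Surjectivity comes from completeness.\<close>

lemma folded_bij: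
  assumes gr: "graph_over W E \<gamma> \<pi> b" and E: "folded E" "\<forall>u x v. (u, x, v) \<in> E \<longrightarrow> x \<in> S"
  shows "bij_betw \<pi> W V"
proof (rule bij_betw_imageI)
  show "inj_on \<pi> W"
  proof (rule inj_onI)
    fix u u' assume u: "u \<in> W" "u' \<in> W" "\<pi> u = \<pi> u'"
    then obtain g g' where g: "(g, u) \<in> reach G E b" "(g', u') \<in> reach G E b"
      using gr unfolding graph_over_def by blast
    note p = path_nf[OF gr E g(1)] and p' = path_nf[OF gr E g(2)]
    define k where "k = inv g \<otimes> g'"
    have "g' \<in> g <# K" using p p' u lcos_self[OF _ K_sub, of g'] by auto
    then obtain k0 where "k0 \<in> K" "g' = g \<otimes> k0" by (auto simp: l_coset_def)
    moreover have "k0 \<in> carrier G" using K_carrier calculation by blast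
    ultimately have k: "k \<in> K" "g' = g \<otimes> k" "k \<in> carrier G"
      using p by (simp_all add: k_def m_assoc[symmetric])
    have kb: "(k, b) \<in> reach G E b" using gr k unfolding graph_over_def by blast
    have "(x \<otimes> k, w) \<in> reach G E b" if "(x, w) \<in> reach G E b" for x w
      using that
    proof induction
      case base
      then show ?case using kb k by simp
    next
      case (forward g u x v)
      have "x \<otimes> (g \<otimes> k) = x \<otimes> g \<otimes> k"
        using graph_over_edge[OF gr forward.hyps(2)] path_nf[OF gr E forward.hyps(1)] k
        by (simp add: m_assoc)
      with reach.forward[OF forward.IH forward.hyps(2)] show ?case by simp
    next
      case (backward g v u x)
      have "inv x \<otimes> (g \<otimes> k) = inv x \<otimes> g \<otimes> k"
        using graph_over_edge[OF gr backward.hyps(2)] path_nf[OF gr E backward.hyps(1)] k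
        by (simp add: m_assoc)
      with reach.backward[OF backward.IH backward.hyps(2)] show ?case by simp
    qed
    from path_nf[OF gr E this[OF g(1)]] k have "path E b (nf g') u" by simp
    with p' show "u = u'" using path_det[OF E(1)] by blast
  qed
  have "word_value G w <# K \<in> \<pi> ` W" if "w \<in> words_over S" for w
    using that
  proof (induction w)
    case Nil
    have "b \<in> W" "\<pi> b = K" using gr by (auto simp: graph_over_def)
    then show ?case by (auto simp: lcos_mult_one)
  next
    case (Cons l w)
    then obtain u where u: "u \<in> W" "\<pi> u = word_value G w <# K" by auto
    have "snd l \<in> S" using Cons.prems by simp
    from folded_complete[OF gr E u(1) this] obtain v where st: "step E l u v" by blast
    have "v \<in> W \<and> \<pi> v = letter_value G l <# \<pi> u"
    proof (cases "fst l")
      case True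
      with st have "(u, snd l, v) \<in> E" by (simp add: step_def)
      from graph_over_edge[OF gr this] True show ?thesis by (simp add: letter_value_def)
    next
      case False
      with st have "(v, snd l, u) \<in> E" by (simp add: step_def)
      from graph_over_edge[OF gr this] False show ?thesis by (simp add: letter_value_def)
    qed
    then show ?case using u Cons.prems by (intro image_eqI[of _ _ v]) (auto simp: lcos_m_assoc)
  qed
  then have "g <# K \<in> \<pi> ` W" if "g \<in> carrier G" for g using S_gen that by (metis imageE)
  then have "V \<subseteq> \<pi> ` W" by (auto simp: V_iff)
  then show "\<pi> ` W = V" using gr by (auto simp: graph_over_def)
qed

text \<open>By completeness each coset and generator give an edge, and injectivity of \<pi>
  determines its target. The graph is thus the Schreier graph, with \<open>card V * card S\<close>
  edges.\<close>

lemma folded_Phi: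
  assumes gr: "graph_over W E \<gamma> \<pi> b" and E: "folded E" "\<forall>u x v. (u, x, v) \<in> E \<longrightarrow> x \<in> S"
  defines "\<delta> \<equiv> \<lambda>v. \<gamma> (inv_into W \<pi> v)"
  shows "chi W E = int (card V) * (1 - int (card S))" "graph_val W E \<gamma> = Phi \<delta>" "family \<delta>" "\<delta> K = \<gamma> b"
proof -
  note bij = folded_bij[OF gr E]
  define \<iota> where "\<iota> = inv_into W \<pi>"
  have \<iota>: "\<iota> v \<in> W" "\<pi> (\<iota> v) = v" if "v \<in> V" for v
    using that bij unfolding \<iota>_def bij_betw_def by (simp_all add: inv_into_into f_inv_into_f)
  have \<iota>\<pi>: "\<iota> (\<pi> u) = u" if "u \<in> W" for u
    using that bij unfolding \<iota>_def bij_betw_def by simp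
  have bij\<iota>: "bij_betw \<iota> V W" unfolding \<iota>_def using bij by (rule bij_betw_inv_into)
  have Eeq: "E = (\<lambda>(v, s). (\<iota> v, s, \<iota> (s <# v))) ` (V \<times> S)"
  proof (intro subset_antisym subsetI)
    fix e assume e: "e \<in> E"
    obtain u s w where euw: "e = (u, s, w)" by (cases e)
    note ed = graph_over_edge[OF gr e[unfolded euw]]
    have "s \<in> S" using e euw E(2) by blast
    moreover have "\<iota> (\<pi> u) = u" "\<iota> (\<pi> w) = w" using \<iota>\<pi>[OF ed(1)] \<iota>\<pi>[OF ed(2)] by blast+
    ultimately show "e \<in> (\<lambda>(v, s). (\<iota> v, s, \<iota> (s <# v))) ` (V \<times> S)"
      using ed(6) by (intro image_eqI[of _ _ "(\<pi> u, s)"]) (simp_all add: euw ed(5)[symmetric])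
  next
    fix e assume "e \<in> (\<lambda>(v, s). (\<iota> v, s, \<iota> (s <# v))) ` (V \<times> S)"
    then obtain v s where vs: "v \<in> V" "s \<in> S" "e = (\<iota> v, s, \<iota> (s <# v))" by auto
    from folded_complete[OF gr E \<iota>(1)[OF vs(1)], of "(True, s)"] vs obtain w
      where w: "(\<iota> v, s, w) \<in> E" by (auto simp: step_def)
    from graph_over_edge[OF gr w] have "w = \<iota> (s <# v)" using \<iota>\<pi>[of w] \<iota>[OF vs(1)] by simp
    with w vs show "e \<in> E" by simp
  qed
  have inj: "inj_on (\<lambda>(v, s). (\<iota> v, s, \<iota> (s <# v))) (V \<times> S)"
    using bij\<iota> by (auto simp: inj_on_def bij_betw_def)
  have "card E = card V * card S" unfolding Eeq card_image[OF inj] by (simp add: card_cartesian_product)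
  moreover have "card W = card V" using bij by (rule bij_betw_same_card)
  ultimately show "chi W E = int (card V) * (1 - int (card S))" by (simp add: chi_def algebra_simps)
  have "(\<Sum>e\<in>E. edge_J \<gamma> e) = (\<Sum>(v, s)\<in>V \<times> S. J (\<delta> (s <# v)) s (\<delta> v))"
    unfolding Eeq sum.reindex[OF inj] by (intro sum.cong) (auto simp: edge_J_def \<delta>_def \<iota>_def)
  also have "\<dots> = (\<Sum>s\<in>S. \<Sum>v\<in>V. J (\<delta> (s <# v)) s (\<delta> v))"
    by (subst sum.swap) (simp add: sum.cartesian_product)
  moreover have "(\<Sum>u\<in>W. h (\<gamma> u)) = (\<Sum>v\<in>V. h (\<delta> v))"
    using sum.reindex_bij_betw[OF bij\<iota>, of "\<lambda>u. h (\<gamma> u)"] by (simp add: \<delta>_def \<iota>_def)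
  ultimately show "graph_val W E \<gamma> = Phi \<delta>" by (simp add: graph_val_def Phi_eq)
  show "family \<delta>" using \<iota> gr by (auto simp: family_def \<delta>_def \<iota>_def graph_over_def)
  have "b \<in> W" "\<pi> b = K" using gr by (auto simp: graph_over_def)
  then show "\<delta> K = \<gamma> b" using \<iota>\<pi>[of b] by (simp add: \<delta>_def \<iota>_def)
qed

text \<open>The rose has characteristic \<open>1 - card R\<close>, and folding can only raise it to
  that of the Schreier graph, which bounds \<open>card R\<close> from below. At the bound no excess
  edge has been lost, and the values become comparable.\<close>

lemma rose_Phi:
  assumes R: "R \<subseteq> K" "finite R" "\<one> \<notin> R" "word_value G ` words_over R = K" and \<beta>: "adm \<beta>"
  shows "int (card V) * (int (card S) - 1) + 1 \<le> int (card R)"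
    and "int (card R) = int (card V) * (int (card S) - 1) + 1 \<Longrightarrow>
      \<exists>\<delta>. family \<delta> \<and> \<beta> \<subseteq> \<delta> K \<and> Phi \<delta> \<le> h \<beta> - (\<Sum>s\<in>R. J \<beta> s \<beta>)"
proof -
  define E where "E = (\<lambda>s. (0 :: nat, s, 0 :: nat)) ` R"
  have Rc: "R \<subseteq> carrier G" using R(1) K_carrier by blast
  have inE: "(u, x, v) \<in> E \<longleftrightarrow> u = 0 \<and> v = 0 \<and> x \<in> R" for u x v by (auto simp: E_def)
  have inj: "inj_on (\<lambda>s. (0 :: nat, s, 0 :: nat)) R" by (auto simp: inj_on_def)
  have "(word_value G w, 0) \<in> reach G E 0" if "w \<in> words_over R" for w
    using that
  proof (induction w)
    case (Cons l w)
    then show ?case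
      using reach.forward[of "word_value G w" 0 G E 0 "snd l" 0] reach.backward[of "word_value G w" 0 G E 0 0 "snd l"]
      by (auto simp: letter_value_def inE)
  qed (simp add: reach.base)
  then have reach: "(k, 0) \<in> reach G E 0" if "k \<in> K" for k using that R(4) by auto
  have fix_K: "x <# K = K" if "x \<in> K" for x
    using coset_join3[OF _ K_sub] that K_carrier by blast
  have gr: "graph_over {0} E (\<lambda>_. \<beta>) (\<lambda>_. K) 0"
    unfolding graph_over_def inE using R Rc \<beta> reach fix_K by (auto simp: E_def intro: reach.base)
  obtain W' E' \<gamma>' \<pi>' b' where *: "graph_over W' E' \<gamma>' \<pi>' b'" "improves {0} E (\<lambda>_. \<beta>) 0 W' E' \<gamma>' b'"
    "folded E'" "\<forall>u x v. (u, x, v) \<in> E' \<longrightarrow> x \<in> S"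
    using ex_folded[OF gr] by metis
  note Phi = folded_Phi[OF *(1,3,4)]
  have chi: "chi {0} E = 1 - int (card R)" by (simp add: chi_def E_def card_image[OF inj])
  then show "int (card V) * (int (card S) - 1) + 1 \<le> int (card R)"
    using *(2) Phi(1) by (simp add: improves_def algebra_simps)
  assume eq: "int (card R) = int (card V) * (int (card S) - 1) + 1"
  have "chi {0} E = chi W' E'" using eq chi Phi(1) by (simp add: algebra_simps)
  then have "graph_val W' E' \<gamma>' \<le> graph_val {0} E (\<lambda>_. \<beta>)" "\<beta> \<subseteq> \<gamma>' b'"
    using *(2) by (auto simp: improves_def)
  moreover have "graph_val {0} E (\<lambda>_. \<beta>) = h \<beta> - (\<Sum>s\<in>R. J \<beta> s \<beta>)"
    by (simp add: graph_val_def E_def sum.reindex[OF inj] edge_J_def)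
  ultimately show "\<exists>\<delta>. family \<delta> \<and> \<beta> \<subseteq> \<delta> K \<and> Phi \<delta> \<le> h \<beta> - (\<Sum>s\<in>R. J \<beta> s \<beta>)"
    using Phi by (intro exI[of _ "\<lambda>v. \<gamma>' (inv_into W' \<pi>' v)"]) simp
qed

end

section \<open>Schreier bases\<close>

definition relabel :: "('x \<Rightarrow> 'y) \<Rightarrow> bool \<times> 'x \<Rightarrow> bool \<times> 'y" where
  "relabel f l = (fst l, f (snd l))"

text \<open>\<open>D\<close> is a spanning tree of the Schreier graph and \<open>\<tau> v\<close>
  the label of the tree path from \<open>K\<close> to \<open>v\<close>. \<open>D_connected\<close>
  is connectedness as an induction principle; \<open>D_entropy\<close> is the entropy estimate
  obtained by collapsing the tree.\<close>

locale schreier_tree = free_coset_system G T U adm h S K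
  for G (structure) and T :: "'a \<Rightarrow> 'e \<Rightarrow> 'e" and U adm h S K +
  fixes D :: "('a set \<times> 'a) set" and \<tau> :: "'a set \<Rightarrow> 'a"
  assumes D_sub: "D \<subseteq> V \<times> S"
    and D_card: "Suc (card D) = card V"
    and \<tau>_D: "(v, s) \<in> D \<Longrightarrow> \<tau> (s <# v) = s \<otimes> \<tau> v"
    and \<tau>_K [simp]: "\<tau> K = \<one>"
    and \<tau>_V: "v \<in> V \<Longrightarrow> \<tau> v \<in> carrier G \<and> \<tau> v <# K = v"
    and D_connected: "Q K \<Longrightarrow> (\<And>v s. (v, s) \<in> D \<Longrightarrow> Q v \<longleftrightarrow> Q (s <# v)) \<Longrightarrow> v \<in> V \<Longrightarrow> Q v"
    and D_entropy: "adm C \<Longrightarrow>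
      h (\<Union>v\<in>V. T (inv (\<tau> v)) ` C) \<le> card V * h C - (\<Sum>(v, s)\<in>D. J C s C)"
begin

text \<open>The loop at \<open>K\<close> which follows the tree to \<open>v\<close>, crosses the
  edge labelled \<open>s\<close> and returns along the tree; it is trivial for tree edges.\<close>

definition gen :: "'a set \<times> 'a \<Rightarrow> 'a" where
  "gen = (\<lambda>(v, s). inv (\<tau> (s <# v)) \<otimes> (s \<otimes> \<tau> v))"

definition nontree :: "('a set \<times> 'a) set" where
  "nontree = V \<times> S - D"

definition basis :: "'a set" where
  "basis = gen ` nontree"

text \<open>To see that the Schreier generators are free, let \<open>G\<close> act on pairs of a coset and a reduced word
  over the nontree edges: crossing a nontree edge pushes it onto the word.\<close>

definition letter_act ::
  "bool \<times> 'a \<Rightarrow> 'a set \<times> (bool \<times> ('a set \<times> 'a)) list \<Rightarrow> 'a set \<times> (bool \<times> ('a set \<times> 'a)) list" where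
  "letter_act l = (\<lambda>(v, w). let v' = letter_value G l <# v; e = (if fst l then v else v', snd l)
     in (v', if e \<in> D then w else push (fst l, e) w))"

definition act where
  "act g y = foldr letter_act (nf g) y"

definition states :: "('a set \<times> (bool \<times> ('a set \<times> 'a)) list) set" where
  "states = V \<times> {w. reduced_word w}"

lemma \<tau>_carrier [simp]: "v \<in> V \<Longrightarrow> \<tau> v \<in> carrier G"
  using \<tau>_V by blast

lemma \<tau>_coset [simp]: "v \<in> V \<Longrightarrow> \<tau> v <# K = v"
  using \<tau>_V by blast

lemma letter_act_states: "snd l \<in> S \<Longrightarrow> y \<in> states \<Longrightarrow> letter_act l y \<in> states"
  by (auto simp: letter_act_def states_def Let_def reduced_word_push)

lemma letter_act_cancel:
  assumes "snd l \<in> S" "y \<in> states"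
  shows "letter_act l (letter_act (letter_inv l) y) = y"
proof -
  obtain v w where y: "y = (v, w)" "v \<in> V" "reduced_word w" using assms by (auto simp: states_def)
  have [simp]: "push (True, e) (push (False, e) w) = w" "push (False, e) (push (True, e) w) = w" for e
    using push_letter_inv[OF y(3), of "(True, e)"] push_letter_inv[OF y(3), of "(False, e)"]
    by (simp_all add: letter_inv_def)
  show ?thesis using assms y
    by (cases "fst l") (auto simp: letter_act_def Let_def letter_inv_def letter_value_def)
qed

lemma act_word:
  assumes "w \<in> words_over S" "y \<in> states"
  shows "act (word_value G w) y = foldr letter_act w y"
  unfolding act_def using assms nf_props[of "word_value G w"]
  by (intro foldr_action_cong[where Y = states]) (auto simp: letter_act_states letter_act_cancel)

lemma act_states: "g \<in> carrier G \<Longrightarrow> y \<in> states \<Longrightarrow> act g y \<in> states"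
proof -
  assume "g \<in> carrier G" "y \<in> states"
  moreover have "w \<in> words_over S \<Longrightarrow> foldr letter_act w y \<in> states" for w
    using \<open>y \<in> states\<close> by (induction w) (auto simp: letter_act_states)
  ultimately show ?thesis using nf_props by (simp add: act_def)
qed

lemma act_mult:
  assumes "g \<in> carrier G" "k \<in> carrier G" "y \<in> states"
  shows "act (g \<otimes> k) y = act g (act k y)"
proof -
  obtain v w where vw: "v \<in> words_over S" "g = word_value G v" "w \<in> words_over S" "k = word_value G w"
    using assms words_onto by (metis imageE)
  have "act k y \<in> states" using act_states assms by blast
  then show ?thesis
    using vw act_word[of "v @ w" y] act_word[of v "act k y"] act_word[of w y] assms
    by (simp add: word_value_append[OF S_carrier])
qed

lemma act_one: "act \<one> y = y"
  by (simp add: act_def nf_one)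

lemma act_inv:
  assumes "g \<in> carrier G" "y \<in> states" "act g y = z"
  shows "act (inv g) z = y"
  using act_mult[of "inv g" g y] assms by (simp add: act_one)

lemma act_gen_letter:
  assumes "s \<in> S" "v \<in> V" "reduced_word w"
  shows "act s (v, w) = (s <# v, if (v, s) \<in> D then w else push (True, (v, s)) w)"
  using act_word[of "[(True, s)]" "(v, w)"] assms
  by (simp add: states_def letter_act_def letter_value_def Let_def)

text \<open>Tree edges leave the word alone. The induction has to pass each of them in both
  directions, since its orientation may point towards or away from \<open>K\<close>.\<close>

lemma act_\<tau>:
  assumes "v \<in> V" "reduced_word w"
  shows "act (\<tau> v) (K, w) = (v, w)"
proof (rule D_connected[where Q = "\<lambda>v. act (\<tau> v) (K, w) = (v, w)", OF _ _ assms(1)])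
  show "act (\<tau> K) (K, w) = (K, w)" by (simp add: act_one)
next
  fix v s assume D: "(v, s) \<in> D"
  then have vs: "v \<in> V" "s \<in> S" using D_sub by auto
  have st: "(K, w) \<in> states" "(v, w) \<in> states" using vs assms by (auto simp: states_def)
  have eq: "act (\<tau> (s <# v)) (K, w) = act s (act (\<tau> v) (K, w))"
    using D vs st by (simp add: \<tau>_D act_mult)
  have s: "act s (v, w) = (s <# v, w)" using act_gen_letter[OF vs(2,1) assms(2)] D by simp
  show "act (\<tau> v) (K, w) = (v, w) \<longleftrightarrow> act (\<tau> (s <# v)) (K, w) = (s <# v, w)"
  proof
    assume "act (\<tau> (s <# v)) (K, w) = (s <# v, w)"
    then have "act (inv s) (s <# v, w) = act (\<tau> v) (K, w)"
      using act_inv[of s "act (\<tau> v) (K, w)"] eq act_states[OF _ st(1)] vs by simp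
    moreover have "act (inv s) (s <# v, w) = (v, w)" using act_inv[OF _ st(2) s] vs by simp
    ultimately show "act (\<tau> v) (K, w) = (v, w)" by simp
  qed (use eq s in simp)
qed

lemma nontreeD: "e \<in> nontree \<Longrightarrow> fst e \<in> V \<and> snd e \<in> S \<and> e \<notin> D"
  by (auto simp: nontree_def)

lemma gen_carrier: "e \<in> V \<times> S \<Longrightarrow> gen e \<in> carrier G"
  by (auto simp: gen_def)

lemma gen_K: "e \<in> V \<times> S \<Longrightarrow> gen e \<in> K"
proof -
  assume e: "e \<in> V \<times> S"
  then obtain v s where vs: "e = (v, s)" "v \<in> V" "s \<in> S" by auto
  have 1: "(s \<otimes> \<tau> v) <# K = s <# v" using vs lcos_m_assoc[OF K_carrier, of s "\<tau> v"] by simp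
  have "gen e <# K = inv (\<tau> (s <# v)) <# ((s \<otimes> \<tau> v) <# K)"
    using vs lcos_m_assoc[OF K_carrier, of "inv (\<tau> (s <# v))" "s \<otimes> \<tau> v"] by (simp add: gen_def)
  also have "\<dots> = inv (\<tau> (s <# v)) <# (\<tau> (s <# v) <# K)" unfolding 1 using vs by simp
  also have "\<dots> = (inv (\<tau> (s <# v)) \<otimes> \<tau> (s <# v)) <# K"
    by (rule lcos_m_assoc) (use vs in auto)
  also have "\<dots> = K" using vs by simp
  finally show ?thesis using lcos_self[OF gen_carrier[OF e] K_sub] by simp
qed

text \<open>Of the loop described by \<open>gen e\<close> only the crossing of \<open>e\<close>
  itself is recorded in the word.\<close>

lemma act_gen:
  assumes "e \<in> nontree" "reduced_word w"
  shows "act (gen e) (K, w) = (K, push (True, e) w)"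
proof -
  obtain v s where vs: "e = (v, s)" "v \<in> V" "s \<in> S" "(v, s) \<notin> D"
    using assms nontreeD by (cases e) auto
  have r: "reduced_word (push (True, e) w)" using assms reduced_word_push by blast
  have st: "(K, w) \<in> states" "(v, w) \<in> states" "(K, push (True, e) w) \<in> states"
    using vs assms r by (auto simp: states_def)
  have "act (s \<otimes> \<tau> v) (K, w) = (s <# v, push (True, e) w)"
    using vs st assms act_gen_letter[of s v w] act_\<tau>[of v w] by (simp add: act_mult)
  moreover have "act (inv (\<tau> (s <# v))) (s <# v, push (True, e) w) = (K, push (True, e) w)"
    using vs st r by (intro act_inv act_\<tau>) auto
  ultimately show ?thesis using vs st by (simp add: gen_def act_mult)
qed

lemma act_gen_inv:
  assumes "e \<in> nontree" "reduced_word w"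
  shows "act (inv (gen e)) (K, w) = (K, push (False, e) w)"
proof -
  have r: "reduced_word (push (False, e) w)" using assms reduced_word_push by blast
  have "push (True, e) (push (False, e) w) = w"
    using push_letter_inv[OF assms(2), of "(True, e)"] by (simp add: letter_inv_def)
  then have "act (gen e) (K, push (False, e) w) = (K, w)" using act_gen[OF assms(1) r] by simp
  moreover have "gen e \<in> carrier G" "(K, push (False, e) w) \<in> states"
    using assms(1) r gen_carrier[of e] by (simp_all add: nontree_def states_def)
  ultimately show ?thesis using act_inv by blast
qed

lemma gen_inj: "inj_on gen nontree"
proof (rule inj_onI)
  fix e e' assume e: "e \<in> nontree" "e' \<in> nontree" "gen e = gen e'"
  have "(K, push (True, e) []) = (K, push (True, e') [])"
    using act_gen[OF e(1) reduced_word_Nil] act_gen[OF e(2) reduced_word_Nil] e(3) by metis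
  then show "e = e'" by simp
qed

lemma finite_nontree: "finite nontree"
  by (simp add: nontree_def)

lemma finite_basis: "finite basis"
  by (simp add: basis_def finite_nontree)

text \<open>Schreier's index formula: the tree takes \<open>card V - 1\<close> of the
  \<open>card V * card S\<close> edges.\<close>

lemma card_basis: "int (card basis) = int (card V) * (int (card S) - 1) + 1"
proof -
  have "finite D" using D_sub by (rule finite_subset) simp
  then have "card nontree = card V * card S - card D"
    unfolding nontree_def by (simp add: card_Diff_subset D_sub card_cartesian_product)
  moreover have "card D \<le> card V * card S"
    using card_mono[OF _ D_sub] by (simp add: card_cartesian_product)
  ultimately have "int (card nontree) = int (card V) * int (card S) - int (card D)"
    by (simp add: of_nat_diff)
  moreover have "int (card V) = int (card D) + 1" using D_card by simp
  ultimately show ?thesis unfolding basis_def card_image[OF gen_inj] right_diff_distrib by simp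
qed

lemma basis_K: "basis \<subseteq> K"
  unfolding basis_def nontree_def using gen_K by blast

lemma act_basis_word:
  assumes "u \<in> words_over basis"
  shows "word_value G u \<in> carrier G \<and> (let w = foldr push (map (relabel (inv_into nontree gen)) u) [] in
    reduced_word w \<and> act (word_value G u) (K, []) = (K, w))"
  using assms
proof (induction u)
  case Nil
  then show ?case by (simp add: act_one)
next
  case (Cons l u)
  define w where "w = foldr push (map (relabel (inv_into nontree gen)) u) []"
  have IH: "word_value G u \<in> carrier G" "reduced_word w" "act (word_value G u) (K, []) = (K, w)"
    using Cons by (auto simp: w_def Let_def)
  define e where "e = inv_into nontree gen (snd l)"
  have e: "e \<in> nontree" "gen e = snd l"
    using Cons.prems unfolding e_def basis_def by (auto intro: inv_into_into f_inv_into_f)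
  have c: "gen e \<in> carrier G" using e nontreeD[of e] gen_carrier[of e] by (cases e) auto
  have lv: "letter_value G l \<in> carrier G" using c e by (simp add: letter_value_def)
  have "act (letter_value G l) (K, w) = (K, push (fst l, e) w)"
    using act_gen[OF e(1) IH(2)] act_gen_inv[OF e(1) IH(2)] e(2) by (simp add: letter_value_def)
  then have "act (word_value G (l # u)) (K, []) = (K, push (fst l, e) w)"
    using IH lv by (simp add: act_mult states_def)
  moreover have "foldr push (map (relabel (inv_into nontree gen)) (l # u)) [] = push (fst l, e) w"
    by (simp add: e_def w_def relabel_def)
  ultimately show ?case using IH lv reduced_word_push[OF IH(2)] by (simp add: Let_def)
qed

lemma reduced_word_map:
  assumes "inj_on f R" "u \<in> words_over R" "reduced_word u"
  shows "reduced_word (map (relabel f) u)"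
  using assms(2,3)
proof (induction u rule: induct_list012)
  case (3 l m u)
  then have "relabel f m \<noteq> letter_inv (relabel f l)"
    using assms(1) by (cases l; cases m) (auto simp: letter_inv_def relabel_def inj_on_def)
  with 3 show ?case by auto
qed auto

text \<open>Applied to the empty word, a reduced word in the generators reproduces itself as a word
  over nontree edges. If it is nonempty, it moves the state and cannot have value one.\<close>

lemma basis_free:
  assumes "u \<in> words_over basis" "reduced_word u" "u \<noteq> []"
  shows "word_value G u \<noteq> \<one>"
proof
  assume "word_value G u = \<one>"
  moreover define w where "w = map (relabel (inv_into nontree gen)) u"
  have "inj_on (inv_into nontree gen) basis" unfolding basis_def by (rule inj_on_inv_into) simp
  then have "reduced_word w" unfolding w_def using assms by (intro reduced_word_map)
  ultimately show False using act_basis_word[OF assms(1)] assms(3)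
    by (simp add: act_one foldr_push_reduced w_def[symmetric] Let_def) (simp add: w_def)
qed

lemma generate_basis: "generate G basis = K"
proof
  have bc: "basis \<subseteq> carrier G" using basis_K K_carrier by blast
  show "generate G basis \<subseteq> K" using generate_subgroup_incl[OF basis_K K_sub] .
  interpret B: subgroup "generate G basis" G using generate_is_subgroup[OF bc] .
  have gen_in: "gen e \<in> generate G basis" if e: "e \<in> V \<times> S" for e
  proof (cases "e \<in> D")
    case True
    with e have "gen e = \<one>" by (auto simp: gen_def \<tau>_D)
    then show ?thesis by simp
  next
    case False
    with e show ?thesis by (auto simp: basis_def nontree_def intro!: generate.incl)
  qed
  \<comment> \<open>Schreier rewriting: an element is corrected into \<open>K\<close> by returning
    along the tree from its coset. Each letter put in front contributes one factor
    \<open>gen e\<close> or its inverse on the left, and for elements of \<open>K\<close> the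
    correction is trivial.\<close>
  have "inv (\<tau> (word_value G w <# K)) \<otimes> word_value G w \<in> generate G basis" if "w \<in> words_over S" for w
    using that
  proof (induction w)
    case Nil
    then show ?case by (simp add: lcos_mult_one)
  next
    case (Cons l w)
    define v where "v = word_value G w <# K"
    define a where "a = letter_value G l"
    have v: "v \<in> V" using Cons.prems by (auto simp: v_def V_iff)
    have a: "a \<in> carrier G" and l: "snd l \<in> S" using Cons.prems by (auto simp: a_def)
    have w: "word_value G w \<in> carrier G" using Cons.prems by simp
    have "inv (\<tau> (a <# v)) \<otimes> (a \<otimes> \<tau> v) \<in> generate G basis"
    proof (cases "fst l")
      case True
      then show ?thesis using gen_in[of "(v, snd l)"] v l by (simp add: gen_def a_def letter_value_def)
    next
      case False
      then have "inv (gen (a <# v, snd l)) = inv (\<tau> (a <# v)) \<otimes> (a \<otimes> \<tau> v)"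
        using v l a by (simp add: gen_def a_def letter_value_def inv_mult_group m_assoc)
      then show ?thesis using gen_in[of "(a <# v, snd l)"] v l a B.m_inv_closed by (metis SigmaI V_act)
    qed
    moreover have "inv (\<tau> v) \<otimes> word_value G w \<in> generate G basis" using Cons by (simp add: v_def)
    ultimately have "(inv (\<tau> (a <# v)) \<otimes> (a \<otimes> \<tau> v)) \<otimes> (inv (\<tau> v) \<otimes> word_value G w) \<in> generate G basis"
      by (rule B.m_closed)
    also have "(inv (\<tau> (a <# v)) \<otimes> (a \<otimes> \<tau> v)) \<otimes> (inv (\<tau> v) \<otimes> word_value G w) =
        inv (\<tau> (a <# v)) \<otimes> (a \<otimes> word_value G w)"
    proof -
      have "\<tau> v \<otimes> (inv (\<tau> v) \<otimes> word_value G w) = word_value G w"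
        using v w by (simp add: m_assoc[symmetric])
      then show ?thesis using v a w by (simp add: m_assoc)
    qed
    finally show ?case using a w by (simp add: v_def a_def lcos_m_assoc)
  qed
  moreover have "k <# K = K" "k \<in> carrier G" if "k \<in> K" for k
    using coset_join3[OF _ K_sub] that K_carrier by blast+
  moreover have "\<exists>w\<in>words_over S. k = word_value G w" if "k \<in> carrier G" for k
    using that words_onto by blast
  ultimately show "K \<subseteq> generate G basis" by (metis \<tau>_K inv_one l_one subsetI)
qed

lemma basis_words: "word_value G ` words_over basis = K"
proof -
  have "basis \<subseteq> carrier G" using basis_K K_carrier by blast
  from generate_word_value[OF this] show ?thesis by (simp add: generate_basis)
qed

text \<open>For a nontree edge, \<open>J C s C\<close> is the mutual information of two translates
  of \<open>C\<close> that both lie in \<beta>, compared by the Schreier generator of that edge. The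
  tree edges are paid for by \<open>D_entropy\<close>.\<close>

lemma basis_entropy:
  assumes C: "adm C"
  defines "\<beta> \<equiv> \<Union>v\<in>V. T (inv (\<tau> v)) ` C"
  shows "h \<beta> - (\<Sum>s\<in>basis. J \<beta> s \<beta>) \<le> card V * Fval C"
proof -
  have \<beta>: "adm \<beta>" unfolding \<beta>_def using C by (intro adm_UN adm_T) auto
  have sub: "T (inv (\<tau> v)) ` C \<subseteq> \<beta>" if "v \<in> V" for v
    using that unfolding \<beta>_def by blast
  have "J C (snd e) C \<le> J \<beta> (gen e) \<beta>" if "e \<in> nontree" for e
  proof -
    obtain v s where vs: "e = (v, s)" "v \<in> V" "s \<in> S"
      using nontreeD[OF \<open>e \<in> nontree\<close>] by (cases e) auto
    have "J C s C = J (T (inv (\<tau> (s <# v))) ` C) (inv (\<tau> (s <# v)) \<otimes> s \<otimes> inv (inv (\<tau> v))) (T (inv (\<tau> v)) ` C)"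
      using vs C by (intro J_translate[symmetric]) auto
    also have "inv (\<tau> (s <# v)) \<otimes> s \<otimes> inv (inv (\<tau> v)) = gen e"
      using vs by (simp add: gen_def m_assoc)
    also have "J (T (inv (\<tau> (s <# v))) ` C) (gen e) (T (inv (\<tau> v)) ` C) \<le> J \<beta> (gen e) \<beta>"
      using vs C \<beta> gen_carrier[of e] by (intro J_mono adm_T sub) auto
    finally show ?thesis by (simp add: vs)
  qed
  then have "(\<Sum>e\<in>nontree. J C (snd e) C) \<le> (\<Sum>e\<in>nontree. J \<beta> (gen e) \<beta>)" by (rule sum_mono)
  also have "\<dots> = (\<Sum>s\<in>basis. J \<beta> s \<beta>)" unfolding basis_def by (simp add: sum.reindex[OF gen_inj])
  finally have 1: "(\<Sum>e\<in>nontree. J C (snd e) C) \<le> (\<Sum>s\<in>basis. J \<beta> s \<beta>)" .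
  have "(\<Sum>e\<in>V \<times> S. J C (snd e) C) = (\<Sum>e\<in>nontree. J C (snd e) C) + (\<Sum>e\<in>D. J C (snd e) C)"
    unfolding nontree_def using D_sub by (intro sum.subset_diff) auto
  moreover have "(\<Sum>e\<in>V \<times> S. J C (snd e) C) = card V * (\<Sum>s\<in>S. J C s C)"
    using sum.cartesian_product[of "\<lambda>v s. J C s C" S V] by (simp add: case_prod_unfold)
  moreover have "h \<beta> \<le> card V * h C - (\<Sum>e\<in>D. J C (snd e) C)"
    using D_entropy[OF C] by (simp add: \<beta>_def case_prod_unfold)
  ultimately show ?thesis using 1 by (simp add: Fval_def algebra_simps)
qed

end

section \<open>Construction of a spanning tree\<close>

context free_coset_system
begin

lemma V_connected:
  assumes "A \<subseteq> V" "K \<in> A" "\<And>l v. snd l \<in> S \<Longrightarrow> v \<in> A \<Longrightarrow> letter_value G l <# v \<in> A"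
  shows "A = V"
proof -
  have "word_value G w <# K \<in> A" if "w \<in> words_over S" for w
    using that
  proof (induction w)
    case Nil
    then show ?case using assms by (simp add: lcos_mult_one)
  next
    case (Cons l w)
    then have "snd l \<in> S" "word_value G w <# K \<in> A" by simp_all
    then have "letter_value G l <# (word_value G w <# K) \<in> A" by (rule assms(3))
    then show ?case
      using Cons.prems lcos_m_assoc[OF K_carrier, of "letter_value G l" "word_value G w"] by simp
  qed
  then have "g <# K \<in> A" if "g \<in> carrier G" for g using S_gen that by (metis imageE)
  then show ?thesis using assms(1) by (auto simp: V_iff)
qed

text \<open>The properties required in \<open>schreier_tree\<close>, for a tree on the cosets in
  \<open>A\<close> only, so that they can be maintained while vertices are added.\<close>

definition subtree :: "'a set set \<Rightarrow> ('a set \<times> 'a) set \<Rightarrow> ('a set \<Rightarrow> 'a) \<Rightarrow> bool" where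
  "subtree A D \<tau> \<longleftrightarrow> A \<subseteq> V \<and> K \<in> A \<and> Suc (card D) = card A \<and>
     (\<forall>(v, s)\<in>D. v \<in> A \<and> s \<in> S \<and> s <# v \<in> A \<and> \<tau> (s <# v) = s \<otimes> \<tau> v) \<and> \<tau> K = \<one> \<and>
     (\<forall>v\<in>A. \<tau> v \<in> carrier G \<and> \<tau> v <# K = v) \<and>
     (\<forall>Q. Q K \<and> (\<forall>(v, s)\<in>D. Q v \<longleftrightarrow> Q (s <# v)) \<longrightarrow> (\<forall>v\<in>A. Q v)) \<and>
     (\<forall>C. adm C \<longrightarrow> h (\<Union>v\<in>A. T (inv (\<tau> v)) ` C) \<le> card A * h C - (\<Sum>(v, s)\<in>D. J C s C))"

lemma subtreeD:
  assumes "subtree A D \<tau>"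
  shows "A \<subseteq> V" "K \<in> A" "Suc (card D) = card A" "\<tau> K = \<one>"
    "(v, s) \<in> D \<Longrightarrow> v \<in> A \<and> s \<in> S \<and> s <# v \<in> A \<and> \<tau> (s <# v) = s \<otimes> \<tau> v"
    "v \<in> A \<Longrightarrow> \<tau> v \<in> carrier G \<and> \<tau> v <# K = v"
    "Q K \<Longrightarrow> \<forall>(v, s)\<in>D. Q v \<longleftrightarrow> Q (s <# v) \<Longrightarrow> v \<in> A \<Longrightarrow> Q v"
    "adm C \<Longrightarrow> h (\<Union>v\<in>A. T (inv (\<tau> v)) ` C) \<le> card A * h C - (\<Sum>(v, s)\<in>D. J C s C)"
proof -
  note st = assms[unfolded subtree_def]
  from st show "A \<subseteq> V" by (elim conjE)
  from st show "K \<in> A" by (elim conjE)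
  from st show "Suc (card D) = card A" by (elim conjE)
  from st show "\<tau> K = \<one>" by (elim conjE)
  from st have *: "\<forall>(v, s)\<in>D. v \<in> A \<and> s \<in> S \<and> s <# v \<in> A \<and> \<tau> (s <# v) = s \<otimes> \<tau> v" by (elim conjE)
  then show "(v, s) \<in> D \<Longrightarrow> v \<in> A \<and> s \<in> S \<and> s <# v \<in> A \<and> \<tau> (s <# v) = s \<otimes> \<tau> v" by blast
  from st have "\<forall>v\<in>A. \<tau> v \<in> carrier G \<and> \<tau> v <# K = v" by (elim conjE)
  then show "v \<in> A \<Longrightarrow> \<tau> v \<in> carrier G \<and> \<tau> v <# K = v" by blast
  from st have "\<forall>Q. Q K \<and> (\<forall>(v, s)\<in>D. Q v \<longleftrightarrow> Q (s <# v)) \<longrightarrow> (\<forall>v\<in>A. Q v)" by (elim conjE)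
  from spec[OF this, of Q]
  show "Q K \<Longrightarrow> \<forall>(v, s)\<in>D. Q v \<longleftrightarrow> Q (s <# v) \<Longrightarrow> v \<in> A \<Longrightarrow> Q v" by blast
  from st have "\<forall>C. adm C \<longrightarrow> h (\<Union>v\<in>A. T (inv (\<tau> v)) ` C) \<le> card A * h C - (\<Sum>(v, s)\<in>D. J C s C)"
    by (elim conjE)
  then show "adm C \<Longrightarrow> h (\<Union>v\<in>A. T (inv (\<tau> v)) ` C) \<le> card A * h C - (\<Sum>(v, s)\<in>D. J C s C)" by blast
qed

lemma subtree_start: "subtree {K} {} (\<lambda>_. \<one>)"
  by (auto simp: subtree_def lcos_mult_one)

lemma subtree_extend:
  assumes tr: "subtree A D \<tau>" and v: "v \<in> A" and l: "snd l \<in> S" and n: "letter_value G l <# v \<notin> A"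
  shows "\<exists>A' D' \<tau>'. subtree A' D' \<tau>' \<and> card A' = Suc (card A)"
proof -
  define a where "a = letter_value G l"
  define n where "n = a <# v"
  \<comment> \<open>Tree edges are stored in their positive orientation; for an inverse letter the
    edge therefore starts at the new vertex.\<close>
  define d where "d = (if fst l then v else n, snd l)"
  define \<tau>' where "\<tau>' = \<tau>(n := a \<otimes> \<tau> v)"
  have a: "a \<in> carrier G" using l by (simp add: a_def)
  have A: "A \<subseteq> V" "finite A" "K \<in> A" "v \<in> V"
    using subtreeD(1,2)[OF tr] v finite_subset[OF subtreeD(1)[OF tr] V_finite] by auto
  have nA: "n \<notin> A" using assms(4) by (simp add: n_def a_def)
  have nV: "n \<in> V" using A a by (simp add: n_def)
  have DA: "x \<in> A \<and> s \<in> S \<and> s <# x \<in> A \<and> \<tau> (s <# x) = s \<otimes> \<tau> x" if "(x, s) \<in> D" for x s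
    using subtreeD(5)[OF tr that] .
  have \<tau>: "\<tau> x \<in> carrier G" "\<tau> x <# K = x" if "x \<in> A" for x using subtreeD(6)[OF tr that] by blast+
  have \<tau>'A: "\<tau>' x = \<tau> x" if "x \<in> A" for x using that nA by (auto simp: \<tau>'_def)
  have \<tau>'n: "\<tau>' n = a \<otimes> \<tau> v" by (simp add: \<tau>'_def)
  have dv: "snd d = snd l" "fst l \<Longrightarrow> fst d = v \<and> snd d <# fst d = n" "\<not> fst l \<Longrightarrow> fst d = n \<and> snd d <# fst d = v"
    using A l by (simp_all add: d_def n_def a_def letter_value_def)
  have dD: "d \<notin> D"
  proof
    assume "d \<in> D"
    with DA[of "fst d" "snd d"] have "fst d \<in> A" "snd d <# fst d \<in> A" by simp_all
    with dv nA show False by metis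
  qed
  have "D \<subseteq> A \<times> S" using DA by auto
  then have finD: "finite D" using A by (meson S_fin finite_SigmaI finite_subset)
  have "subtree (insert n A) (insert d D) \<tau>'"
    unfolding subtree_def
  proof (intro conjI allI impI ballI)
    show "Suc (card (insert d D)) = card (insert n A)"
      using subtreeD(3)[OF tr] dD finD nA A by simp
  next
    fix e assume e: "e \<in> insert d D"
    show "case e of (x, s) \<Rightarrow> x \<in> insert n A \<and> s \<in> S \<and> s <# x \<in> insert n A \<and> \<tau>' (s <# x) = s \<otimes> \<tau>' x"
    proof (cases "e = d")
      case True
      show ?thesis
      proof (cases "fst l")
        case t: True
        then have "a = snd l" by (simp add: a_def letter_value_def)
        moreover have "d = (v, snd l)" using t by (simp add: d_def)
        moreover have "snd l <# v = n" using dv(2)[OF t] dv(1) by metis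
        ultimately show ?thesis using True v l \<tau>'n \<tau>'A[OF v] by simp
      next
        case f: False
        then have "a = inv (snd l)" by (simp add: a_def letter_value_def)
        moreover have "d = (n, snd l)" using f by (simp add: d_def)
        moreover have "snd l \<otimes> (inv (snd l) \<otimes> \<tau> v) = \<tau> v"
          using l \<tau>[OF v] by (simp add: m_assoc[symmetric])
        moreover have "snd l <# n = v" using dv(3)[OF f] dv(1) by metis
        ultimately show ?thesis using True v l \<tau>'n \<tau>'A[OF v] by simp
      qed
    next
      case False
      with e DA show ?thesis by (cases e) (auto simp: \<tau>'A)
    qed
  next
    show "\<tau>' K = \<one>" using subtreeD(4)[OF tr] A by (simp add: \<tau>'A)
  next
    have n: "(a \<otimes> \<tau> v) <# K = n"
      using lcos_m_assoc[OF K_carrier a, of "\<tau> v"] \<tau>[OF v] by (simp add: n_def)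
    fix x assume "x \<in> insert n A"
    then have "\<tau>' x \<in> carrier G \<and> \<tau>' x <# K = x"
    proof
      assume "x = n"
      then show ?thesis using n \<tau>'n a \<tau>[OF v] by simp
    next
      assume "x \<in> A"
      then show ?thesis using \<tau>'A \<tau> by simp
    qed
    then show "\<tau>' x \<in> carrier G" "\<tau>' x <# K = x" by blast+
  next
    fix Q x assume Q: "Q K \<and> (\<forall>(v, s)\<in>insert d D. Q v = Q (s <# v))" and x: "x \<in> insert n A"
    then have "\<forall>(v, s)\<in>D. Q v = Q (s <# v)" by blast
    then have QA: "\<forall>x\<in>A. Q x" using subtreeD(7)[OF tr, of Q] Q by blast
    have "Q (fst d) = Q (snd d <# fst d)" using Q by (cases d) auto
    then have "Q n" using QA v dv(2,3) by metis
    then show "Q x" using QA x by auto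
  next
    fix C assume C: "adm C"
    define B where "B = (\<Union>v\<in>A. T (inv (\<tau> v)) ` C)"
    define Z where "Z = T (inv (a \<otimes> \<tau> v)) ` C"
    define Y where "Y = T (inv (\<tau> v)) ` C"
    have adm: "adm B" "adm Z" "adm Y" using C A \<tau> v a by (auto simp: B_def Z_def Y_def intro!: adm_UN)
    have union: "(\<Union>x\<in>insert n A. T (inv (\<tau>' x)) ` C) = Z \<union> B"
      using nA by (auto simp: B_def Z_def \<tau>'_def)
    \<comment> \<open>Of all earlier translates only the one at the neighbour \<open>v\<close> is
      kept in the condition. This already saves the mutual information of the new edge.\<close>
    have "hc Z B \<le> hc Z Y" using adm v by (intro hc_antimono) (auto simp: B_def Y_def)
    also have "hc Z Y = hc (T (a \<otimes> \<tau> v) ` Z) (T (a \<otimes> \<tau> v) ` Y)"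
      using adm a \<tau> v by (intro hc_T[symmetric]) auto
    also have "T (a \<otimes> \<tau> v) ` Z = C" using C a \<tau> v by (simp add: Z_def T_image_mult)
    also have "T (a \<otimes> \<tau> v) ` Y = T a ` C" using C a \<tau> v by (simp add: Y_def T_image_mult m_assoc)
    also have "hc C (T a ` C) = h C - J C a C" using C a by (simp add: hc_def J_def)
    also have "J C a C = J C (snd l) C"
      using C l J_flip[of C C "snd l"] by (simp add: a_def letter_value_def)
    finally have "h (Z \<union> B) \<le> h B + h C - J C (snd l) C" by (simp add: hc_def)
    moreover have "h B \<le> card A * h C - (\<Sum>(v, s)\<in>D. J C s C)"
      using subtreeD(8)[OF tr C] by (simp add: B_def)
    moreover have "(\<Sum>(v, s)\<in>insert d D. J C s C) = J C (snd l) C + (\<Sum>(v, s)\<in>D. J C s C)"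
      using dD finD dv by (simp add: case_prod_unfold)
    ultimately show "h (\<Union>x\<in>insert n A. T (inv (\<tau>' x)) ` C) \<le>
        card (insert n A) * h C - (\<Sum>(v, s)\<in>insert d D. J C s C)"
      unfolding union using nA A by (simp add: algebra_simps)
  qed (use A nV in auto)
  moreover have "card (insert n A) = Suc (card A)" using nA A by simp
  ultimately show ?thesis by blast
qed

lemma ex_schreier_tree: "\<exists>D \<tau>. schreier_tree G T U adm h S K D \<tau>"
proof -
  have "\<exists>A D \<tau>. subtree A D \<tau> \<and> card A = Suc m" if "Suc m \<le> card V" for m
    using that
  proof (induction m)
    case 0
    then show ?case using subtree_start by (intro exI[of _ "{K}"] exI[of _ "{}"] exI[of _ "\<lambda>_. \<one>"]) simp
  next
    case (Suc m)
    then obtain A D \<tau> where A: "subtree A D \<tau>" "card A = Suc m" by auto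
    have "A \<noteq> V" using A Suc.prems by auto
    then obtain l v where "snd l \<in> S" "v \<in> A" "letter_value G l <# v \<notin> A"
      using V_connected[of A] subtreeD(1,2)[OF A(1)] by blast
    from subtree_extend[OF A(1) this(2,1,3)] A(2) show ?case by simp
  qed
  moreover have "V \<noteq> {}" using K_V by (metis empty_iff)
  then have "0 < card V" by (simp add: card_gt_0_iff)
  then have "Suc (card V - 1) = card V" by simp
  ultimately obtain A D \<tau> where A: "subtree A D \<tau>" "card A = card V" by (metis order_refl)
  then have "A = V" using subtreeD(1)[OF A(1)] by (simp add: card_subset_eq)
  with A(1) have st: "subtree V D \<tau>" by simp
  have "schreier_tree G T U adm h S K D \<tau>"
  proof unfold_locales
    show "D \<subseteq> V \<times> S" using subtreeD(5)[OF st] by auto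
    show "Suc (card D) = card V" "\<tau> K = \<one>" using subtreeD(3,4)[OF st] by blast+
    show "\<tau> (s <# v) = s \<otimes> \<tau> v" if "(v, s) \<in> D" for v s using subtreeD(5)[OF st that] by blast
    show "\<tau> v \<in> carrier G \<and> \<tau> v <# K = v" if "v \<in> V" for v using subtreeD(6)[OF st that] .
    show "Q v" if "Q K" "\<And>v s. (v, s) \<in> D \<Longrightarrow> Q v \<longleftrightarrow> Q (s <# v)" "v \<in> V" for Q v
      using subtreeD(7)[OF st, of Q] that by blast
    show "h (\<Union>v\<in>V. T (inv (\<tau> v)) ` C) \<le> card V * h C - (\<Sum>(v, s)\<in>D. J C s C)" if "adm C" for C
      using subtreeD(8)[OF st that] .
  qed
  then show ?thesis by blast
qed

end

section \<open>Entropy of countable partitions\<close>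

lemma infsum_eq_nn_integral_count_space:
  fixes f :: "'a \<Rightarrow> ennreal"
  assumes "countable A"
  shows "infsum f A = (\<integral>\<^sup>+x. f x \<partial>count_space A)"
proof (cases "finite A")
  case True
  then show ?thesis by (simp add: nn_integral_count_space_finite)
next
  case False
  with assms have bij: "bij_betw (from_nat_into A) UNIV A" by (simp add: bij_betw_from_nat_into)
  have "infsum f A = infsum (\<lambda>n. f (from_nat_into A n)) UNIV"
    by (rule infsum_reindex_bij_betw[OF bij, symmetric])
  also have "\<dots> = suminf (\<lambda>n. f (from_nat_into A n))"
    by (intro sums_unique has_sum_imp_sums has_sum_infsum nonneg_summable_on_complete) simp
  also have "\<dots> = (\<integral>\<^sup>+n. f (from_nat_into A n) \<partial>count_space UNIV)"
    by (simp add: nn_integral_count_space_nat)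
  also have "\<dots> = (\<integral>\<^sup>+x. f x \<partial>count_space A)"
    by (rule nn_integral_bij_count_space[OF bij])
  finally show ?thesis .
qed

text \<open>The equivalence relation by which a collection encodes a partition; its classes are the
  atoms below, and uniting collections intersects the relations.\<close>

definition same :: "'x set set \<Rightarrow> 'x \<Rightarrow> 'x \<Rightarrow> bool" where
  "same C x y \<longleftrightarrow> (\<forall>A\<in>C. x \<in> A \<longleftrightarrow> y \<in> A)"

lemma same_refl [simp]: "same C x x"
  by (simp add: same_def)

lemma same_sym: "same C x y \<Longrightarrow> same C y x"
  by (simp add: same_def)

lemma same_trans: "same C x y \<Longrightarrow> same C y z \<Longrightarrow> same C x z"
  by (simp add: same_def)

lemma same_eqI: "same C x y \<Longrightarrow> same C x = same C y"
  by (rule ext) (metis same_sym same_trans)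

lemma same_Un: "same (C \<union> D) x y \<longleftrightarrow> same C x y \<and> same D x y"
  by (auto simp: same_def)

definition atom :: "'x measure \<Rightarrow> 'x set set \<Rightarrow> 'x \<Rightarrow> 'x set" where
  "atom M C x = {y \<in> space M. same C x y}"

definition atoms :: "'x measure \<Rightarrow> 'x set set \<Rightarrow> 'x set set" where
  "atoms M C = atom M C ` space M"

lemma atom_self: "x \<in> space M \<Longrightarrow> x \<in> atom M C x"
  by (simp add: atom_def)

lemma atom_cong: "same C x y \<Longrightarrow> atom M C x = atom M C y"
  unfolding atom_def by (drule same_eqI) simp

lemma atom_Un: "atom M (C \<union> D) x = atom M C x \<inter> atom M D x"
  by (auto simp: atom_def same_Un)

lemma atom_eqI: "P \<in> atoms M C \<Longrightarrow> x \<in> P \<Longrightarrow> P = atom M C x"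
proof -
  assume "P \<in> atoms M C" "x \<in> P"
  then obtain y where "P = atom M C y" "x \<in> atom M C y" unfolding atoms_def by blast
  moreover from this(2) have "same C y x" by (simp add: atom_def)
  ultimately show ?thesis using atom_cong[of C y x M] by simp
qed

lemma atoms_partition: "partition_on (space M) (atoms M C)"
proof (rule partition_onI)
  show "\<Union> (atoms M C) = space M"
  proof (intro subset_antisym subsetI)
    fix x assume x: "x \<in> space M"
    then show "x \<in> \<Union> (atoms M C)"
      unfolding atoms_def using atom_self[OF x, of C] by (intro UnionI[of "atom M C x"] imageI)
  next
    fix x assume "x \<in> \<Union> (atoms M C)"
    then show "x \<in> space M" unfolding atoms_def atom_def by blast
  qed
next
  fix p q assume pq: "p \<in> atoms M C" "q \<in> atoms M C" "p \<noteq> q"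
  show "disjnt p q"
  proof (rule ccontr)
    assume "\<not> disjnt p q"
    then obtain x where x: "x \<in> p" "x \<in> q" unfolding disjnt_def by blast
    have "p = q" using atom_eqI[OF pq(1) x(1)] atom_eqI[OF pq(2) x(2)] by (rule trans[OF _ sym])
    then show False using pq(3) by contradiction
  qed
next
  show "{} \<notin> atoms M C"
  proof
    assume "{} \<in> atoms M C"
    then obtain x where x: "x \<in> space M" "{} = atom M C x" unfolding atoms_def by blast
    from atom_self[OF x(1), of C] show False unfolding x(2)[symmetric] by simp
  qed
qed

lemma partition_on_unique:
  assumes "partition_on Z \<alpha>" "A \<in> \<alpha>" "B \<in> \<alpha>" "y \<in> A" "y \<in> B"
  shows "B = A"
  using disjointD[OF partition_onD2[OF assms(1)] assms(3,2)] assms(4,5) by blast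

lemma atom_partition:
  assumes \<alpha>: "partition_on (space M) \<alpha>" and A: "A \<in> \<alpha>" "x \<in> A"
  shows "atom M \<alpha> x = A"
proof -
  have sub: "A \<subseteq> space M" using \<alpha> A by (auto simp: partition_on_def)
  have uniq: "B = A" if "B \<in> \<alpha>" "y \<in> B" "y \<in> A" for B y
    using partition_on_unique[OF \<alpha> A(1) that(1) that(3,2)] .
  have "same \<alpha> x y \<longleftrightarrow> y \<in> A" for y
  proof
    assume "same \<alpha> x y"
    then show "y \<in> A" using A by (simp add: same_def)
  next
    assume "y \<in> A"
    then show "same \<alpha> x y" unfolding same_def using uniq A(2) by metis
  qed
  then show ?thesis using sub by (auto simp: atom_def)
qed

lemma atoms_of_partition:
  assumes "partition_on (space M) \<alpha>"
  shows "atoms M \<alpha> = \<alpha>"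
proof -
  have "atom M \<alpha> x \<in> \<alpha>" if "x \<in> space M" for x
  proof -
    have "x \<in> \<Union>\<alpha>" using that assms by (simp add: partition_on_def)
    then obtain A where "A \<in> \<alpha>" "x \<in> A" by (rule UnionE)
    then show ?thesis using atom_partition[OF assms] by metis
  qed
  moreover have "\<exists>x\<in>space M. atom M \<alpha> x = A" if "A \<in> \<alpha>" for A
  proof -
    have "A \<noteq> {}" using assms that unfolding partition_on_def by metis
    then obtain x where x: "x \<in> A" by (metis equals0I)
    then have "x \<in> space M" using assms that unfolding partition_on_def by blast
    then show ?thesis using atom_partition[OF assms that x] by blast
  qed
  ultimately show ?thesis unfolding atoms_def by blast
qed

text \<open>A nonempty block of the refinement is an intersection of one block from each partition,
  that is, a class of points with the same memberships throughout.\<close>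

lemma common_refinement_eq_atoms:
  assumes "\<And>P. P \<in> \<P> \<Longrightarrow> partition_on (space M) P" "\<P> \<noteq> {}"
  shows "common_refinement \<P> = atoms M (\<Union>\<P>)"
proof -
  have part: "partition_on (space M) (common_refinement \<P>)"
    using assms by (rule partition_on_common_refinement)
  have "A = atom M (\<Union>\<P>) x" if A: "A \<in> common_refinement \<P>" "x \<in> A" for A x
  proof -
    obtain f where f: "f \<in> (\<Pi>\<^sub>E P\<in>\<P>. P)" "A = \<Inter> (f ` \<P>)"
      using A by (auto simp: common_refinement_def)
    have "atom M P x = f P" if "P \<in> \<P>" for P
      using f that A by (intro atom_partition assms) auto
    moreover have "atom M (\<Union>\<P>) x = (\<Inter>P\<in>\<P>. atom M P x)"
      using assms(2) unfolding atom_def same_def by blast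
    ultimately show ?thesis using f by simp
  qed
  then have "common_refinement \<P> = atoms M (common_refinement \<P>)"
    "\<And>x. x \<in> space M \<Longrightarrow> atom M (common_refinement \<P>) x = atom M (\<Union>\<P>) x"
  proof -
    assume *: "\<And>A x. A \<in> common_refinement \<P> \<Longrightarrow> x \<in> A \<Longrightarrow> A = atom M (\<Union>\<P>) x"
    show "common_refinement \<P> = atoms M (common_refinement \<P>)"
      using atoms_of_partition[OF part] by simp
    fix x assume "x \<in> space M"
    then obtain A where "A \<in> common_refinement \<P>" "x \<in> A" using part unfolding partition_on_def by blast
    then show "atom M (common_refinement \<P>) x = atom M (\<Union>\<P>) x"
      using * atom_partition[OF part] by metis
  qed
  then show ?thesis unfolding atoms_def by simp
qed

section \<open>Entropy as the integral of the information function\<close>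

context prob_space
begin

text \<open>Only countably many atoms are allowed, so that almost every point lies in an atom of positive
  mass and the value \<open>ln 0 = 0\<close> is harmless.\<close>

definition pre_adm :: "'a set set \<Rightarrow> bool" where
  "pre_adm C \<longleftrightarrow> countable C \<and> C \<subseteq> events \<and> countable (atoms M C)"

definition mass :: "'a set set \<Rightarrow> 'a \<Rightarrow> real" where
  "mass C x = prob (atom M C x)"

definition admissible :: "'a set set \<Rightarrow> bool" where
  "admissible C \<longleftrightarrow> pre_adm C \<and> integrable M (\<lambda>x. - ln (mass C x))"

text \<open>The integrand is the information function. Written as integrals over the same space,
  entropies of different collections can be compared pointwise.\<close>

definition ent :: "'a set set \<Rightarrow> real" where
  "ent C = (\<integral>x. - ln (mass C x) \<partial>M)"

lemma atom_events [measurable]: "pre_adm C \<Longrightarrow> atom M C x \<in> events"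
  unfolding atom_def same_def pre_adm_def
proof (intro sets.sets_Collect_countable_All')
  fix A assume "countable C \<and> C \<subseteq> events \<and> countable (atoms M C)" "A \<in> C"
  then have "A \<in> events" by auto
  moreover have "{y \<in> space M. (x \<in> A) = (y \<in> A)} = (if x \<in> A then A \<inter> space M else space M - A)"
    by auto
  ultimately show "{y \<in> space M. (x \<in> A) = (y \<in> A)} \<in> events" by auto
qed auto

lemma atoms_events: "pre_adm C \<Longrightarrow> atoms M C \<subseteq> events"
  by (auto simp: atoms_def)

lemma pre_adm_Un:
  assumes "pre_adm C" "pre_adm D"
  shows "pre_adm (C \<union> D)"
proof -
  have "atoms M (C \<union> D) \<subseteq> (\<lambda>(P, Q). P \<inter> Q) ` (atoms M C \<times> atoms M D)"
    by (auto simp: atoms_def atom_Un)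
  then have "countable (atoms M (C \<union> D))"
    using assms countable_subset by (fastforce simp: pre_adm_def)
  then show ?thesis using assms by (auto simp: pre_adm_def)
qed

lemma measurable_atomwise:
  assumes C: "pre_adm C" and f: "\<And>x y. x \<in> space M \<Longrightarrow> y \<in> space M \<Longrightarrow> same C x y \<Longrightarrow> f x = f y"
    and sp: "\<And>x. x \<in> space M \<Longrightarrow> f x \<in> space N"
  shows "f \<in> measurable M N"
proof (rule measurableI)
  fix A assume "A \<in> sets N"
  have "f -` A \<inter> space M = (\<Union>P\<in>{P \<in> atoms M C. f ` P \<subseteq> A}. P)"
  proof (intro subset_antisym subsetI)
    fix x assume x: "x \<in> f -` A \<inter> space M"
    have "f y \<in> A" if "y \<in> atom M C x" for y
      using x that f[of x y] by (simp add: atom_def)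
    then have "f ` atom M C x \<subseteq> A" by blast
    then show "x \<in> (\<Union>P\<in>{P \<in> atoms M C. f ` P \<subseteq> A}. P)"
      using x atom_self[of x M C] by (auto simp: atoms_def)
  next
    fix x assume "x \<in> (\<Union>P\<in>{P \<in> atoms M C. f ` P \<subseteq> A}. P)"
    then show "x \<in> f -` A \<inter> space M" by (auto simp: atoms_def atom_def)
  qed
  also have "\<dots> \<in> events"
    using C atoms_events[OF C] by (intro sets.countable_UN') (auto simp: pre_adm_def)
  finally show "f -` A \<inter> space M \<in> events" .
qed (fact sp)

lemma mass_same: "x \<in> space M \<Longrightarrow> y \<in> space M \<Longrightarrow> same C x y \<Longrightarrow> mass C x = mass C y"
  using atom_cong[of C x y M] by (simp add: mass_def)

lemma mass_measurable [measurable]: "pre_adm C \<Longrightarrow> mass C \<in> borel_measurable M"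
  by (rule measurable_atomwise) (auto intro: mass_same)

lemma mass_nonneg [simp]: "0 \<le> mass C x" "mass C x \<le> 1"
  by (simp_all add: mass_def)

lemma mass_Un_le: "pre_adm C \<Longrightarrow> pre_adm D \<Longrightarrow> mass (C \<union> D) x \<le> mass C x"
  unfolding mass_def atom_Un by (intro finite_measure_mono atom_events) auto

lemma AE_mass_pos:
  assumes "pre_adm C"
  shows "AE x in M. 0 < mass C x"
proof -
  have "(\<Union>P\<in>{P \<in> atoms M C. prob P = 0}. P) \<in> null_sets M"
    using assms atoms_events[OF assms]
    by (intro null_sets_UN') (auto simp: pre_adm_def emeasure_eq_measure intro!: null_setsI)
  then show ?thesis
  proof (rule AE_I')
    show "{x \<in> space M. \<not> 0 < mass C x} \<subseteq> (\<Union>P\<in>{P \<in> atoms M C. prob P = 0}. P)"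
    proof
      fix x assume "x \<in> {x \<in> space M. \<not> 0 < mass C x}"
      then have "x \<in> space M" "prob (atom M C x) = 0"
        by (simp_all add: mass_def zero_less_measure_iff)
      then show "x \<in> (\<Union>P\<in>{P \<in> atoms M C. prob P = 0}. P)"
        using atom_self[of x M C] by (auto simp: atoms_def)
    qed
  qed
qed

lemma nn_integral_atoms:
  assumes C: "pre_adm C" and [measurable]: "f \<in> borel_measurable M"
  shows "(\<integral>\<^sup>+x. f x \<partial>M) = (\<integral>\<^sup>+P. (\<integral>\<^sup>+x. f x * indicator P x \<partial>M) \<partial>count_space (atoms M C))"
proof -
  have "(\<integral>\<^sup>+P. f x * indicator P x \<partial>count_space (atoms M C)) = f x" if x: "x \<in> space M" for x
  proof -
    have "(\<integral>\<^sup>+P. f x * indicator P x \<partial>count_space (atoms M C)) = (\<Sum>P\<in>{atom M C x}. f x * indicator P x)"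
    proof (rule nn_integral_count_space')
      show "f x * indicator P x = 0" if "P \<in> atoms M C" "P \<notin> {atom M C x}" for P
        using that atom_eqI[of P M C x] by (auto simp: indicator_def)
    qed (use x in \<open>auto simp: atoms_def\<close>)
    then show ?thesis using atom_self[OF x] by simp
  qed
  then have "(\<integral>\<^sup>+x. f x \<partial>M) = (\<integral>\<^sup>+x. (\<integral>\<^sup>+P. f x * indicator P x \<partial>count_space (atoms M C)) \<partial>M)"
    by (intro nn_integral_cong) simp
  also have "\<dots> = (\<integral>\<^sup>+P. (\<integral>\<^sup>+x. f x * indicator P x \<partial>M) \<partial>count_space (atoms M C))"
  proof (rule nn_integral_count_space_nn_integral)
    show "countable (atoms M C)" using C by (simp add: pre_adm_def)
    fix P assume "P \<in> atoms M C"
    then have [measurable]: "P \<in> events" using atoms_events[OF C] by blast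
    show "(\<lambda>x. f x * indicator P x) \<in> borel_measurable M" by measurable
  qed
  finally show ?thesis .
qed

text \<open>The integrand has integral at most 1 because the sum over the atoms \<open>P\<close> of the common
  refinement of \<open>\<mu>(A\<^sub>P) \<mu>(B\<^sub>P) / \<mu>(C\<^sub>P)\<close>, where \<open>A\<^sub>P\<close>, \<open>B\<^sub>P\<close>, \<open>C\<^sub>P\<close> are the atoms containing \<open>P\<close> of the
  respective coarser collections, is at most the sum of \<open>\<mu>(C\<^sub>P)\<close> over the atoms of \<open>C\<close>.\<close>

lemma mass_ratio_integral_le:
  assumes A: "pre_adm A" and B: "pre_adm B" and C: "pre_adm C"
  shows "(\<integral>\<^sup>+x. ennreal (mass (A \<union> C) x * mass (B \<union> C) x / (mass (A \<union> B \<union> C) x * mass C x)) \<partial>M) \<le> 1"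
proof -
  define D where "D = A \<union> B \<union> C"
  have AC: "pre_adm (A \<union> C)" and BC: "pre_adm (B \<union> C)" and D: "pre_adm D"
    using A B C by (auto simp: D_def intro!: pre_adm_Un)
  note [measurable] = mass_measurable[OF AC] mass_measurable[OF BC] mass_measurable[OF D] mass_measurable[OF C]
  define R where "R x = mass (A \<union> C) x * mass (B \<union> C) x / (mass D x * mass C x)" for x
  have [measurable]: "R \<in> borel_measurable M" unfolding R_def by measurable
  define a where "a P = atom M (A \<union> C) (SOME x. x \<in> P)" for P
  define b where "b P = atom M (B \<union> C) (SOME x. x \<in> P)" for P
  have rep: "a P = atom M (A \<union> C) x \<and> b P = atom M (B \<union> C) x"
    if P: "P \<in> atoms M D" and x: "x \<in> P" for P x
  proof -
    let ?y = "SOME x. x \<in> P"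
    have y: "?y \<in> P" using x by (rule someI)
    have "same D x ?y" using atom_eqI[OF P x] y by (auto simp: atom_def)
    then have "same (A \<union> C) x ?y" "same (B \<union> C) x ?y" by (auto simp: D_def same_Un)
    then show ?thesis unfolding a_def b_def by (metis atom_cong)
  qed
  have ab_atoms: "a P \<in> atoms M (A \<union> C)" "b P \<in> atoms M (B \<union> C)" if P: "P \<in> atoms M D" for P
  proof -
    obtain y where y: "y \<in> space M" "P = atom M D y" using P by (auto simp: atoms_def)
    then have "y \<in> P" using atom_self[of y M D] by simp
    from rep[OF P this] y(1) show "a P \<in> atoms M (A \<union> C)" "b P \<in> atoms M (B \<union> C)"
      by (simp_all add: atoms_def)
  qed
  have ab: "P = a P \<inter> b P" if P: "P \<in> atoms M D" for P
  proof -
    obtain x where x: "x \<in> space M" "P = atom M D x" using P by (auto simp: atoms_def)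
    then have "x \<in> P" using atom_self[of x M D] by simp
    from rep[OF P this] show ?thesis using x by (auto simp: D_def atom_Un)
  qed
  have aM: "a P \<in> events" "b P \<in> events" for P using AC BC by (auto simp: a_def b_def)
  \<comment> \<open>The ratio is constant on \<open>P\<close>, and the resulting quantity is spread
    over the larger set \<open>a P\<close>, so that for a fixed point the sum over \<open>P\<close>
    can be carried out.\<close>
  have term_le: "(\<integral>\<^sup>+x. ennreal (R x) * indicator P x \<partial>M) \<le>
      (\<integral>\<^sup>+x. ennreal (prob (b P) / mass C x) * indicator (a P) x \<partial>M)" if P: "P \<in> atoms M D" for P
  proof -
    obtain x0 where x0: "x0 \<in> space M" "P = atom M D x0" using P by (auto simp: atoms_def)
    then have x0P: "x0 \<in> P" using atom_self[of x0 M D] by simp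
    have aP: "a P = atom M (A \<union> C) x0" "b P = atom M (B \<union> C) x0" using rep[OF P x0P] by auto
    have PM: "P \<in> events" using P atoms_events[OF D] by blast
    have C0: "mass C x = mass C x0" if "x \<in> a P" for x
    proof (rule mass_same)
      have "same C x0 x" using that by (simp add: aP atom_def same_Un)
      then show "same C x x0" by (rule same_sym)
      show "x \<in> space M" using that unfolding aP atom_def by blast
    qed (fact x0(1))
    have Rx: "R x = R x0" if "x \<in> P" for x
    proof -
      have "same D x0 x" "x \<in> space M" using that by (auto simp: x0 atom_def)
      then have s: "same (A \<union> C) x x0" "same (B \<union> C) x x0" "same D x x0" "same C x x0"
        by (auto simp: D_def same_Un intro: same_sym)
      show ?thesis unfolding R_def
        using mass_same[OF \<open>x \<in> space M\<close> x0(1) s(1)] mass_same[OF \<open>x \<in> space M\<close> x0(1) s(2)]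
          mass_same[OF \<open>x \<in> space M\<close> x0(1) s(3)] mass_same[OF \<open>x \<in> space M\<close> x0(1) s(4)] by simp
    qed
    have R0: "0 \<le> R x0" by (simp add: R_def)
    have "(\<integral>\<^sup>+x. ennreal (R x) * indicator P x \<partial>M) = (\<integral>\<^sup>+x. ennreal (R x0) * indicator P x \<partial>M)"
      using Rx by (intro nn_integral_cong) (auto simp: indicator_def)
    also have "\<dots> = ennreal (R x0 * prob P)"
      using PM R0 by (simp add: nn_integral_cmult_indicator emeasure_eq_measure ennreal_mult)
    also have "R x0 * prob P \<le> prob (b P) / mass C x0 * prob (a P)"
      \<comment> \<open>Equality holds if \<open>prob P\<close> is positive; otherwise the left side
        vanishes, whatever division by zero yields.\<close>
      using aP x0 by (cases "prob P = 0") (auto simp: R_def mass_def field_simps)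
    also have "ennreal (prob (b P) / mass C x0 * prob (a P)) =
        (\<integral>\<^sup>+x. ennreal (prob (b P) / mass C x0) * indicator (a P) x \<partial>M)"
      using aM by (simp add: nn_integral_cmult_indicator emeasure_eq_measure ennreal_mult[symmetric])
    also have "\<dots> = (\<integral>\<^sup>+x. ennreal (prob (b P) / mass C x) * indicator (a P) x \<partial>M)"
      using C0 by (intro nn_integral_cong) (auto simp: indicator_def)
    finally show ?thesis by (simp add: ennreal_leI)
  qed
  \<comment> \<open>The \<open>P\<close> with \<open>x\<close> in \<open>a P\<close> share the same
    \<open>a P\<close>. Being distinct, they have disjoint \<open>b P\<close>, all inside the atom
    of \<open>C\<close> at \<open>x\<close>.\<close>
  have inner: "(\<integral>\<^sup>+P. ennreal (prob (b P) / mass C x) * indicator (a P) x \<partial>count_space (atoms M D)) \<le> 1"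
    if x: "x \<in> space M" for x
  proof -
    define I where "I = {P \<in> atoms M D. x \<in> a P}"
    have I: "countable I" using D by (auto simp: I_def pre_adm_def)
    have bC: "b P \<subseteq> atom M C x" if "P \<in> I" for P
    proof -
      have P: "P \<in> atoms M D" "x \<in> a P" using that by (auto simp: I_def)
      obtain y where y: "y \<in> space M" "P = atom M D y" using P by (auto simp: atoms_def)
      then have "y \<in> P" using atom_self[of y M D] by simp
      from rep[OF P(1) this] have aP: "a P = atom M (A \<union> C) y" "b P = atom M (B \<union> C) y"
        by blast+
      have "same C y x" using P(2) by (simp add: aP atom_def same_Un)
      then have "atom M C x = atom M C y" using atom_cong[of C y x M] by simp
      then show ?thesis by (simp add: aP atom_Un)
    qed
    have disj: "disjoint_family_on b I"
      unfolding disjoint_family_on_def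
    proof (intro ballI impI)
      fix P Q assume PQ: "P \<in> I" "Q \<in> I" "P \<noteq> Q"
      have P: "P \<in> atoms M D" "x \<in> a P" and Q: "Q \<in> atoms M D" "x \<in> a Q" using PQ by (auto simp: I_def)
      have "a P = a Q" using atom_eqI[OF ab_atoms(1)[OF P(1)] P(2)] atom_eqI[OF ab_atoms(1)[OF Q(1)] Q(2)] by simp
      then have "b P \<noteq> b Q" using ab[OF P(1)] ab[OF Q(1)] PQ(3) by auto
      then show "b P \<inter> b Q = {}"
        using atom_eqI[OF ab_atoms(2)[OF P(1)]] atom_eqI[OF ab_atoms(2)[OF Q(1)]] by (metis disjoint_iff)
    qed
    have "(\<integral>\<^sup>+P. ennreal (prob (b P) / mass C x) * indicator (a P) x \<partial>count_space (atoms M D)) =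
        (\<integral>\<^sup>+P. ennreal (1 / mass C x) * (emeasure M (b P) * indicator I P) \<partial>count_space (atoms M D))"
      by (intro nn_integral_cong)
        (auto simp: I_def indicator_def emeasure_eq_measure ennreal_mult[symmetric])
    also have "\<dots> = ennreal (1 / mass C x) * (\<integral>\<^sup>+P. emeasure M (b P) * indicator I P \<partial>count_space (atoms M D))"
      by (rule nn_integral_cmult) simp
    also have "(\<integral>\<^sup>+P. emeasure M (b P) * indicator I P \<partial>count_space (atoms M D)) =
        (\<integral>\<^sup>+P. emeasure M (b P) \<partial>count_space I)"
      by (subst (1 2) nn_integral_count_space_indicator)
        (auto simp: I_def indicator_def intro!: nn_integral_cong)
    also have "\<dots> = emeasure M (\<Union>(b ` I))"
      by (rule emeasure_UN_countable[symmetric]) (use aM I disj in auto)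
    also have "\<dots> \<le> emeasure M (atom M C x)"
      using bC C by (intro emeasure_mono) auto
    also have "ennreal (1 / mass C x) * emeasure M (atom M C x) \<le> 1"
    proof -
      have "ennreal (1 / mass C x) * emeasure M (atom M C x) = ennreal (1 / mass C x * mass C x)"
        by (simp only: emeasure_eq_measure mass_def ennreal_mult[symmetric] measure_nonneg
            divide_nonneg_nonneg zero_le_one)
      also have "\<dots> \<le> 1" by (auto simp: ennreal_le_1)
      finally show ?thesis .
    qed
    finally show ?thesis by (simp add: mult_left_mono)
  qed
  have "(\<integral>\<^sup>+x. ennreal (R x) \<partial>M) = (\<integral>\<^sup>+P. (\<integral>\<^sup>+x. ennreal (R x) * indicator P x \<partial>M) \<partial>count_space (atoms M D))"
    by (rule nn_integral_atoms[OF D]) measurable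
  also have "\<dots> \<le> (\<integral>\<^sup>+P. (\<integral>\<^sup>+x. ennreal (prob (b P) / mass C x) * indicator (a P) x \<partial>M) \<partial>count_space (atoms M D))"
    by (rule nn_integral_mono) (simp add: term_le)
  also have "\<dots> = (\<integral>\<^sup>+x. (\<integral>\<^sup>+P. ennreal (prob (b P) / mass C x) * indicator (a P) x \<partial>count_space (atoms M D)) \<partial>M)"
  proof (rule nn_integral_count_space_nn_integral[symmetric])
    show "countable (atoms M D)" using D by (simp add: pre_adm_def)
    fix P :: "'a set"
    have [measurable]: "a P \<in> events" by (rule aM)
    show "(\<lambda>x. ennreal (prob (b P) / mass C x) * indicator (a P) x) \<in> borel_measurable M" by measurable
  qed
  also have "\<dots> \<le> (\<integral>\<^sup>+x. 1 \<partial>M)" using inner by (intro nn_integral_mono) simp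
  also have "\<dots> = 1" by (simp add: emeasure_space_1)
  finally show ?thesis by (simp add: R_def D_def)
qed

lemma neg_ln_mass_nonneg: "0 \<le> - ln (mass C x)"
proof (cases "mass C x = 0")
  case False
  then have "0 < mass C x" using mass_nonneg(1)[of C x] by linarith
  then show ?thesis using mass_nonneg(2)[of C x] by simp
qed simp

lemma admissibleI:
  assumes "pre_adm C" "(\<integral>\<^sup>+x. ennreal (- ln (mass C x)) \<partial>M) < \<infinity>"
  shows "admissible C"
  unfolding admissible_def
proof
  note [measurable] = mass_measurable[OF assms(1)]
  show "integrable M (\<lambda>x. - ln (mass C x))"
    by (rule integrableI_nonneg) (use assms(2) neg_ln_mass_nonneg in auto)
qed (fact assms(1))

lemma admissible_pre [simp]: "admissible C \<Longrightarrow> pre_adm C"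
  by (simp add: admissible_def)

lemma admissible_integrable: "admissible C \<Longrightarrow> integrable M (\<lambda>x. - ln (mass C x))"
  by (simp add: admissible_def)

lemma nn_integral_admissible:
  "admissible C \<Longrightarrow> (\<integral>\<^sup>+x. ennreal (- ln (mass C x)) \<partial>M) = ennreal (ent C)"
  unfolding ent_def
  by (intro nn_integral_eq_integral admissible_integrable AE_I2 neg_ln_mass_nonneg)

lemma atom_empty: "atom M {} x = space M"
  by (simp add: atom_def same_def)

lemma mass_empty [simp]: "mass {} x = 1"
  by (simp add: mass_def atom_empty prob_space)

lemma admissible_empty: "admissible {}" and ent_empty: "ent {} = 0"
proof -
  have "atoms M {} \<subseteq> {space M}" by (auto simp: atoms_def atom_empty)
  then have "countable (atoms M {})" by (rule countable_subset) simp
  then show "admissible {}" by (simp add: admissible_def pre_adm_def)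
  show "ent {} = 0" by (simp add: ent_def)
qed

text \<open>Integrability of the joint information is what is to be shown, so nothing may be
  subtracted. Instead \<open>ln (R x) \<le> R x\<close> bounds it by the two given information
  functions plus \<open>R\<close>, whose integral is at most 1.\<close>

lemma admissible_Un:
  assumes C: "admissible C" and D: "admissible D"
  shows "admissible (C \<union> D)"
proof (rule admissibleI)
  have p: "pre_adm C" "pre_adm D" "pre_adm {}" using C D admissible_empty by auto
  show CD: "pre_adm (C \<union> D)" using p(1,2) by (rule pre_adm_Un)
  note [measurable] = mass_measurable[OF CD] mass_measurable[OF p(1)] mass_measurable[OF p(2)]
  define R where "R x = mass C x * mass D x / mass (C \<union> D) x" for x
  have [measurable]: "R \<in> borel_measurable M" unfolding R_def by measurable
  have R: "(\<integral>\<^sup>+x. ennreal (R x) \<partial>M) \<le> 1"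
    using mass_ratio_integral_le[OF p] by (simp add: R_def)
  have le: "AE x in M. ennreal (- ln (mass (C \<union> D) x)) \<le>
      ennreal (- ln (mass C x)) + ennreal (- ln (mass D x)) + ennreal (R x)"
    using AE_mass_pos[OF CD] AE_mass_pos[OF p(1)] AE_mass_pos[OF p(2)]
  proof eventually_elim
    case (elim x)
    then have pos: "R x > 0" by (simp add: R_def)
    have "ln (R x) = ln (mass C x) + ln (mass D x) - ln (mass (C \<union> D) x)"
      using elim by (simp add: R_def ln_div ln_mult)
    moreover have "ln (R x) \<le> R x" using ln_le_minus_one[OF pos] by simp
    ultimately have "- ln (mass (C \<union> D) x) \<le> - ln (mass C x) + - ln (mass D x) + R x" by simp
    then have "ennreal (- ln (mass (C \<union> D) x)) \<le> ennreal (- ln (mass C x) + - ln (mass D x) + R x)"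
      by (rule ennreal_leI)
    also have "\<dots> = ennreal (- ln (mass C x)) + ennreal (- ln (mass D x)) + ennreal (R x)"
      using neg_ln_mass_nonneg[of C x] neg_ln_mass_nonneg[of D x] pos
      by (subst ennreal_plus[symmetric]; simp)+
    finally show ?case .
  qed
  have "(\<integral>\<^sup>+x. ennreal (- ln (mass (C \<union> D) x)) \<partial>M) \<le>
      (\<integral>\<^sup>+x. ennreal (- ln (mass C x)) + ennreal (- ln (mass D x)) + ennreal (R x) \<partial>M)"
    using le by (rule nn_integral_mono_AE)
  also have "\<dots> = ennreal (ent C) + ennreal (ent D) + (\<integral>\<^sup>+x. ennreal (R x) \<partial>M)"
    by (simp add: nn_integral_add nn_integral_admissible[OF C] nn_integral_admissible[OF D])
  also have "\<dots> \<le> ennreal (ent C) + ennreal (ent D) + 1" using R by (rule add_left_mono)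
  also have "\<dots> < \<infinity>" by simp
  finally show "(\<integral>\<^sup>+x. ennreal (- ln (mass (C \<union> D) x)) \<partial>M) < \<infinity>" .
qed

lemma ent_mono_Un:
  assumes C: "admissible C" and D: "admissible D"
  shows "ent C \<le> ent (C \<union> D)"
  unfolding ent_def
proof (rule integral_mono_AE)
  have p: "pre_adm C" "pre_adm D" "pre_adm (C \<union> D)" using C D pre_adm_Un by auto
  show "AE x in M. - ln (mass C x) \<le> - ln (mass (C \<union> D) x)"
    using AE_mass_pos[OF p(3)]
  proof eventually_elim
    case (elim x)
    then show ?case using mass_Un_le[OF p(1,2), of x] by simp
  qed
qed (use C D admissible_Un admissible_integrable in blast)+

text \<open>Gibbs' inequality: the left side minus the right side is the integral of
  \<open>ln (R x)\<close>, hence at most that of \<open>R x - 1\<close>, which is at most 0.\<close>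

lemma ent_submod:
  assumes A: "admissible A" and B: "admissible B" and C: "admissible C"
  shows "ent (A \<union> B \<union> C) + ent C \<le> ent (A \<union> C) + ent (B \<union> C)"
proof -
  have adm: "admissible (A \<union> C)" "admissible (B \<union> C)" "admissible (A \<union> B \<union> C)"
    using A B C by (auto intro!: admissible_Un)
  note p = adm[THEN admissible_pre] C[THEN admissible_pre]
  note [measurable] = p[THEN mass_measurable]
  define R where "R x = mass (A \<union> C) x * mass (B \<union> C) x / (mass (A \<union> B \<union> C) x * mass C x)" for x
  have [measurable]: "R \<in> borel_measurable M" unfolding R_def by measurable
  have R: "(\<integral>\<^sup>+x. ennreal (R x) \<partial>M) \<le> 1"
    using mass_ratio_integral_le[of A B C] A B C by (simp add: R_def)
  have R0: "0 \<le> R x" for x by (simp add: R_def)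
  have intR: "integrable M R"
    by (rule integrableI_nonneg) (use R R0 le_less_trans[OF R ennreal_one_less_top] in auto)
  have "ennreal (\<integral>x. R x \<partial>M) \<le> 1"
    using R nn_integral_eq_integral[OF intR] R0 by simp
  then have R1: "(\<integral>x. R x \<partial>M) \<le> 1" by simp
  have int: "integrable M (\<lambda>x. ln (mass D x))" if "admissible D" for D
    using admissible_integrable[OF that] by simp
  define f where "f x = ln (mass (A \<union> C) x) + ln (mass (B \<union> C) x) - ln (mass (A \<union> B \<union> C) x) - ln (mass C x)" for x
  have "(\<integral>x. f x \<partial>M) \<le> (\<integral>x. R x - 1 \<partial>M)"
  proof (rule integral_mono_AE)
    show "integrable M f" unfolding f_def using adm C int by (intro Bochner_Integration.integrable_diff Bochner_Integration.integrable_add) auto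
    show "integrable M (\<lambda>x. R x - 1)" using intR by simp
    show "AE x in M. f x \<le> R x - 1"
      using p[THEN AE_mass_pos]
    proof eventually_elim
      case (elim x)
      then have pos: "R x > 0" by (simp add: R_def)
      have "f x = ln (R x)" using elim by (simp add: R_def f_def ln_div ln_mult)
      then show ?case using ln_le_minus_one[OF pos] by simp
    qed
  qed
  also have "\<dots> \<le> 0" using intR R1 by (simp add: prob_space)
  finally have "(\<integral>x. f x \<partial>M) \<le> 0" .
  moreover have "(\<integral>x. f x \<partial>M) = ent (A \<union> B \<union> C) + ent C - ent (A \<union> C) - ent (B \<union> C)"
    unfolding f_def ent_def using adm C int by simp
  ultimately show ?thesis by simp
qed

lemma admissible_singleton:
  assumes A: "A \<in> events"
  shows "admissible {A}"
    and "ent {A} = - prob A * ln (prob A) - prob (space M - A) * ln (prob (space M - A))"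
proof -
  have at: "atom M {A} x = (if x \<in> A then A else space M - A)" if "x \<in> space M" for x
    using sets.sets_into_space[OF A] by (auto simp: atom_def same_def)
  have "atoms M {A} \<subseteq> {A, space M - A}" using at by (auto simp: atoms_def)
  then have "countable (atoms M {A})" by (rule countable_subset) simp
  then have pre: "pre_adm {A}" using A by (simp add: pre_adm_def)
  define f where "f x = indicator A x * (- ln (prob A)) + indicator (space M - A) x * (- ln (prob (space M - A)))" for x
  have f: "- ln (mass {A} x) = f x" if "x \<in> space M" for x
    using at[OF that] that by (simp add: mass_def f_def)
  have "integrable M f" unfolding f_def using A by (intro Bochner_Integration.integrable_add integrable_mult_left) (auto simp: emeasure_eq_measure)
  then have "integrable M (\<lambda>x. - ln (mass {A} x))"
    using f by (simp cong: Bochner_Integration.integrable_cong)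
  with pre show "admissible {A}" by (simp add: admissible_def)
  have "ent {A} = (\<integral>x. f x \<partial>M)"
    unfolding ent_def using f by (intro Bochner_Integration.integral_cong) auto
  also have "\<dots> = prob A * (- ln (prob A)) + prob (space M - A) * (- ln (prob (space M - A)))"
    unfolding f_def using A
    by (subst Bochner_Integration.integral_add) (auto simp: emeasure_eq_measure)
  finally show "ent {A} = - prob A * ln (prob A) - prob (space M - A) * ln (prob (space M - A))" by simp
qed

text \<open>An explicit bound that tends to 0 with \<open>prob A\<close> and vanishes on null sets.
  Both terms come from \<open>ln t \<le> t - 1\<close>, at the reciprocal of \<open>sqrt p\<close>
  and of \<open>1 - p\<close>.\<close>

lemma ent_singleton_le:
  assumes A: "A \<in> events"
  shows "ent {A} \<le> 2 * sqrt (prob A) + prob A"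
proof -
  define p where "p = prob A"
  have p: "0 \<le> p" "p \<le> 1" by (simp_all add: p_def)
  have q: "prob (space M - A) = 1 - p" using prob_compl[OF A] by (simp add: p_def)
  have "- p * ln p \<le> 2 * sqrt p"
  proof (cases "p = 0")
    case False
    with p have pos: "p > 0" by simp
    have "ln (1 / sqrt p) \<le> 1 / sqrt p - 1" using pos by (intro ln_le_minus_one) simp
    moreover have "ln (1 / sqrt p) = - ln p / 2" using pos by (simp add: ln_div ln_sqrt)
    ultimately have "- ln p \<le> 2 / sqrt p" by simp
    then have "p * - ln p \<le> p * (2 / sqrt p)" using pos by (intro mult_left_mono) auto
    also have "p * (2 / sqrt p) = 2 * (p / sqrt p)" by simp
    also have "p / sqrt p = sqrt p" using pos by (simp add: real_div_sqrt)
    finally show ?thesis by simp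
  qed simp
  moreover have "- (1 - p) * ln (1 - p) \<le> p"
  proof (cases "p = 1")
    case False
    with p have pos: "1 - p > 0" by simp
    have "ln (1 / (1 - p)) \<le> 1 / (1 - p) - 1" using pos by (intro ln_le_minus_one) simp
    then have "- ln (1 - p) \<le> 1 / (1 - p) - 1" using pos by (simp add: ln_div)
    then have "(1 - p) * - ln (1 - p) \<le> (1 - p) * (1 / (1 - p) - 1)" using pos by (intro mult_left_mono) auto
    also have "\<dots> = p" using pos by (simp add: right_diff_distrib)
    finally show ?thesis by (simp only: mult_minus_right mult_minus_left)
  qed simp
  ultimately show ?thesis unfolding admissible_singleton(2)[OF A] q p_def[symmetric] by (simp add: algebra_simps)
qed

lemma admissible_finite: "finite C \<Longrightarrow> C \<subseteq> events \<Longrightarrow> admissible C"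
proof (induction C rule: finite_induct)
  case (insert A C)
  then show ?case using admissible_Un[OF admissible_singleton(1)[of A], of C] by simp
qed (rule admissible_empty)

lemma mass_cong:
  assumes "\<And>x y. x \<in> space M \<Longrightarrow> y \<in> space M \<Longrightarrow> same C x y \<longleftrightarrow> same D x y" "x \<in> space M"
  shows "atom M C x = atom M D x" "mass C x = mass D x"
proof -
  show "atom M C x = atom M D x" using assms by (auto simp: atom_def)
  then show "mass C x = mass D x" by (simp add: mass_def)
qed

lemma admissible_cong:
  assumes eq: "\<And>x y. x \<in> space M \<Longrightarrow> y \<in> space M \<Longrightarrow> same C x y \<longleftrightarrow> same D x y"
    and C: "admissible C" and D: "countable D" "D \<subseteq> events"
  shows "admissible D" "ent D = ent C"
proof -
  have at: "atom M D x = atom M C x" "mass D x = mass C x" if "x \<in> space M" for x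
    using mass_cong[of C D x] eq that by simp_all
  have "atoms M D = atoms M C" using at by (auto simp: atoms_def)
  then have "pre_adm D" using C D by (simp add: admissible_def pre_adm_def)
  moreover have "integrable M (\<lambda>x. - ln (mass D x)) = integrable M (\<lambda>x. - ln (mass C x))"
    using at by (intro Bochner_Integration.integrable_cong) auto
  ultimately show "admissible D" using C by (simp add: admissible_def)
  show "ent D = ent C" unfolding ent_def using at by (intro Bochner_Integration.integral_cong) auto
qed

text \<open>The atoms of the initial segments decrease to those of \<open>C\<close>, and the
  information function of \<open>C\<close> dominates all the others.\<close>

lemma ent_initial_segments:
  assumes C: "admissible C" and c: "C = range c"
  shows "(\<lambda>n. ent (c ` {..<n})) \<longlonglongrightarrow> ent C"
  unfolding ent_def
proof (rule integral_dominated_convergence)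
  have ev: "c n \<in> events" for n using C c by (auto simp: admissible_def pre_adm_def)
  then have fin: "admissible (c ` {..<n})" for n by (intro admissible_finite) auto
  show "(\<lambda>x. - ln (mass C x)) \<in> borel_measurable M"
    "integrable M (\<lambda>x. - ln (mass C x))"
    "(\<lambda>x. - ln (mass (c ` {..<n}) x)) \<in> borel_measurable M" for n
    using admissible_integrable[OF C] admissible_integrable[OF fin] by blast+
  have lim: "(\<lambda>n. mass (c ` {..<n}) x) \<longlonglongrightarrow> mass C x" for x
  proof -
    have "(\<Inter>n. atom M (c ` {..<n}) x) = atom M C x"
      unfolding c atom_def same_def by (auto intro: lessI)
    moreover have "(\<lambda>n. prob (atom M (c ` {..<n}) x)) \<longlonglongrightarrow> prob (\<Inter>n. atom M (c ` {..<n}) x)"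
    proof (rule finite_Lim_measure_decseq)
      show "range (\<lambda>n. atom M (c ` {..<n}) x) \<subseteq> events" using fin by auto
      show "decseq (\<lambda>n. atom M (c ` {..<n}) x)"
        unfolding decseq_def atom_def same_def by auto
    qed
    ultimately show ?thesis by (simp add: mass_def)
  qed
  show "AE x in M. (\<lambda>n. - ln (mass (c ` {..<n}) x)) \<longlonglongrightarrow> - ln (mass C x)"
    using AE_mass_pos[OF admissible_pre[OF C]]
  proof eventually_elim
    case (elim x)
    then show ?case using lim[of x] by (intro tendsto_minus tendsto_ln) auto
  qed
  show "AE x in M. norm (- ln (mass (c ` {..<n}) x)) \<le> - ln (mass C x)" for n
    using AE_mass_pos[OF admissible_pre[OF C]]
  proof eventually_elim
    case (elim x)
    have "c ` {..<n} \<union> C = C" using c by auto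
    then have "mass C x \<le> mass (c ` {..<n}) x"
      using mass_Un_le[OF admissible_pre[OF fin] admissible_pre[OF C], of n x] by simp
    then show ?case using elim neg_ln_mass_nonneg[of "c ` {..<n}" x] by simp
  qed
qed

lemma shannon_entropy_atoms:
  assumes C: "pre_adm C"
  shows "shannon_entropy M (atoms M C) = enn2ereal (\<integral>\<^sup>+x. ennreal (- ln (mass C x)) \<partial>M)"
proof -
  note [measurable] = mass_measurable[OF C]
  have "(\<integral>\<^sup>+x. ennreal (- ln (mass C x)) * indicator P x \<partial>M) = ennreal (- prob P * ln (prob P))"
    if P: "P \<in> atoms M C" for P
  proof -
    have PM: "P \<in> events" using P atoms_events[OF C] by blast
    have "(\<integral>\<^sup>+x. ennreal (- ln (mass C x)) * indicator P x \<partial>M) =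
        (\<integral>\<^sup>+x. ennreal (- ln (prob P)) * indicator P x \<partial>M)"
    proof (rule nn_integral_cong)
      fix x
      show "ennreal (- ln (mass C x)) * indicator P x = ennreal (- ln (prob P)) * indicator P x"
      proof (cases "x \<in> P")
        case True
        then have "mass C x = prob P" using atom_eqI[OF P True] by (simp add: mass_def)
        then show ?thesis by simp
      qed simp
    qed
    also have "\<dots> = ennreal (- ln (prob P)) * ennreal (prob P)"
      using PM by (simp add: nn_integral_cmult_indicator emeasure_eq_measure)
    also have "\<dots> = ennreal (- ln (prob P) * prob P)"
    proof (rule ennreal_mult[symmetric])
      show "0 \<le> - ln (prob P)" by (cases "prob P = 0") (auto simp: zero_less_measure_iff)
    qed simp
    finally show ?thesis by (simp add: mult.commute)
  qed
  then have "(\<integral>\<^sup>+x. ennreal (- ln (mass C x)) \<partial>M) =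
      (\<integral>\<^sup>+P. ennreal (- prob P * ln (prob P)) \<partial>count_space (atoms M C))"
    by (subst nn_integral_atoms[OF C]) (auto intro!: nn_integral_cong)
  also have "\<dots> = infsum (\<lambda>P. ennreal (- prob P * ln (prob P))) (atoms M C)"
    using C by (intro infsum_eq_nn_integral_count_space[symmetric]) (simp add: pre_adm_def)
  finally show ?thesis by (simp add: shannon_entropy_def)
qed

lemma shannon_entropy_admissible:
  assumes "admissible C"
  shows "shannon_entropy M (atoms M C) = ereal (ent C)"
proof -
  have "0 \<le> ent C" unfolding ent_def by (rule Bochner_Integration.integral_nonneg) (rule neg_ln_mass_nonneg)
  then show ?thesis
    using assms by (simp add: shannon_entropy_atoms nn_integral_admissible enn2ereal_ennreal)
qed

lemma admissible_partition:
  assumes "countable_partition M \<alpha>" "shannon_entropy M \<alpha> < \<infinity>"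
  shows "admissible \<alpha>"
proof (rule admissibleI)
  have at: "atoms M \<alpha> = \<alpha>" using assms atoms_of_partition by (auto simp: countable_partition_def)
  then show pre: "pre_adm \<alpha>" using assms by (simp add: pre_adm_def countable_partition_def)
  have "enn2ereal (\<integral>\<^sup>+x. ennreal (- ln (mass \<alpha> x)) \<partial>M) < \<infinity>"
    using shannon_entropy_atoms[OF pre] assms(2) at by simp
  then show "(\<integral>\<^sup>+x. ennreal (- ln (mass \<alpha> x)) \<partial>M) < \<infinity>"
    by (cases "\<integral>\<^sup>+x. ennreal (- ln (mass \<alpha> x)) \<partial>M") (auto simp: enn2ereal_ennreal)
qed

end

section \<open>Generating collections\<close>

context coset_system
begin

lemma finite_subset_word_ball:
  assumes "finite F" "F \<subseteq> carrier G"
  shows "\<exists>n. F \<subseteq> word_ball G S n"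
  using assms
proof (induction F rule: finite_induct)
  case (insert g F)
  then obtain n where n: "F \<subseteq> word_ball G S n" by auto
  have "g \<in> word_value G ` words_over S" using insert.prems S_gen by simp
  then obtain w where w: "w \<in> words_over S" "g = word_value G w" by auto
  then have "g \<in> word_ball G S (max n (length w))" unfolding word_ball_def by auto
  moreover have "F \<subseteq> word_ball G S (max n (length w))"
    using n word_ball_mono[of n "max n (length w)" G S] by auto
  ultimately show ?case by blast
qed simp

lemma generates_word_ball:
  assumes \<alpha>: "generates (carrier G) \<alpha>" and C: "adm C" and \<epsilon>: "\<epsilon> > 0"
  shows "\<exists>k. hc C (orb (word_ball G S k) \<alpha>) < \<epsilon>"
proof -
  obtain F where F: "finite F" "F \<subseteq> carrier G" "hc C (orb F \<alpha>) < \<epsilon>" using generatesE[OF \<alpha> C \<epsilon>] .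
  obtain k where k: "F \<subseteq> word_ball G S k" using finite_subset_word_ball F by blast
  have "hc C (orb (word_ball G S k) \<alpha>) \<le> hc C (orb F \<alpha>)"
    using F C k word_ball_carrier generates_adm[OF \<alpha>] by (intro hc_antimono orb_adm orb_mono) auto
  then show ?thesis using F by (intro exI[of _ k]) simp
qed

text \<open>The hypothesis on \<beta> concerns the base coset only. For \<open>v = g <# K\<close>
  the translates of \<beta> by \<open>g \<otimes> f\<close> with \<open>f\<close> in
  \<open>K\<close> all occur in the expansion at \<open>v\<close>, and the problem is moved to the
  base coset by \<open>inv g\<close>.\<close>

lemma expand_capture:
  assumes \<gamma>: "family \<gamma>" and \<beta>: "generates K \<beta>" "\<beta> \<subseteq> \<gamma> K" and \<alpha>: "adm \<alpha>" and \<epsilon>: "\<epsilon> > 0"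
  shows "\<exists>n. \<forall>v\<in>V. hc \<alpha> (expand n \<gamma> v) < \<epsilon>"
proof -
  have "\<exists>n. hc \<alpha> (expand n \<gamma> v) < \<epsilon>" if v: "v \<in> V" for v
  proof -
    obtain g where g: "g \<in> carrier G" "v = g <# K" using v by (auto simp: V_iff)
    obtain F where F: "finite F" "F \<subseteq> K" "hc (T (inv g) ` \<alpha>) (orb F \<beta>) < \<epsilon>"
      using generatesE[OF \<beta>(1) _ \<epsilon>, of "T (inv g) ` \<alpha>"] \<alpha> g by auto
    have Fc: "F \<subseteq> carrier G" using F K_carrier by blast
    define F' where "F' = (\<lambda>f. g \<otimes> f) ` F"
    have F': "finite F'" "F' \<subseteq> carrier G" using F Fc g by (auto simp: F'_def)
    obtain n where n: "F' \<subseteq> word_ball G S n" using finite_subset_word_ball[OF F'] by blast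
    have adm: "adm \<beta>" "adm (orb F \<beta>)" "adm (expand n \<gamma> v)"
      using generates_adm[OF \<beta>(1)] F(1) Fc family_expand[OF \<gamma>] v by auto
    have "T g ` orb F \<beta> \<subseteq> expand n \<gamma> v"
    proof -
      have "T g ` T f ` \<beta> \<subseteq> expand n \<gamma> v" if f: "f \<in> F" for f
      proof -
        have fc: "f \<in> carrier G" "f \<in> K" using f F Fc by auto
        have "inv (g \<otimes> f) <# v = inv (g \<otimes> f) <# (g <# K)" using g by simp
        also have "\<dots> = (inv (g \<otimes> f) \<otimes> g) <# K"
          using lcos_m_assoc[OF K_carrier, of "inv (g \<otimes> f)" g] g fc by simp
        also have "inv (g \<otimes> f) \<otimes> g = inv f" using g fc by (simp add: inv_mult_group m_assoc)
        also have "inv f <# K = K"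
          using coset_join3[OF _ K_sub, of "inv f"] fc subgroup.m_inv_closed[OF K_sub] by simp
        finally have "inv (g \<otimes> f) <# v = K" .
        moreover have "g \<otimes> f \<in> word_ball G S n" using n f by (auto simp: F'_def)
        moreover have "T g ` T f ` \<beta> = T (g \<otimes> f) ` \<beta>" using adm g fc by (simp add: T_image_mult)
        ultimately show ?thesis using \<beta>(2) unfolding expand_def by fastforce
      qed
      then show ?thesis unfolding orb_def image_UN by blast
    qed
    then have "hc \<alpha> (expand n \<gamma> v) \<le> hc \<alpha> (T g ` orb F \<beta>)"
      using adm \<alpha> g by (intro hc_antimono) auto
    also have "\<dots> = hc (T g ` T (inv g) ` \<alpha>) (T g ` orb F \<beta>)"
      using \<alpha> g by (simp add: T_image_mult)
    also have "\<dots> = hc (T (inv g) ` \<alpha>) (orb F \<beta>)" using adm \<alpha> g by (intro hc_T) auto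
    also have "\<dots> < \<epsilon>" by (rule F(3))
    finally show ?thesis by blast
  qed
  then obtain n where n: "\<And>v. v \<in> V \<Longrightarrow> hc \<alpha> (expand (n v) \<gamma> v) < \<epsilon>" by metis
  have "hc \<alpha> (expand (Max (n ` V)) \<gamma> v) < \<epsilon>" if v: "v \<in> V" for v
  proof -
    have "n v \<le> Max (n ` V)" using v by (intro Max_ge) auto
    then have "hc \<alpha> (expand (Max (n ` V)) \<gamma> v) \<le> hc \<alpha> (expand (n v) \<gamma> v)"
      using v \<alpha> family_expand[OF \<gamma>] by (intro hc_antimono expand_mono) auto
    then show ?thesis using n[OF v] by simp
  qed
  then show ?thesis by blast
qed

end

context free_coset_system
begin

lemma index_times_Fval_le:
  assumes R: "R \<subseteq> K" "finite R" "\<one> \<notin> R" "word_value G ` words_over R = K"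
    and card: "int (card R) = int (card V) * (int (card S) - 1) + 1"
    and \<alpha>: "generates (carrier G) \<alpha>" and \<beta>: "generates K \<beta>" and \<epsilon>: "\<epsilon> > 0"
  shows "\<exists>k. card V * Fval (orb (word_ball G S k) \<alpha>) \<le> h \<beta> - (\<Sum>s\<in>R. J \<beta> s \<beta>) + \<epsilon>"
proof -
  obtain \<delta> where \<delta>: "family \<delta>" "\<beta> \<subseteq> \<delta> K" "Phi \<delta> \<le> h \<beta> - (\<Sum>s\<in>R. J \<beta> s \<beta>)"
    using rose_Phi(2)[OF R generates_adm[OF \<beta>] card] by blast
  have "\<exists>k. card V * Fval (orb (word_ball G S k) \<alpha>) \<le> Phi \<delta> + \<epsilon>"
    using generates_word_ball[OF \<alpha>] expand_capture[OF \<delta>(1) \<beta> \<delta>(2) generates_adm[OF \<alpha>]]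
    by (intro Phi_capture[OF \<delta>(1) generates_adm[OF \<alpha>] _ _ \<epsilon>])
  with \<delta>(3) show ?thesis by (meson add_right_mono order_trans)
qed

end

context schreier_tree
begin

text \<open>The \<open>\<tau> v\<close> represent the left cosets, so their inverses represent the
  right cosets; thus \<open>K\<close> together with these inverses reaches all of
  \<open>G\<close>.\<close>

lemma ex_coset_representation:
  assumes g: "g \<in> carrier G"
  shows "\<exists>k\<in>K. \<exists>v\<in>V. g = k \<otimes> inv (\<tau> v)"
proof -
  define v where "v = inv g <# K"
  have v: "v \<in> V" using g by (auto simp: v_def V_iff)
  have "\<tau> v \<in> v" using lcos_self[OF \<tau>_carrier[OF v] K_sub] v by simp
  then obtain k where k: "k \<in> K" "\<tau> v = inv g \<otimes> k" by (auto simp: v_def l_coset_def)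
  have kc: "k \<in> carrier G" using k K_carrier by blast
  have "g = k \<otimes> inv (\<tau> v)" using k kc g by (simp add: inv_mult_group m_assoc[symmetric])
  then show ?thesis using k v by blast
qed

lemma generates_union:
  assumes \<alpha>: "generates (carrier G) \<alpha>"
  shows "generates K (\<Union>v\<in>V. T (inv (\<tau> v)) ` \<alpha>)"
proof (rule generates_coarser[OF \<alpha>])
  have adm: "adm \<alpha>" using \<alpha> by (rule generates_adm)
  show \<beta>: "adm (\<Union>v\<in>V. T (inv (\<tau> v)) ` \<alpha>)" using adm by (intro adm_UN adm_T) auto
  fix g assume g: "g \<in> carrier G"
  obtain k v where k: "k \<in> K" and v: "v \<in> V" and gk: "g = k \<otimes> inv (\<tau> v)"
    using ex_coset_representation[OF g] by blast
  have kc: "k \<in> carrier G" using k K_carrier by blast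
  have "T g ` \<alpha> = T k ` T (inv (\<tau> v)) ` \<alpha>" using adm kc v gk by (simp add: T_image_mult)
  then have "T g ` \<alpha> \<subseteq> T k ` (\<Union>v\<in>V. T (inv (\<tau> v)) ` \<alpha>)" using v by blast
  then show "\<exists>k\<in>K. T g ` \<alpha> \<subseteq> T k ` (\<Union>v\<in>V. T (inv (\<tau> v)) ` \<alpha>)" using k by blast
qed auto

end

section \<open>Measure-preserving actions\<close>

locale pmp_system = prob_space M + group G for M :: "'x measure" and G :: "('g, 'b) monoid_scheme" (structure) +
  fixes \<phi> :: "'g \<Rightarrow> 'x \<Rightarrow> 'x"
  assumes pmp: "pmp_action G \<phi> M"
begin

sublocale action: group_action G "space M" \<phi>
  using pmp by (simp add: pmp_action_def)

lemma \<phi>_space [simp]: "g \<in> carrier G \<Longrightarrow> x \<in> space M \<Longrightarrow> \<phi> g x \<in> space M"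
  using action.element_image by blast

lemma \<phi>_mult: "g \<in> carrier G \<Longrightarrow> k \<in> carrier G \<Longrightarrow> x \<in> space M \<Longrightarrow> \<phi> (g \<otimes> k) x = \<phi> g (\<phi> k x)"
  using action.composition_rule by blast

lemma \<phi>_one [simp]: "x \<in> space M \<Longrightarrow> \<phi> \<one> x = x"
  using action.id_eq_one by (metis restrict_apply')

lemma \<phi>_inv [simp]:
  "g \<in> carrier G \<Longrightarrow> x \<in> space M \<Longrightarrow> \<phi> g (\<phi> (inv g) x) = x"
  "g \<in> carrier G \<Longrightarrow> x \<in> space M \<Longrightarrow> \<phi> (inv g) (\<phi> g x) = x"
  using \<phi>_mult[of g "inv g" x] \<phi>_mult[of "inv g" g x] by simp_all

lemma \<phi>_image:
  assumes "g \<in> carrier G" "A \<subseteq> space M"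
  shows "\<phi> g ` A = \<phi> (inv g) -` A \<inter> space M"
proof (intro subset_antisym subsetI)
  fix x assume "x \<in> \<phi> g ` A"
  then obtain y where "y \<in> A" "x = \<phi> g y" by blast
  moreover have "y \<in> space M" using \<open>y \<in> A\<close> assms(2) by blast
  ultimately show "x \<in> \<phi> (inv g) -` A \<inter> space M" using assms(1) by simp
next
  fix x assume "x \<in> \<phi> (inv g) -` A \<inter> space M"
  then have "\<phi> (inv g) x \<in> A" "x = \<phi> g (\<phi> (inv g) x)" using assms(1) by simp_all
  then show "x \<in> \<phi> g ` A" by blast
qed

lemma mem_\<phi>_image:
  assumes "g \<in> carrier G" "A \<subseteq> space M" "x \<in> space M"
  shows "x \<in> \<phi> g ` A \<longleftrightarrow> \<phi> (inv g) x \<in> A"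
  using assms by (simp add: \<phi>_image)

lemma \<phi>_measurable: "g \<in> carrier G \<Longrightarrow> \<phi> g \<in> measurable M M"
  and \<phi>_distr: "g \<in> carrier G \<Longrightarrow> distr M M (\<phi> g) = M"
  using pmp by (auto simp: pmp_action_def)

lemma \<phi>_image_events:
  assumes "g \<in> carrier G" "A \<in> events"
  shows "\<phi> g ` A \<in> events"
  unfolding \<phi>_image[OF assms(1) sets.sets_into_space[OF assms(2)]]
  using \<phi>_measurable[of "inv g"] assms by (auto intro: measurable_sets)

lemma prob_\<phi>_image:
  assumes "g \<in> carrier G" "A \<in> events"
  shows "prob (\<phi> g ` A) = prob A"
proof -
  have "prob A = measure (distr M M (\<phi> (inv g))) A" using \<phi>_distr assms(1) by simp
  also have "\<dots> = prob (\<phi> (inv g) -` A \<inter> space M)"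
    using \<phi>_measurable[of "inv g"] assms by (intro measure_distr) auto
  finally show ?thesis using \<phi>_image[OF assms(1) sets.sets_into_space[OF assms(2)]] by simp
qed

definition T :: "'g \<Rightarrow> 'x set \<Rightarrow> 'x set" where
  "T g A = \<phi> g ` A"

lemma translate_eq: "translate \<phi> g C = T g ` C"
  by (simp add: translate_def T_def)

lemma same_T:
  assumes "g \<in> carrier G" "C \<subseteq> events" "x \<in> space M" "y \<in> space M"
  shows "same (T g ` C) x y \<longleftrightarrow> same C (\<phi> (inv g) x) (\<phi> (inv g) y)"
proof -
  have "z \<in> T g A \<longleftrightarrow> \<phi> (inv g) z \<in> A" if "A \<in> C" "z \<in> space M" for A z
  proof -
    have "A \<subseteq> space M" using that assms(2) sets.sets_into_space by blast
    then show ?thesis unfolding T_def using mem_\<phi>_image assms(1) that by blast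
  qed
  then show ?thesis using assms unfolding same_def by simp
qed

lemma atom_T:
  assumes "g \<in> carrier G" "C \<subseteq> events" "x \<in> space M"
  shows "atom M (T g ` C) x = T g (atom M C (\<phi> (inv g) x))"
proof (intro subset_antisym subsetI)
  fix y assume "y \<in> atom M (T g ` C) x"
  then have "\<phi> (inv g) y \<in> atom M C (\<phi> (inv g) x)" "y = \<phi> g (\<phi> (inv g) y)"
    using same_T[OF assms, of y] assms(1) by (simp_all add: atom_def)
  then show "y \<in> T g (atom M C (\<phi> (inv g) x))" unfolding T_def by blast
next
  fix y assume "y \<in> T g (atom M C (\<phi> (inv g) x))"
  then obtain z where z: "y = \<phi> g z" "z \<in> space M" "same C (\<phi> (inv g) x) z"
    unfolding T_def atom_def by blast
  then show "y \<in> atom M (T g ` C) x"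
    using same_T[OF assms, of y] assms(1) by (simp add: atom_def)
qed

lemma T_events: "g \<in> carrier G \<Longrightarrow> C \<subseteq> events \<Longrightarrow> T g ` C \<subseteq> events"
  using \<phi>_image_events by (auto simp: T_def)

lemma pre_adm_T:
  assumes g: "g \<in> carrier G" and C: "pre_adm C"
  shows "pre_adm (T g ` C)"
proof -
  have ev: "C \<subseteq> events" "countable C" "countable (atoms M C)" using C by (auto simp: pre_adm_def)
  have "atoms M (T g ` C) \<subseteq> T g ` atoms M C"
    unfolding atoms_def using atom_T[OF g ev(1)] g by auto
  then have "countable (atoms M (T g ` C))" using ev(3) by (meson countable_image countable_subset)
  then show ?thesis using ev T_events[OF g ev(1)] by (simp add: pre_adm_def)
qed

lemma mass_T:
  assumes g: "g \<in> carrier G" and C: "pre_adm C" and x: "x \<in> space M"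
  shows "mass (T g ` C) x = mass C (\<phi> (inv g) x)"
proof -
  have ev: "C \<subseteq> events" using C by (simp add: pre_adm_def)
  show ?thesis unfolding mass_def atom_T[OF g ev x]
    using prob_\<phi>_image[OF g atom_events[OF C]] by (simp add: T_def)
qed

lemma admissible_T: "admissible (T g ` C)" and ent_T: "ent (T g ` C) = ent C"
  if C: "admissible C" and g: "g \<in> carrier G"
proof -
  have pre: "pre_adm C" using C by simp
  have ig: "inv g \<in> carrier G" using g by simp
  have eq: "ln (mass (T g ` C) x) = ln (mass C (\<phi> (inv g) x))" if "x \<in> space M" for x
    using mass_T[OF g pre that] by simp
  have int: "integrable (distr M M (\<phi> (inv g))) (\<lambda>x. - ln (mass C x))"
    using admissible_integrable[OF C] \<phi>_distr[OF ig] by simp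
  have "integrable M (\<lambda>x. - ln (mass C (\<phi> (inv g) x)))"
    using integrable_distr[OF \<phi>_measurable[OF ig] int] .
  then have "integrable M (\<lambda>x. - ln (mass (T g ` C) x))"
    using eq by (simp cong: Bochner_Integration.integrable_cong)
  then show "admissible (T g ` C)" using pre_adm_T[OF g pre] by (simp add: admissible_def)
  have "ent C = (\<integral>x. - ln (mass C x) \<partial>distr M M (\<phi> (inv g)))"
    using \<phi>_distr[OF ig] by (simp add: ent_def)
  also have "\<dots> = (\<integral>x. - ln (mass C (\<phi> (inv g) x)) \<partial>M)"
    using \<phi>_measurable[OF ig] borel_measurable_integrable[OF admissible_integrable[OF C]]
    by (intro integral_distr)
  also have "\<dots> = ent (T g ` C)"
    unfolding ent_def using eq by (intro Bochner_Integration.integral_cong) auto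
  finally show "ent (T g ` C) = ent C" by simp
qed

sublocale entropy_system G T events admissible ent
proof unfold_locales
  fix g k A assume *: "g \<in> carrier G" "k \<in> carrier G" "A \<in> events"
  have "\<phi> g (\<phi> k x) = \<phi> (g \<otimes> k) x" if "x \<in> A" for x
    using that * sets.sets_into_space[OF *(3)] \<phi>_mult by (metis subsetD)
  then show "T g (T k A) = T (g \<otimes> k) A" unfolding T_def image_image by (intro image_cong) auto
next
  fix A assume *: "A \<in> events"
  have "\<phi> \<one> x = x" if "x \<in> A" for x using that sets.sets_into_space[OF *] by auto
  then show "T \<one> A = A" unfolding T_def by simp
next
  show "admissible C \<Longrightarrow> C \<subseteq> events" for C by (simp add: admissible_def pre_adm_def)
qed (simp_all add: admissible_empty admissible_Un admissible_T ent_T ent_mono_Un ent_submod ent_empty)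

section \<open>Generating partitions in terms of conditional entropy\<close>

lemma hc_determined:
  assumes "admissible C" "admissible D" "admissible E"
    and "\<And>x y. x \<in> space M \<Longrightarrow> y \<in> space M \<Longrightarrow> same D x y \<Longrightarrow> same E x y \<Longrightarrow> same C x y"
  shows "hc C E \<le> hc D E"
proof -
  have 1: "admissible (D \<union> E)" "admissible (C \<union> (D \<union> E))" using assms by (simp_all add: admissible_Un)
  have "ent (C \<union> (D \<union> E)) = ent (D \<union> E)"
    using 1 assms(4) by (intro admissible_cong(2)) (auto simp: same_Un admissible_def pre_adm_def)
  moreover have "ent (C \<union> E) \<le> ent (C \<union> (D \<union> E))"
    using assms 1 by (intro h_mono) (auto simp: admissible_Un)
  ultimately show ?thesis by (simp add: hc_def)
qed

text \<open>The sets \<open>A\<close> with \<open>approx \<alpha> {A}\<close> form an invariant \<open>\<sigma>\<close>-algebra, closed under changes on null sets,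
  which contains \<open>\<alpha>\<close>.\<close>

definition approx :: "'x set set \<Rightarrow> 'x set set \<Rightarrow> bool" where
  "approx \<alpha> C \<longleftrightarrow> admissible C \<and>
     (\<forall>\<epsilon>>0. \<exists>F. finite F \<and> F \<subseteq> carrier G \<and> hc C (orb F \<alpha>) < \<epsilon>)"

lemma approxE:
  assumes "approx \<alpha> C" "\<epsilon> > 0"
  obtains F where "finite F" "F \<subseteq> carrier G" "hc C (orb F \<alpha>) < \<epsilon>"
  using assms unfolding approx_def by blast

lemma approx_admissible: "approx \<alpha> C \<Longrightarrow> admissible C"
  by (simp add: approx_def)

lemma approx_Un:
  assumes \<alpha>: "admissible \<alpha>" and C: "approx \<alpha> C" and D: "approx \<alpha> D"
  shows "approx \<alpha> (C \<union> D)"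
  unfolding approx_def
proof (intro conjI allI impI)
  have adm: "admissible C" "admissible D" using C D approx_admissible by auto
  then show "admissible (C \<union> D)" by (rule admissible_Un)
  fix \<epsilon> :: real assume "\<epsilon> > 0"
  then have \<epsilon>: "\<epsilon> / 2 > 0" by simp
  obtain F where F: "finite F" "F \<subseteq> carrier G" "hc C (orb F \<alpha>) < \<epsilon> / 2" using approxE[OF C \<epsilon>] .
  obtain E where E: "finite E" "E \<subseteq> carrier G" "hc D (orb E \<alpha>) < \<epsilon> / 2" using approxE[OF D \<epsilon>] .
  have FE: "finite (F \<union> E)" "F \<union> E \<subseteq> carrier G" using F E by auto
  have "hc (C \<union> D) (orb (F \<union> E) \<alpha>) \<le> hc C (orb (F \<union> E) \<alpha>) + hc D (orb (F \<union> E) \<alpha>)"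
    using adm FE \<alpha> by (intro hc_Un_le orb_adm)
  moreover have "hc C (orb (F \<union> E) \<alpha>) \<le> hc C (orb F \<alpha>)"
    using adm FE F \<alpha> by (intro hc_antimono orb_adm orb_mono) auto
  moreover have "hc D (orb (F \<union> E) \<alpha>) \<le> hc D (orb E \<alpha>)"
    using adm FE E \<alpha> by (intro hc_antimono orb_adm orb_mono) auto
  ultimately have "hc (C \<union> D) (orb (F \<union> E) \<alpha>) < \<epsilon>" using F E by linarith
  then show "\<exists>F. finite F \<and> F \<subseteq> carrier G \<and> hc (C \<union> D) (orb F \<alpha>) < \<epsilon>" using FE by blast
qed

lemma approx_limit:
  assumes \<alpha>: "admissible \<alpha>" and C: "admissible C"
    and lim: "\<And>\<epsilon>. \<epsilon> > 0 \<Longrightarrow> \<exists>D. approx \<alpha> D \<and> hc C D < \<epsilon>"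
  shows "approx \<alpha> C"
  unfolding approx_def
proof (intro conjI allI impI)
  fix \<epsilon> :: real assume "\<epsilon> > 0"
  then have \<epsilon>: "\<epsilon> / 2 > 0" by simp
  obtain D where D: "approx \<alpha> D" "hc C D < \<epsilon> / 2" using lim[OF \<epsilon>] by blast
  obtain F where F: "finite F" "F \<subseteq> carrier G" "hc D (orb F \<alpha>) < \<epsilon> / 2" using approxE[OF D(1) \<epsilon>] .
  have "hc C (orb F \<alpha>) \<le> hc C D + hc D (orb F \<alpha>)"
    using C approx_admissible[OF D(1)] F \<alpha> by (intro hc_trans orb_adm)
  then show "\<exists>F. finite F \<and> F \<subseteq> carrier G \<and> hc C (orb F \<alpha>) < \<epsilon>"
    using D F by (intro exI[of _ F]) auto
qed (fact C)

lemma approx_determined: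
  assumes \<alpha>: "admissible \<alpha>" and D: "approx \<alpha> D" and C: "admissible C"
    and det: "\<And>x y. x \<in> space M \<Longrightarrow> y \<in> space M \<Longrightarrow> same D x y \<Longrightarrow> same C x y"
  shows "approx \<alpha> C"
proof (rule approx_limit[OF \<alpha> C])
  fix \<epsilon> :: real assume \<epsilon>: "\<epsilon> > 0"
  have "hc C D \<le> hc D D" using approx_admissible[OF D] C det by (intro hc_determined)
  then have "hc C D < \<epsilon>" using \<epsilon> by (simp add: hc_def)
  then show "\<exists>D. approx \<alpha> D \<and> hc C D < \<epsilon>" using D by blast
qed

lemma approx_self:
  assumes "admissible \<alpha>"
  shows "approx \<alpha> \<alpha>"
proof -
  have "hc \<alpha> (orb {\<one>} \<alpha>) = 0" using assms by (simp add: orb_def hc_def)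
  then show ?thesis unfolding approx_def using assms by (metis empty_subsetI finite.emptyI finite.insertI insert_subset one_closed)
qed

lemma approx_T:
  assumes \<alpha>: "admissible \<alpha>" and C: "approx \<alpha> C" and g: "g \<in> carrier G"
  shows "approx \<alpha> (T g ` C)"
  unfolding approx_def
proof (intro conjI allI impI)
  show "admissible (T g ` C)" using approx_admissible[OF C] g by (rule admissible_T)
  fix \<epsilon> :: real assume "\<epsilon> > 0"
  then obtain F where F: "finite F" "F \<subseteq> carrier G" "hc C (orb F \<alpha>) < \<epsilon>" using approxE[OF C] by blast
  have "T g ` orb F \<alpha> = orb ((\<lambda>f. g \<otimes> f) ` F) \<alpha>"
  proof -
    have "T g ` T f ` \<alpha> = T (g \<otimes> f) ` \<alpha>" if "f \<in> F" for f
      using that F g \<alpha> by (intro T_image_mult) auto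
    then show ?thesis unfolding orb_def image_UN by simp
  qed
  then have "hc (T g ` C) (orb ((\<lambda>f. g \<otimes> f) ` F) \<alpha>) < \<epsilon>"
    using hc_T[OF approx_admissible[OF C] orb_adm[OF F(1,2) \<alpha>] g] F(3) by simp
  moreover have "(\<lambda>f. g \<otimes> f) ` F \<subseteq> carrier G" using F g by auto
  ultimately show "\<exists>F. finite F \<and> F \<subseteq> carrier G \<and> hc (T g ` C) (orb F \<alpha>) < \<epsilon>"
    using F(1) by (intro exI[of _ "(\<lambda>f. g \<otimes> f) ` F"]) simp
qed

lemma approx_empty: "admissible \<alpha> \<Longrightarrow> approx \<alpha> {}"
  by (rule approx_determined[OF _ approx_self]) (auto simp: same_def admissible_empty)

lemma approx_finite:
  assumes "admissible \<alpha>" "finite C" "\<And>A. A \<in> C \<Longrightarrow> approx \<alpha> {A}"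
  shows "approx \<alpha> C"
  using assms(2,3)
proof (induction C rule: finite_induct)
  case (insert A C)
  then show ?case using approx_Un[OF assms(1), of "{A}" C] by simp
qed (simp add: approx_empty assms(1))

lemma approx_sigma_algebra:
  assumes \<alpha>: "admissible \<alpha>"
  shows "sigma_algebra (space M) {A \<in> events. approx \<alpha> {A}}"
  unfolding sigma_algebra_iff2
proof (intro conjI ballI allI impI)
  show "{A \<in> events. approx \<alpha> {A}} \<subseteq> Pow (space M)" using sets.sets_into_space by blast
  have "approx \<alpha> {{}}"
    by (rule approx_determined[OF \<alpha> approx_self[OF \<alpha>]]) (auto simp: same_def admissible_singleton)
  then show "{} \<in> {A \<in> events. approx \<alpha> {A}}" by simp
next
  fix A assume A: "A \<in> {A \<in> events. approx \<alpha> {A}}"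
  then have "approx \<alpha> {space M - A}"
    using admissible_singleton(1)[of "space M - A"]
    by (elim CollectE conjE) (rule approx_determined[OF \<alpha>, of "{A}"], auto simp: same_def)
  then show "space M - A \<in> {A \<in> events. approx \<alpha> {A}}" using A by auto
next
  fix A :: "nat \<Rightarrow> 'x set" assume A: "range A \<subseteq> {A \<in> events. approx \<alpha> {A}}"
  then have Aev: "A n \<in> events" and Aap: "approx \<alpha> {A n}" for n by auto
  define U where "U = (\<Union>n. A n)"
  \<comment> \<open>The part of the union not covered by the first \<open>n\<close> sets. It
    decreases to the empty set, so its entropy tends to 0, and together with those \<open>n\<close>
    sets it determines the union.\<close>
  define B where "B n = U - (\<Union>i<n. A i)" for n
  have Uev: "U \<in> events" using Aev by (auto simp: U_def)
  have Bev: "B n \<in> events" for n using Aev Uev by (auto simp: B_def)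
  have "(\<lambda>n. prob (B n)) \<longlonglongrightarrow> prob (\<Inter>n. B n)"
  proof (rule finite_Lim_measure_decseq)
    show "range B \<subseteq> events" using Bev by auto
    show "decseq B" unfolding decseq_def B_def by fastforce
  qed
  moreover have "(\<Inter>n. B n) = {}" unfolding B_def U_def by auto
  ultimately have "(\<lambda>n. prob (B n)) \<longlonglongrightarrow> 0" by simp
  then have lim: "(\<lambda>n. 2 * sqrt (prob (B n)) + prob (B n)) \<longlonglongrightarrow> 0"
    by (auto intro!: tendsto_eq_intros)
  have "approx \<alpha> {U}"
  proof (rule approx_limit[OF \<alpha> admissible_singleton(1)[OF Uev]])
    fix \<epsilon> :: real assume "\<epsilon> > 0"
    from order_tendstoD(2)[OF lim this] obtain n where n: "2 * sqrt (prob (B n)) + prob (B n) < \<epsilon>"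
      by (auto simp: eventually_sequentially)
    define D where "D = A ` {..<n}"
    have D: "approx \<alpha> D" unfolding D_def by (rule approx_finite[OF \<alpha>]) (use Aap in auto)
    have "hc {U} D \<le> hc {B n} D"
    proof (rule hc_determined)
      fix x y assume "same {B n} x y" "same D x y"
      then have "x \<in> B n \<longleftrightarrow> y \<in> B n" "\<And>i. i < n \<Longrightarrow> x \<in> A i \<longleftrightarrow> y \<in> A i"
        by (simp_all add: same_def D_def)
      then show "same {U} x y" unfolding same_def B_def U_def by auto
    qed (use admissible_singleton(1) Uev Bev approx_admissible[OF D] in auto)
    also have "\<dots> \<le> ent {B n}"
      using admissible_singleton(1)[OF Bev] approx_admissible[OF D] by (rule hc_le_h)
    also have "\<dots> \<le> 2 * sqrt (prob (B n)) + prob (B n)" using Bev by (rule ent_singleton_le)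
    finally show "\<exists>D. approx \<alpha> D \<and> hc {U} D < \<epsilon>" using n D by (intro exI[of _ D]) auto
  qed
  then show "(\<Union>n. A n) \<in> {A \<in> events. approx \<alpha> {A}}" using Uev by (simp add: U_def)
qed

text \<open>Minimality places the invariant \<sigma>-algebra among the approximable sets, and
  changes on null sets cost no entropy. A countable collection is then the entropy limit of its
  finite initial segments.\<close>

lemma generating_partition_generates:
  assumes gen: "generating_partition G \<phi> M \<alpha>" and \<alpha>: "admissible \<alpha>"
  shows "generates (carrier G) \<alpha>"
proof -
  define \<S> where "\<S> = {A \<in> events. approx \<alpha> {A}}"
  have "invariant_sigma_algebra G \<phi> M \<alpha> \<subseteq> \<S>"
    unfolding invariant_sigma_algebra_def
  proof (intro Inter_lower CollectI conjI ballI)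
    show "sigma_algebra (space M) \<S>" unfolding \<S>_def by (rule approx_sigma_algebra[OF \<alpha>])
    show "\<alpha> \<subseteq> \<S>"
    proof
      fix A assume A: "A \<in> \<alpha>"
      then have ev: "A \<in> events" using \<alpha> by (auto simp: admissible_def pre_adm_def)
      have "approx \<alpha> {A}"
        by (rule approx_determined[OF \<alpha> approx_self[OF \<alpha>]])
          (use A admissible_singleton(1)[OF ev] in \<open>auto simp: same_def\<close>)
      then show "A \<in> \<S>" using ev by (simp add: \<S>_def)
    qed
    fix g A assume "g \<in> carrier G" "A \<in> \<S>"
    then show "\<phi> g ` A \<in> \<S>"
      using approx_T[OF \<alpha>, of "{A}" g] \<phi>_image_events by (simp add: \<S>_def T_def)
  qed
  moreover have "approx \<alpha> {A}" if A: "A \<in> events" and B: "B \<in> \<S>" "(A - B) \<union> (B - A) \<in> null_sets M" for A B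
  proof (rule approx_limit[OF \<alpha> admissible_singleton(1)[OF A]])
    fix \<epsilon> :: real assume \<epsilon>: "\<epsilon> > 0"
    define N where "N = (A - B) \<union> (B - A)"
    have N: "N \<in> events" "prob N = 0" using B(2) by (auto simp: N_def measure_eq_0_null_sets)
    have "hc {A} {B} \<le> hc {N} {B}"
    proof (rule hc_determined)
      fix x y assume "same {N} x y" "same {B} x y"
      then show "same {A} x y" unfolding same_def N_def by auto
    qed (use A B N admissible_singleton(1) in \<open>auto simp: \<S>_def\<close>)
    also have "\<dots> \<le> ent {N}"
      using N B admissible_singleton(1) by (intro hc_le_h) (auto simp: \<S>_def)
    also have "\<dots> \<le> 0" using ent_singleton_le[OF N(1)] N(2) by simp
    finally show "\<exists>D. approx \<alpha> D \<and> hc {A} D < \<epsilon>" using \<epsilon> B by (intro exI[of _ "{B}"]) (auto simp: \<S>_def)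
  qed
  ultimately have single: "approx \<alpha> {A}" if "A \<in> events" for A
    using gen that unfolding generating_partition_def by blast
  have "approx \<alpha> C" if C: "admissible C" for C
  proof (cases "C = {}")
    case True
    then show ?thesis using approx_empty[OF \<alpha>] by simp
  next
    case False
    have Cc: "countable C" "C \<subseteq> events" using C by (auto simp: admissible_def pre_adm_def)
    define c where "c = from_nat_into C"
    have c: "C = range c" unfolding c_def using False Cc by (simp add: range_from_nat_into)
    show ?thesis
    proof (rule approx_limit[OF \<alpha> C])
      fix \<epsilon> :: real assume "\<epsilon> > 0"
      then have "ent C - \<epsilon> < ent C" by simp
      from order_tendstoD(1)[OF ent_initial_segments[OF C c] this] obtain n
        where n: "ent C - \<epsilon> < ent (c ` {..<n})" by (auto simp: eventually_sequentially)
      have "approx \<alpha> (c ` {..<n})" by (rule approx_finite[OF \<alpha>]) (use single Cc c in auto)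
      moreover have "C \<union> c ` {..<n} = C" using c by auto
      ultimately show "\<exists>D. approx \<alpha> D \<and> hc C D < \<epsilon>"
        using n by (intro exI[of _ "c ` {..<n}"]) (simp add: hc_def)
    qed
  qed
  then show ?thesis using \<alpha> unfolding generates_def approx_def by blast
qed

end

section \<open>The f-invariant of subgroups of finite index\<close>

lemma (in group) inv_image_r_coset:
  assumes H: "subgroup H G" and g: "g \<in> carrier G"
  shows "(\<lambda>x. inv x) ` (H #> g) = inv g <# H"
proof (intro subset_antisym subsetI)
  fix x assume "x \<in> (\<lambda>x. inv x) ` (H #> g)"
  then obtain y where y: "y \<in> H" "x = inv (y \<otimes> g)" by (auto simp: r_coset_def)
  have "y \<in> carrier G" using y(1) subgroup.subset[OF H] by blast
  then have "x = inv g \<otimes> inv y" using y g by (simp add: inv_mult_group)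
  moreover have "inv y \<in> H" using y H by (simp add: subgroup.m_inv_closed)
  ultimately show "x \<in> inv g <# H" by (auto simp: l_coset_def)
next
  fix x assume "x \<in> inv g <# H"
  then obtain y where y: "y \<in> H" "x = inv g \<otimes> y" by (auto simp: l_coset_def)
  have yc: "y \<in> carrier G" using y(1) subgroup.subset[OF H] by blast
  have "x = inv (inv y \<otimes> g)" using y yc g by (simp add: inv_mult_group)
  moreover have "inv y \<in> H" using y H by (simp add: subgroup.m_inv_closed)
  ultimately show "x \<in> (\<lambda>x. inv x) ` (H #> g)" by (auto simp: r_coset_def)
qed

text \<open>The index is counted with right cosets, whereas the vertices of the Schreier graph are
  left cosets.\<close>

lemma (in group) bij_betw_rcosets_lcosets:
  assumes H: "subgroup H G"
  shows "bij_betw (\<lambda>A. (\<lambda>x. inv x) ` A) (rcosets H) (lcosets H)"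
proof (rule bij_betw_imageI)
  show "inj_on (\<lambda>A. (\<lambda>x. inv x) ` A) (rcosets H)"
  proof (rule inj_onI)
    fix A B assume AB: "A \<in> rcosets H" "B \<in> rcosets H" "(\<lambda>x. inv x) ` A = (\<lambda>x. inv x) ` B"
    have sub: "A \<subseteq> carrier G" "B \<subseteq> carrier G"
      using AB(1,2) rcosets_part_G[OF H] by blast+
    have id: "(\<lambda>x. inv x) ` (\<lambda>x. inv x) ` C = C" if "C \<subseteq> carrier G" for C
    proof -
      have "(\<lambda>x. inv (inv x)) ` C = (\<lambda>x. x) ` C"
        by (rule image_cong[OF refl], rule inv_inv, rule subsetD[OF that])
      then show ?thesis by (simp only: image_image image_ident)
    qed
    have "(\<lambda>x. inv x) ` (\<lambda>x. inv x) ` A = (\<lambda>x. inv x) ` (\<lambda>x. inv x) ` B"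
      by (simp only: AB(3))
    then show "A = B" by (simp only: id[OF sub(1)] id[OF sub(2)])
  qed
  show "(\<lambda>A. (\<lambda>x. inv x) ` A) ` (rcosets H) = lcosets H"
  proof (intro subset_antisym subsetI)
    fix B assume "B \<in> (\<lambda>A. (\<lambda>x. inv x) ` A) ` (rcosets H)"
    then obtain g where "g \<in> carrier G" "B = (\<lambda>x. inv x) ` (H #> g)" by (auto simp: RCOSETS_def)
    then show "B \<in> lcosets H" using inv_image_r_coset[OF H] by (auto simp: LCOSETS_def)
  next
    fix B assume "B \<in> lcosets H"
    then obtain g where g: "g \<in> carrier G" "B = g <# H" by (auto simp: LCOSETS_def)
    then have "B = (\<lambda>x. inv x) ` (H #> inv g)" using inv_image_r_coset[OF H, of "inv g"] by simp
    moreover have "H #> inv g \<in> rcosets H" using g by (auto simp: RCOSETS_def)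
    ultimately show "B \<in> (\<lambda>A. (\<lambda>x. inv x) ` A) ` (rcosets H)" by blast
  qed
qed

lemma (in group) word_value_subgroup:
  assumes H: "subgroup H G" and R: "R \<subseteq> H" and w: "w \<in> words_over R"
  shows "word_value (G\<lparr>carrier := H\<rparr>) w = word_value G w"
  using w
proof (induction w)
  case (Cons l w)
  then have "snd l \<in> H" using R by auto
  then have "letter_value (G\<lparr>carrier := H\<rparr>) l = letter_value G l"
    using H by (simp add: letter_value_def)
  then show ?case using Cons by simp
qed simp

lemma (in schreier_tree) free_generating_set_basis:
  "free_generating_set (G\<lparr>carrier := K\<rparr>) basis"
  unfolding free_generating_set_def
proof (intro conjI ballI impI)
  show "basis \<subseteq> carrier (G\<lparr>carrier := K\<rparr>)" using basis_K by simp
  show "generate (G\<lparr>carrier := K\<rparr>) basis = carrier (G\<lparr>carrier := K\<rparr>)"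
    using generate_consistent[OF basis_K K_sub] generate_basis by simp
  fix w assume "w \<in> words_over basis" "reduced_word w \<and> w \<noteq> []"
  then show "word_value (G\<lparr>carrier := K\<rparr>) w \<noteq> \<one>\<^bsub>G\<lparr>carrier := K\<rparr>\<^esub>"
    using word_value_subgroup[OF K_sub basis_K] basis_free by simp
qed

section \<open>Limits of the functional and independence of the choices\<close>

context pmp_system
begin

text \<open>\<open>T\<close> and \<open>ent\<close> depend only on the action maps and the measure,
  so results for the subgroup speak of the same quantities as those for \<open>G\<close>.\<close>

lemma pmp_system_subgroup:
  assumes H: "subgroup H G"
  shows "pmp_system M (G\<lparr>carrier := H\<rparr>) \<phi>"
proof -
  have sub: "H \<subseteq> carrier G" using H by (rule subgroup.subset)
  have grp: "Group.group (G\<lparr>carrier := H\<rparr>)" using subgroup.subgroup_is_group[OF H is_group] .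
  have "group_hom G (BijGroup (space M)) \<phi>" using action.group_hom .
  then have "group_hom (G\<lparr>carrier := H\<rparr>) (BijGroup (space M)) \<phi>"
    using sub grp by (auto simp: group_hom_def group_hom_axioms_def hom_def Pi_def subset_iff)
  then have "group_action (G\<lparr>carrier := H\<rparr>) (space M) \<phi>" by (simp add: group_action_def)
  then have "pmp_action (G\<lparr>carrier := H\<rparr>) \<phi> M"
    using pmp sub by (auto simp: pmp_action_def)
  then show ?thesis
    using grp prob_space_axioms by (simp add: pmp_system_def pmp_system_axioms_def)
qed

lemma free_coset_systemI:
  assumes S: "free_generating_set G S" "finite S" and K: "subgroup K G" "finite (lcosets K)"
  shows "free_coset_system G T events admissible ent S K"
proof -
  interpret free_basis G S using S by unfold_locales
  interpret K: subgroup K G by fact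
  show ?thesis
  proof unfold_locales
    show "word_value G ` words_over S = carrier G" by (rule words_onto)
  qed (use S K in auto)
qed

lemma lcosets_carrier_eq: "lcosets (carrier G) = {carrier G}"
proof -
  have "g <# carrier G = carrier G" if "g \<in> carrier G" for g
    using coset_join3[OF that subgroup_self that] .
  then show ?thesis by (auto simp: LCOSETS_def)
qed

lemma free_coset_system_whole:
  assumes S: "free_generating_set G S" "finite S"
  shows "free_coset_system G T events admissible ent S (carrier G)"
  using S by (intro free_coset_systemI subgroup_self) (simp_all add: lcosets_carrier_eq)

definition FS :: "'g set \<Rightarrow> 'x set set \<Rightarrow> real" where
  "FS S C = ent C - (\<Sum>s\<in>S. J C s C)"

text \<open>The sequence decreases, so this is its limit; as an infimum it can be estimated term by
  term from either side.\<close>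

definition flim :: "'g set \<Rightarrow> 'x set set \<Rightarrow> ereal" where
  "flim S \<alpha> = (INF n. ereal (FS S (orb (word_ball G S n) \<alpha>)))"

lemma word_ball_props:
  assumes "free_generating_set G S" "finite S"
  shows "finite (word_ball G S n)" "word_ball G S n \<subseteq> carrier G" "\<one> \<in> word_ball G S n"
proof -
  interpret free_coset_system G T events admissible ent S "carrier G"
    using assms by (rule free_coset_system_whole)
  show "finite (word_ball G S n)" "word_ball G S n \<subseteq> carrier G"
    using word_ball_carrier by simp_all
  show "\<one> \<in> word_ball G S n" using word_ball_mono[of 0 n G S] by auto
qed

lemma FS_convergent:
  assumes S: "free_generating_set G S" "finite S" and \<alpha>: "admissible \<alpha>"
  shows "(\<lambda>n. ereal (FS S (orb (word_ball G S n) \<alpha>))) \<longlonglongrightarrow> flim S \<alpha>"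
  unfolding flim_def
proof (intro LIMSEQ_INF decseq_SucI)
  interpret C: free_coset_system G T events admissible ent S "carrier G"
    using S by (rule free_coset_system_whole)
  fix n
  have "C.family (\<lambda>_. \<alpha>)" using \<alpha> by (simp add: C.family_def)
  from C.Phi_expand_antimono[OF this, of n]
  have "C.Phi (\<lambda>_. orb (word_ball G S (Suc n)) \<alpha>) \<le> C.Phi (\<lambda>_. orb (word_ball G S n) \<alpha>)"
    by (simp add: C.expand_def[abs_def] orb_def)
  then show "ereal (FS S (orb (word_ball G S (Suc n)) \<alpha>)) \<le> ereal (FS S (orb (word_ball G S n) \<alpha>))"
    by (simp add: C.Phi_const C.Fval_def FS_def lcosets_carrier_eq)
qed

lemma flim_le:
  assumes S: "free_generating_set G S" "finite S" and S': "free_generating_set G S'" "finite S'"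
    and \<alpha>: "generates (carrier G) \<alpha>" and \<beta>: "generates (carrier G) \<beta>"
  shows "flim S \<alpha> \<le> ereal (FS S' \<beta>)"
proof (rule ereal_le_epsilon2)
  interpret C: free_coset_system G T events admissible ent S "carrier G"
    using S by (rule free_coset_system_whole)
  interpret C': free_coset_system G T events admissible ent S' "carrier G"
    using S' by (rule free_coset_system_whole)
  have R: "S' \<subseteq> carrier G" "finite S'" "\<one> \<notin> S'" "word_value G ` words_over S' = carrier G"
    using S' one_notin_free_generating_set C'.S_gen by simp_all
  have R': "S \<subseteq> carrier G" "finite S" "\<one> \<notin> S" "word_value G ` words_over S = carrier G"
    using S one_notin_free_generating_set C.S_gen by simp_all
  \<comment> \<open>The lower bound on generating sets, used in both directions at index 1, shows
    that \<open>S\<close> and \<open>S'\<close> have equally many elements.\<close>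
  have card: "int (card S') = int (card (lcosets (carrier G))) * (int (card S) - 1) + 1"
    using C.rose_Phi(1)[OF R admissible_empty] C'.rose_Phi(1)[OF R' admissible_empty]
    by (simp add: lcosets_carrier_eq)
  fix \<epsilon> :: real assume "0 < \<epsilon>"
  from C.index_times_Fval_le[OF R card \<alpha> \<beta> this]
  obtain k where "FS S (orb (word_ball G S k) \<alpha>) \<le> FS S' \<beta> + \<epsilon>"
    by (auto simp: C.Fval_def FS_def lcosets_carrier_eq)
  then have "ereal (FS S (orb (word_ball G S k) \<alpha>)) \<le> ereal (FS S' \<beta>) + ereal \<epsilon>" by simp
  then show "flim S \<alpha> \<le> ereal (FS S' \<beta>) + ereal \<epsilon>"
    unfolding flim_def by (rule INF_lower2[OF UNIV_I])
qed

lemma generates_orb: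
  assumes \<alpha>: "generates (carrier G) \<alpha>" and F: "finite F" "F \<subseteq> carrier G" "\<one> \<in> F"
  shows "generates (carrier G) (orb F \<alpha>)"
proof (rule generates_coarser[OF \<alpha>])
  have adm: "admissible \<alpha>" using \<alpha> by (rule generates_adm)
  then show "admissible (orb F \<alpha>)" using F by (intro orb_adm)
  fix g assume g: "g \<in> carrier G"
  have "\<alpha> \<subseteq> orb F \<alpha>" using F(3) T_image_one[OF adm] unfolding orb_def by blast
  then show "\<exists>k\<in>carrier G. T g ` \<alpha> \<subseteq> T k ` orb F \<alpha>" using g by (intro bexI[of _ g] image_mono)
qed auto

text \<open>\<open>flim_le\<close> bounds one limit by a single value of the other functional. It
  applies to every term of the other sequence, because joins over balls generate again.\<close>

lemma flim_unique:
  assumes S: "free_generating_set G S" "finite S" and S': "free_generating_set G S'" "finite S'"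
    and \<alpha>: "generates (carrier G) \<alpha>" and \<beta>: "generates (carrier G) \<beta>"
  shows "flim S \<alpha> = flim S' \<beta>"
proof (rule antisym)
  show "flim S \<alpha> \<le> flim S' \<beta>"
    unfolding flim_def[of S']
    by (intro INF_greatest flim_le[OF S S' \<alpha>] generates_orb[OF \<beta>] word_ball_props[OF S'])
  show "flim S' \<beta> \<le> flim S \<alpha>"
    unfolding flim_def[of S]
    by (intro INF_greatest flim_le[OF S' S \<beta>] generates_orb[OF \<alpha>] word_ball_props[OF S])
qed

lemma atoms_T:
  assumes g: "g \<in> carrier G" and C: "C \<subseteq> events"
  shows "atoms M (T g ` C) = T g ` atoms M C"
proof (intro subset_antisym subsetI)
  fix P assume "P \<in> atoms M (T g ` C)"
  then obtain x where x: "x \<in> space M" "P = atom M (T g ` C) x" by (auto simp: atoms_def)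
  then show "P \<in> T g ` atoms M C" using atom_T[OF g C x(1)] g by (simp add: atoms_def)
next
  fix P assume "P \<in> T g ` atoms M C"
  then obtain x where x: "x \<in> space M" "P = T g (atom M C x)" by (auto simp: atoms_def)
  then have "\<phi> g x \<in> space M" "P = atom M (T g ` C) (\<phi> g x)"
    using atom_T[OF g C, of "\<phi> g x"] g by simp_all
  then show "P \<in> atoms M (T g ` C)" by (simp add: atoms_def)
qed

lemma partition_T:
  assumes "g \<in> carrier G" "C \<subseteq> events" "partition_on (space M) C"
  shows "partition_on (space M) (T g ` C)"
  using atoms_partition[of M "T g ` C"] atoms_T[OF assms(1,2)] atoms_of_partition[OF assms(3)] by simp

lemma same_atoms:
  assumes "x \<in> space M" "y \<in> space M"
  shows "same (atoms M C) x y \<longleftrightarrow> same C x y"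
proof
  assume "same (atoms M C) x y"
  moreover have "atom M C x \<in> atoms M C" using assms by (simp add: atoms_def)
  ultimately have "y \<in> atom M C x" using atom_self[OF assms(1)] unfolding same_def by blast
  then show "same C x y" by (simp add: atom_def)
next
  assume *: "same C x y"
  show "same (atoms M C) x y"
    unfolding same_def
  proof
    fix P assume "P \<in> atoms M C"
    then obtain z where "P = atom M C z" by (auto simp: atoms_def)
    then show "x \<in> P \<longleftrightarrow> y \<in> P"
      using assms same_trans[OF _ *, of z] same_trans[OF _ same_sym[OF *], of z]
      by (auto simp: atom_def)
  qed
qed

lemma admissible_eventsD: "admissible C \<Longrightarrow> C \<subseteq> events" "admissible C \<Longrightarrow> countable C"
  "admissible C \<Longrightarrow> countable (atoms M C)" "admissible C \<Longrightarrow> atoms M C \<subseteq> events"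
  using atoms_events[of C] by (auto simp: admissible_def pre_adm_def)

lemma countable_partition_atoms: "admissible C \<Longrightarrow> countable_partition M (atoms M C)"
  using atoms_partition admissible_eventsD by (simp add: countable_partition_def)

lemma F_functional_translate_join:
  assumes \<alpha>: "countable_partition M \<alpha>" "admissible \<alpha>"
    and F: "finite F" "F \<noteq> {}" "F \<subseteq> carrier G" and S: "finite S" "S \<subseteq> carrier G"
  shows "F_functional \<phi> M S (translate_join \<phi> F \<alpha>) = ereal (FS S (orb F \<alpha>))"
proof -
  define C where "C = orb F \<alpha>"
  define D where "D = atoms M C"
  have C: "admissible C" unfolding C_def using F \<alpha> by (intro orb_adm)
  note CD = admissible_eventsD[OF C, folded D_def]
  have part: "partition_on (space M) \<alpha>" "\<alpha> \<subseteq> events" using \<alpha>(1) by (simp_all add: countable_partition_def)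
  have partD: "partition_on (space M) D" unfolding D_def by (rule atoms_partition)
  have "translate_join \<phi> F \<alpha> = common_refinement ((\<lambda>f. T f ` \<alpha>) ` F)"
    by (simp add: translate_join_def translate_eq)
  also have "\<dots> = atoms M (\<Union> ((\<lambda>f. T f ` \<alpha>) ` F))"
    by (rule common_refinement_eq_atoms) (use partition_T part F in auto)
  also have "\<dots> = D" by (simp add: D_def C_def orb_def)
  finally have join: "translate_join \<phi> F \<alpha> = D" .
  have HD: "shannon_entropy M D = ereal (ent C)" unfolding D_def by (rule shannon_entropy_admissible[OF C])
  have Hs: "shannon_entropy M (common_refinement {translate \<phi> s D, D}) = ereal (ent (C \<union> T s ` C))"
    if s: "s \<in> S" for s
  proof -
    have sc: "s \<in> carrier G" using s S by auto
    have "common_refinement {translate \<phi> s D, D} = atoms M (\<Union> {T s ` D, D})"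
      unfolding translate_eq by (rule common_refinement_eq_atoms) (use partition_T[OF sc CD(4) partD] partD in auto)
    then have cr: "common_refinement {translate \<phi> s D, D} = atoms M (T s ` D \<union> D)" by simp
    have adm: "admissible (C \<union> T s ` C)" using C sc by (intro admissible_Un admissible_T)
    \<comment> \<open>The functional joins the atoms of \<open>C\<close> with their translates
      instead of \<open>C\<close> with its translate: different collections, but the same
      classes.\<close>
    have eq: "same (C \<union> T s ` C) x y \<longleftrightarrow> same (T s ` D \<union> D) x y" if "x \<in> space M" "y \<in> space M" for x y
      using that sc CD same_T[OF sc _ that] same_atoms[of x y C] same_atoms[of "\<phi> (inv s) x" "\<phi> (inv s) y" C]
      by (auto simp: same_Un D_def)
    have TD: "countable (T s ` D \<union> D)" "T s ` D \<union> D \<subseteq> events"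
      using CD T_events[OF sc CD(4)] by auto
    note adm' = admissible_cong[OF eq adm TD]
    show ?thesis using shannon_entropy_admissible[OF adm'(1)] adm'(2) by (simp add: cr)
  qed
  have "F_functional \<phi> M S D = ereal (1 - 2 * real (card S)) * ereal (ent C) + (\<Sum>s\<in>S. ereal (ent (C \<union> T s ` C)))"
    unfolding F_functional_def HD using Hs by simp
  also have "\<dots> = ereal ((1 - 2 * real (card S)) * ent C + (\<Sum>s\<in>S. ent (C \<union> T s ` C)))"
    by simp
  \<comment> \<open>Each \<open>J C s C\<close> is twice the entropy of \<open>C\<close> minus a
    joint entropy, which accounts for the coefficient \<open>1 - 2 * card S\<close>.\<close>
  also have "(1 - 2 * real (card S)) * ent C + (\<Sum>s\<in>S. ent (C \<union> T s ` C)) = FS S C"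
    by (simp add: FS_def J_def sum_subtractf algebra_simps)
  finally show ?thesis by (simp add: join C_def)
qed

text \<open>Convergence supplies a witness for the definite description, and
  \<open>flim_unique\<close> its uniqueness over all bases and generating partitions.\<close>

lemma f_entropy_eq:
  assumes S: "free_generating_set G S" "finite S"
    and \<alpha>: "generating_partition G \<phi> M \<alpha>" "shannon_entropy M \<alpha> < \<infinity>"
  shows "f_entropy G \<phi> M = flim S \<alpha>"
proof -
  have lim: "(\<lambda>n. F_functional \<phi> M S' (translate_join \<phi> (word_ball G S' n) \<beta>)) \<longlonglongrightarrow> flim S' \<beta>"
    and gen: "generates (carrier G) \<beta>"
    if S': "free_generating_set G S'" "finite S'"
      and \<beta>: "generating_partition G \<phi> M \<beta>" "shannon_entropy M \<beta> < \<infinity>" for S' \<beta>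
  proof -
    have cp: "countable_partition M \<beta>" using \<beta> by (simp add: generating_partition_def)
    have adm: "admissible \<beta>" using admissible_partition[OF cp \<beta>(2)] .
    show "generates (carrier G) \<beta>" using \<beta>(1) adm by (rule generating_partition_generates)
    have "S' \<subseteq> carrier G" using S' by (simp add: free_generating_set_def)
    then have "F_functional \<phi> M S' (translate_join \<phi> (word_ball G S' n) \<beta>) =
        ereal (FS S' (orb (word_ball G S' n) \<beta>))" for n
      using word_ball_props[OF S', of n] S' by (intro F_functional_translate_join cp adm) auto
    then show "(\<lambda>n. F_functional \<phi> M S' (translate_join \<phi> (word_ball G S' n) \<beta>)) \<longlonglongrightarrow> flim S' \<beta>"
      using FS_convergent[OF S' adm] by simp
  qed
  show ?thesis
    unfolding f_entropy_def
  proof (rule the_equality)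
    show "\<exists>S' \<beta>. finite S' \<and> free_generating_set G S' \<and> generating_partition G \<phi> M \<beta> \<and>
        shannon_entropy M \<beta> < \<infinity> \<and>
        (\<lambda>n. F_functional \<phi> M S' (translate_join \<phi> (word_ball G S' n) \<beta>)) \<longlonglongrightarrow> flim S \<alpha>"
      using S \<alpha> lim[OF S \<alpha>] by blast
    fix v assume "\<exists>S \<alpha>. finite S \<and> free_generating_set G S \<and> generating_partition G \<phi> M \<alpha> \<and>
        shannon_entropy M \<alpha> < \<infinity> \<and>
        (\<lambda>n. F_functional \<phi> M S (translate_join \<phi> (word_ball G S n) \<alpha>)) \<longlonglongrightarrow> v"
    then obtain S' \<beta> where S': "finite S'" "free_generating_set G S'"
      and \<beta>: "generating_partition G \<phi> M \<beta>" "shannon_entropy M \<beta> < \<infinity>"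
      and v: "(\<lambda>n. F_functional \<phi> M S' (translate_join \<phi> (word_ball G S' n) \<beta>)) \<longlonglongrightarrow> v" by blast
    have "v = flim S' \<beta>" using LIMSEQ_unique[OF v lim[OF S'(2,1) \<beta>]] .
    also have "\<dots> = flim S \<alpha>" by (rule flim_unique[OF S'(2,1) S gen[OF S'(2,1) \<beta>] gen[OF S \<alpha>]])
    finally show "v = flim S \<alpha>" .
  qed
qed

lemma invariant_sigma_algebra_mono:
  assumes K: "K \<subseteq> carrier G" and C: "admissible C" and \<alpha>: "\<alpha> \<subseteq> events"
    and cover: "\<And>g. g \<in> carrier G \<Longrightarrow> \<exists>k\<in>K. \<exists>r\<in>carrier G. g = k \<otimes> r \<and> T r ` \<alpha> \<subseteq> C"
  shows "invariant_sigma_algebra G \<phi> M \<alpha> \<subseteq> invariant_sigma_algebra (G\<lparr>carrier := K\<rparr>) \<phi> M (atoms M C)"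
  unfolding invariant_sigma_algebra_def[of "G\<lparr>carrier := K\<rparr>"]
proof (rule Inter_greatest, elim CollectE conjE)
  fix \<Sigma> assume \<Sigma>: "sigma_algebra (space M) \<Sigma>" "atoms M C \<subseteq> \<Sigma>"
    "\<forall>g\<in>carrier (G\<lparr>carrier := K\<rparr>). \<forall>A\<in>\<Sigma>. \<phi> g ` A \<in> \<Sigma>"
  interpret \<Sigma>: sigma_algebra "space M" \<Sigma> by fact
  \<comment> \<open>A \<open>K\<close>-invariant \<Sigma> need not be \<open>G\<close>-invariant.
    The sets all of whose \<open>G\<close>-translates lie in \<Sigma> form a \<sigma>-algebra that
    is.\<close>
  define \<Sigma>' where "\<Sigma>' = {A \<in> \<Sigma>. \<forall>g\<in>carrier G. \<phi> g ` A \<in> \<Sigma>}"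
  have C\<Sigma>: "A \<in> \<Sigma>" if A: "A \<in> C" for A
  proof -
    have "A \<subseteq> space M" using A admissible_eventsD(1)[OF C] sets.sets_into_space by blast
    have "A = \<Union>{P \<in> atoms M C. P \<subseteq> A}"
    proof (intro subset_antisym subsetI)
      fix x assume x: "x \<in> A"
      then have "x \<in> space M" using \<open>A \<subseteq> space M\<close> by blast
      moreover have "atom M C x \<subseteq> A" using x A by (auto simp: atom_def same_def)
      ultimately show "x \<in> \<Union>{P \<in> atoms M C. P \<subseteq> A}"
        using atom_self[of x M C] by (auto simp: atoms_def)
    qed blast
    moreover have "countable {P \<in> atoms M C. P \<subseteq> A}"
      using admissible_eventsD(3)[OF C] by (rule countable_subset[rotated]) blast
    then have "\<Union>{P \<in> atoms M C. P \<subseteq> A} \<in> \<Sigma>" using \<Sigma>(2) by (intro \<Sigma>.countable_Union) auto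
    ultimately show ?thesis by simp
  qed
  have \<alpha>\<Sigma>: "\<phi> g ` A \<in> \<Sigma>" if A: "A \<in> \<alpha>" and g: "g \<in> carrier G" for A g
  proof -
    obtain k r where kr: "k \<in> K" "r \<in> carrier G" "g = k \<otimes> r" "T r ` \<alpha> \<subseteq> C" using cover[OF g] by blast
    have kc: "k \<in> carrier G" using kr(1) K by blast
    have "T r A \<in> \<Sigma>" using kr(4) A C\<Sigma> by blast
    then have "T k (T r A) \<in> \<Sigma>" using \<Sigma>(3) kr(1) by (simp add: T_def)
    moreover have "T k (T r A) = T g A" using T_mult[OF kc kr(2), of A] A \<alpha> kr(3) by auto
    ultimately show ?thesis by (simp add: T_def)
  qed
  have "invariant_sigma_algebra G \<phi> M \<alpha> \<subseteq> \<Sigma>'"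
    unfolding invariant_sigma_algebra_def
  proof (intro Inter_lower CollectI conjI ballI)
    show "sigma_algebra (space M) \<Sigma>'"
      unfolding sigma_algebra_iff2
    proof (intro conjI ballI allI impI)
      show "\<Sigma>' \<subseteq> Pow (space M)" using \<Sigma>.space_closed by (auto simp: \<Sigma>'_def)
      show "{} \<in> \<Sigma>'" by (simp add: \<Sigma>'_def)
    next
      fix A assume A: "A \<in> \<Sigma>'"
      have "\<phi> g ` (space M - A) = space M - \<phi> g ` A" if g: "g \<in> carrier G" for g
      proof -
        have "A \<subseteq> space M" using A \<Sigma>.space_closed by (auto simp: \<Sigma>'_def)
        then show ?thesis using g by (auto simp: \<phi>_image)
      qed
      then show "space M - A \<in> \<Sigma>'" using A by (auto simp: \<Sigma>'_def)
    next
      fix A :: "nat \<Rightarrow> 'x set" assume "range A \<subseteq> \<Sigma>'"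
      then show "(\<Union>n. A n) \<in> \<Sigma>'" unfolding \<Sigma>'_def by (auto simp: image_UN subset_iff)
    qed
    show "\<alpha> \<subseteq> \<Sigma>'"
    proof
      fix A assume A: "A \<in> \<alpha>"
      have "A \<subseteq> space M" using A \<alpha> sets.sets_into_space by blast
      then have "\<phi> \<one> ` A = A" by (force simp: subset_iff)
      then show "A \<in> \<Sigma>'" using \<alpha>\<Sigma>[OF A] \<alpha>\<Sigma>[OF A one_closed] by (simp add: \<Sigma>'_def)
    qed
    fix g A assume g: "g \<in> carrier G" and A: "A \<in> \<Sigma>'"
    have "\<phi> k ` \<phi> g ` A = \<phi> (k \<otimes> g) ` A" if k: "k \<in> carrier G" for k
    proof -
      have "A \<subseteq> space M" using A \<Sigma>.space_closed by (auto simp: \<Sigma>'_def)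
      then show ?thesis unfolding image_image using g k \<phi>_mult by (intro image_cong) (auto simp: subset_iff)
    qed
    then show "\<phi> g ` A \<in> \<Sigma>'" using A g by (simp add: \<Sigma>'_def)
  qed
  then show "invariant_sigma_algebra G \<phi> M \<alpha> \<subseteq> \<Sigma>" by (auto simp: \<Sigma>'_def)
qed

text \<open>Invariance under \<open>G\<close> is the stronger condition, so the intersection runs
  over fewer \<sigma>-algebras and is larger.\<close>

lemma generating_partition_supergroup:
  assumes "subgroup H G" "generating_partition (G\<lparr>carrier := H\<rparr>) \<phi> M \<alpha>"
  shows "generating_partition G \<phi> M \<alpha>"
proof -
  have "H \<subseteq> carrier G" using assms(1) by (rule subgroup.subset)
  then have "invariant_sigma_algebra (G\<lparr>carrier := H\<rparr>) \<phi> M \<alpha> \<subseteq> invariant_sigma_algebra G \<phi> M \<alpha>"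
    unfolding invariant_sigma_algebra_def by (intro Inter_anti_mono) auto
  then show ?thesis using assms(2) unfolding generating_partition_def by blast
qed

theorem f_entropy_finite_index:
  assumes S: "free_generating_set G S" "finite S" and H: "subgroup H G" "finite (lcosets H)"
    and \<alpha>: "generating_partition G \<phi> M \<alpha>" "shannon_entropy M \<alpha> < \<infinity>"
  shows "f_entropy_defined (G\<lparr>carrier := H\<rparr>) \<phi> M \<and>
    f_entropy (G\<lparr>carrier := H\<rparr>) \<phi> M = ereal (real (card (lcosets H))) * f_entropy G \<phi> M"
proof -
  interpret C: free_coset_system G T events admissible ent S H
    using S H by (rule free_coset_systemI)
  obtain D \<tau> where "schreier_tree G T events admissible ent S H D \<tau>" using C.ex_schreier_tree by blast
  then interpret R: schreier_tree G T events admissible ent S H D \<tau> .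
  let ?H = "G\<lparr>carrier := H\<rparr>"
  interpret HP: pmp_system M ?H \<phi> using H(1) by (rule pmp_system_subgroup)
  define B where "B C = (\<Union>v\<in>lcosets H. T (inv (\<tau> v)) ` C)" for C
  have basis: "free_generating_set ?H R.basis" "finite R.basis"
    using R.free_generating_set_basis R.finite_basis by auto
  have Rcond: "R.basis \<subseteq> H" "finite R.basis" "\<one> \<notin> R.basis" "word_value G ` words_over R.basis = H"
    using R.basis_K R.finite_basis HP.one_notin_free_generating_set[OF basis(1)] R.basis_words by auto
  have cp: "countable_partition M \<alpha>" using \<alpha> by (simp add: generating_partition_def)
  have adm: "admissible \<alpha>" using admissible_partition[OF cp \<alpha>(2)] .
  have gen: "generates (carrier G) \<alpha>" using \<alpha>(1) adm by (rule generating_partition_generates)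
  have admB: "admissible (B C)" if "admissible C" for C
    unfolding B_def using that by (intro adm_UN adm_T) auto
  define \<beta> where "\<beta> = atoms M (B \<alpha>)"
  have cover: "\<exists>k\<in>H. \<exists>r\<in>carrier G. g = k \<otimes> r \<and> T r ` \<alpha> \<subseteq> B \<alpha>" if "g \<in> carrier G" for g
  proof -
    obtain k v where "k \<in> H" "v \<in> lcosets H" "g = k \<otimes> inv (\<tau> v)"
      using R.ex_coset_representation[OF \<open>g \<in> carrier G\<close>] by blast
    then show ?thesis unfolding B_def by (intro bexI[of _ k] bexI[of _ "inv (\<tau> v)"]) auto
  qed
  have "invariant_sigma_algebra G \<phi> M \<alpha> \<subseteq> invariant_sigma_algebra ?H \<phi> M \<beta>"
    unfolding \<beta>_def using C.K_carrier admB[OF adm] admissible_eventsD(1)[OF adm] cover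
    by (rule invariant_sigma_algebra_mono)
  then have \<beta>: "generating_partition ?H \<phi> M \<beta>"
    using \<alpha>(1) countable_partition_atoms[OF admB[OF adm]]
    unfolding generating_partition_def \<beta>_def by blast
  have H\<beta>: "shannon_entropy M \<beta> < \<infinity>"
    unfolding \<beta>_def shannon_entropy_admissible[OF admB[OF adm]] by simp
  have defd: "f_entropy_defined ?H \<phi> M"
    unfolding f_entropy_defined_def fg_free_group_def using HP.is_group basis \<beta> H\<beta> by blast
  have adm\<beta>: "admissible \<beta>"
    using \<beta> H\<beta> admissible_partition by (simp add: generating_partition_def)
  have gen\<beta>: "HP.generates H \<beta>" using HP.generating_partition_generates[OF \<beta> adm\<beta>] by simp
  have fG: "f_entropy G \<phi> M = flim S \<alpha>" using S \<alpha> by (rule f_entropy_eq)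
  have fH: "f_entropy ?H \<phi> M = HP.flim R.basis \<beta>" using basis \<beta> H\<beta> by (rule HP.f_entropy_eq)
  let ?N = "real (card (lcosets H))"
  let ?a = "\<lambda>n. FS S (orb (word_ball G S n) \<alpha>)"
  have lim: "(\<lambda>n. ereal ?N * ereal (?a n)) \<longlonglongrightarrow> ereal ?N * flim S \<alpha>"
    using FS_convergent[OF S adm] by (intro tendsto_cmult_ereal) auto
  \<comment> \<open>For every \<open>n\<close> the union \<open>B C\<close> is another generating
    collection for the subgroup. \<open>HP.flim_le\<close> allows comparing the fixed limit for
    \<beta> with all of them.\<close>
  have "HP.flim R.basis \<beta> \<le> ereal ?N * flim S \<alpha>"
  proof (rule LIMSEQ_le_const[OF lim], intro exI allI impI)
    fix n
    define C where "C = orb (word_ball G S n) \<alpha>"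
    have genC: "generates (carrier G) C"
      unfolding C_def using word_ball_props[OF S] by (intro generates_orb gen)
    have "HP.generates H (B C)" using R.generates_union[OF genC] by (simp add: B_def)
    then have "HP.flim R.basis \<beta> \<le> ereal (HP.FS R.basis (B C))"
      using HP.flim_le[OF basis basis, of \<beta> "B C"] gen\<beta> by simp
    also have "HP.FS R.basis (B C) \<le> ?N * FS S C"
      using R.basis_entropy[OF generates_adm[OF genC]]
      by (simp add: HP.FS_def FS_def B_def C.Fval_def)
    finally show "HP.flim R.basis \<beta> \<le> ereal ?N * ereal (?a n)" by (simp add: C_def)
  qed
  \<comment> \<open>For the opposite bound each term of the subgroup's sequence is the value of a
    rose on the Schreier basis, to which foldings apply.\<close>
  moreover have "ereal ?N * flim S \<alpha> \<le> HP.flim R.basis \<beta>"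
    unfolding HP.flim_def
  proof (rule INF_greatest)
    fix n
    define C where "C = HP.orb (word_ball ?H R.basis n) \<beta>"
    have genC: "HP.generates H C"
      using HP.generates_orb[of \<beta>] HP.word_ball_props[OF basis] gen\<beta> by (simp add: C_def)
    show "ereal ?N * flim S \<alpha> \<le> ereal (HP.FS R.basis (HP.orb (word_ball ?H R.basis n) \<beta>))"
    proof (rule ereal_le_epsilon2)
      fix \<epsilon> :: real assume "0 < \<epsilon>"
      from C.index_times_Fval_le[OF Rcond R.card_basis gen genC this]
      obtain k where k: "?N * ?a k \<le> HP.FS R.basis C + \<epsilon>"
        by (auto simp: C.Fval_def FS_def HP.FS_def)
      have "ereal ?N * flim S \<alpha> \<le> ereal ?N * ereal (?a k)"
        unfolding flim_def by (intro ereal_mult_left_mono INF_lower) auto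
      also have "\<dots> \<le> ereal (HP.FS R.basis C + \<epsilon>)" using k by simp
      finally show "ereal ?N * flim S \<alpha> \<le> ereal (HP.FS R.basis (HP.orb (word_ball ?H R.basis n) \<beta>)) + ereal \<epsilon>"
        by (simp add: C_def)
    qed
  qed
  ultimately have "HP.flim R.basis \<beta> = ereal ?N * flim S \<alpha>" by (rule antisym)
  then show ?thesis using defd fG fH by simp
qed

end

theorem theorem1p1:
  fixes G :: "('g, 'b) monoid_scheme" and H :: "'g set"
    and \<phi> :: "'g \<Rightarrow> 'x \<Rightarrow> 'x" and M :: "'x measure"
  assumes "fg_free_group G"
    and "subgroup H G"
    and "finite (rcosets\<^bsub>G\<^esub> H)"
    and "standard_probability_space M"
    and "pmp_action G \<phi> M"
    and "f_entropy_defined G \<phi> M \<or> f_entropy_defined (G\<lparr>carrier := H\<rparr>) \<phi> M"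
  shows "f_entropy_defined G \<phi> M \<and> f_entropy_defined (G\<lparr>carrier := H\<rparr>) \<phi> M \<and>
    f_entropy (G\<lparr>carrier := H\<rparr>) \<phi> M = ereal (real (card (rcosets\<^bsub>G\<^esub> H))) * f_entropy G \<phi> M"
proof -
  interpret group G using assms(1) by (simp add: fg_free_group_def)
  interpret prob_space M using assms(4) by (simp add: standard_probability_space_def)
  interpret pmp_system M G \<phi> using assms(5) by unfold_locales
  obtain S where S: "free_generating_set G S" "finite S" using assms(1) by (auto simp: fg_free_group_def)
  note bij = bij_betw_rcosets_lcosets[OF assms(2)]
  have card: "card (lcosets\<^bsub>G\<^esub> H) = card (rcosets\<^bsub>G\<^esub> H)" using bij_betw_same_card[OF bij] by simp
  have fin: "finite (lcosets\<^bsub>G\<^esub> H)" using bij_betw_finite[OF bij] assms(3) by simp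
  \<comment> \<open>Either alternative yields a generating partition for \<open>G\<close>, as one
    for the subgroup also generates for \<open>G\<close>.\<close>
  obtain \<alpha> where \<alpha>: "generating_partition G \<phi> M \<alpha>" "shannon_entropy M \<alpha> < \<infinity>"
    using assms(6) generating_partition_supergroup[OF assms(2)] unfolding f_entropy_defined_def by blast
  have "f_entropy_defined G \<phi> M" using assms(1) \<alpha> unfolding f_entropy_defined_def by blast
  with f_entropy_finite_index[OF S assms(2) fin \<alpha>] card show ?thesis by simp
qed

end
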